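(* Let $A$ be a $2\times 2$ real symmetric positive-semidefinite matrix and let $f:\mathbb{H}\times\mathbb{R}^2\to\mathbb{R}$ satisfy: (A1) there exists $L_1>0$ such that $|f(p,w_1)-f(p,w_2)|\le L_1|w_1-w_2|$ for all $p\in\mathbb{H}$, $w_1,w_2\in\mathbb{R}^2$; (A2) for every $\rho>0$ there exists $L_2(\rho)>0$ such that $|f(p,w)-f(q,w)|\le L_2(\rho)\,|p\cdot q^{-1}|_G$ for all $p,q\in\mathbb{H}$ with $|p|,|q|\le\rho$ and all $w\in\mathbb{R}^2$; (A3) there exists $C_f>0$ such that $|f(p,\xi)|\le C_f(1+|\xi|)$ for all $p\in\mathbb{H}$, $\xi\in\mathbb{R}^2$; and the concavity condition $$f(h^{-1}\cdot p,\xi)+f(h\cdot p,\eta)\le2f\left(p,\tfrac12(\xi+\eta)\right)$$ for all $p\in\mathbb{H}$, $h\in\mathbb{H}_0$ and $\xi,\eta\in\mathbb{R}^2$. Let $u\in C(\mathbb{H}\times[0,\infty))$ be the unique viscosity solution of $$u_t-\operatorname{tr}\left(A(\nabla_H^2u)^\ast\right)+f(p,\nabla_Hu)=0\ \text{ in }\mathbb{H}\times(0,\infty),\qquad u(\cdot,0)=u_0\ \text{ in }\mathbb{H},$$ satisfying the growth condition (G) for any $T>0$ there exist $k>0$ and $C_T>0$ such that $|u(p,t)|\le C_Te^{k\langle p\rangle}$ for all $(p,t)\in\mathbb{H}\times[0,T]$. Assume in addition that for any $t\ge0$, $u(\cdot,t)$ either is an even or vertically even function or has a separable structure, i.e. is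 of the form $(x,y,z)\mapsto a(x,y)+b(z)$ for some functions $a:\mathbb{R}^2\to\mathbb{R}$ and $b:\mathbb{R}\to\mathbb{R}$. If $u_0$ is h-convex in $\mathbb{H}$, then so is $u(\cdot,t)$ in $\mathbb{H}$ for all $t\ge0$.
   Context: The Heisenberg group $\mathbb{H}$ is $\mathbb{R}^3$ with the group law $(x_p,y_p,z_p)\cdot(x_q,y_q,z_q)=\left(x_p+x_q,\,y_p+y_q,\,z_p+z_q+\tfrac12(x_py_q-x_qy_p)\right)$; the inverse of $p=(x,y,z)$ is $p^{-1}=(-x,-y,-z)$. Set $\mathbb{H}_0=\{(h_1,h_2,0):h_1,h_2\in\mathbb{R}\}\subset\mathbb{H}$. The Korányi gauge is $|p|_G=\left((x^2+y^2)^2+16z^2\right)^{1/4}$; $|p|$ is the Euclidean norm; $\langle p\rangle=(1+x^4+y^4+16z^2)^{1/4}$ for $p=(x,y,z)$. An upper semicontinuous function $w:\mathbb{H}\to\mathbb{R}$ is h-convex (horizontally convex) in $\mathbb{H}$ if $w(p\cdot h^{-1})+w(p\cdot h)\ge2w(p)$ for all $p\in\mathbb{H}$ and $h\in\mathbb{H}_0$. A function $w:\mathbb{H}\to\mathbb{R}$ is even if $w(p)=w(p^{-1})$ for all $p$, and vertically even if $w(x,y,z)=w(x,y,-z)$ for all $(x,y,z)$. Left-invariant vector fields: $X_1=\partial_x-\tfrac y2\partial_z$, $X_2=\partial_y+\tfrac x2\partial_z$. The horizontal gradient is $\nabla_Hu=(X_1u,X_2u)$, and the symmetrized horizontal Hessian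 $(\nabla_H^2u)^\ast$ is the symmetric $2\times2$ matrix with diagonal entries $X_1^2u$, $X_2^2u$ and off-diagonal entries $\tfrac12(X_1X_2u+X_2X_1u)$ (derivatives in the space variable only). Viscosity notions: an upper semicontinuous (resp. lower semicontinuous) function $u$ is a viscosity subsolution (resp. supersolution) of the equation in $\mathbb{H}\times(0,\infty)$ if, whenever $\phi$ is $C^2$ near $(p_0,t_0)\in\mathbb{H}\times(0,\infty)$ and $u-\phi$ has a local maximum (resp. minimum) at $(p_0,t_0)$, one has $\phi_t-\operatorname{tr}(A(\nabla_H^2\phi)^\ast)+f(p_0,\nabla_H\phi)\le0$ (resp. $\ge0$) at $(p_0,t_0)$. A continuous function is a viscosity solution if it is both. *)

theory Defs
  imports "HOL-Analysis.Analysis"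
begin

section \<open>The Heisenberg group\<close>

text \<open>The underlying set is \<open>real^3\<close>, whose library norm is the Euclidean norm.\<close>

definition hmult :: "real^3 \<Rightarrow> real^3 \<Rightarrow> real^3"  (infixl "\<odot>" 70) where
  "p \<odot> q = vector [p$1 + q$1, p$2 + q$2, p$3 + q$3 + (p$1 * q$2 - q$1 * p$2) / 2]"

definition hinv :: "real^3 \<Rightarrow> real^3" where
  "hinv p = vector [- (p$1), - (p$2), - (p$3)]"

definition horizontal :: "(real^3) set" where
  "horizontal = {vector [h1, h2, 0] | h1 h2. True}"

definition koranyi_gauge :: "real^3 \<Rightarrow> real" where
  "koranyi_gauge p = root 4 (((p$1)\<^sup>2 + (p$2)\<^sup>2)\<^sup>2 + 16 * (p$3)\<^sup>2)"

definition jbracket :: "real^3 \<Rightarrow> real" where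
  "jbracket p = root 4 (1 + (p$1)^4 + (p$2)^4 + 16 * (p$3)\<^sup>2)"

section \<open>Semicontinuity, horizontal convexity and symmetries\<close>

definition usc_on :: "'a::topological_space set \<Rightarrow> ('a \<Rightarrow> real) \<Rightarrow> bool" where
  "usc_on S w \<longleftrightarrow> (\<forall>x\<in>S. \<forall>c. w x < c \<longrightarrow> (\<forall>\<^sub>F y in at x within S. w y < c))"

definition lsc_on :: "'a::topological_space set \<Rightarrow> ('a \<Rightarrow> real) \<Rightarrow> bool" where
  "lsc_on S w \<longleftrightarrow> (\<forall>x\<in>S. \<forall>c. c < w x \<longrightarrow> (\<forall>\<^sub>F y in at x within S. c < w y))"

definition h_convex :: "(real^3 \<Rightarrow> real) \<Rightarrow> bool" where
  "h_convex w \<longleftrightarrow> usc_on UNIV w \<and>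
     (\<forall>p. \<forall>h\<in>horizontal. w (p \<odot> hinv h) + w (p \<odot> h) \<ge> 2 * w p)"

definition even_fun :: "(real^3 \<Rightarrow> real) \<Rightarrow> bool" where
  "even_fun w \<longleftrightarrow> (\<forall>p. w p = w (hinv p))"

definition vertically_even :: "(real^3 \<Rightarrow> real) \<Rightarrow> bool" where
  "vertically_even w \<longleftrightarrow> (\<forall>x y z. w (vector [x, y, z]) = w (vector [x, y, - z]))"

definition separable_fun :: "(real^3 \<Rightarrow> real) \<Rightarrow> bool" where
  "separable_fun w \<longleftrightarrow>
     (\<exists>(a :: real \<Rightarrow> real \<Rightarrow> real) (b :: real \<Rightarrow> real).
        \<forall>x y z. w (vector [x, y, z]) = a x y + b z)"

section \<open>Horizontal derivatives\<close>

definition partial :: "'n \<Rightarrow> (real^'n \<Rightarrow> real) \<Rightarrow> real^'n \<Rightarrow> real" where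
  "partial i v p = deriv (\<lambda>s. v (p + s *\<^sub>R axis i 1)) 0"

definition X1 :: "(real^3 \<Rightarrow> real) \<Rightarrow> real^3 \<Rightarrow> real" where
  "X1 v p = partial 1 v p - p$2 / 2 * partial 3 v p"

definition X2 :: "(real^3 \<Rightarrow> real) \<Rightarrow> real^3 \<Rightarrow> real" where
  "X2 v p = partial 2 v p + p$1 / 2 * partial 3 v p"

definition hgrad :: "(real^3 \<Rightarrow> real) \<Rightarrow> real^3 \<Rightarrow> real^2" where
  "hgrad v p = vector [X1 v p, X2 v p]"

definition hhess_sym :: "(real^3 \<Rightarrow> real) \<Rightarrow> real^3 \<Rightarrow> real^2^2" where
  "hhess_sym v p =
     (let m = (X1 (X2 v) p + X2 (X1 v) p) / 2
      in vector [vector [X1 (X1 v) p, m], vector [m, X2 (X2 v) p]])"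

section \<open>Viscosity solutions\<close>

text \<open>Both predicates are meant for open \<open>S\<close>. In \<open>C2_on\<close> the Frechet derivative,
  a map into the normed space of bounded linear functionals, is itself required to be \<open>C1\<close>.\<close>

definition C1_on :: "'a::real_normed_vector set \<Rightarrow> ('a \<Rightarrow> 'b::real_normed_vector) \<Rightarrow> bool" where
  "C1_on S g \<longleftrightarrow>
     (\<exists>g' :: 'a \<Rightarrow> 'a \<Rightarrow>\<^sub>L 'b.
        (\<forall>x\<in>S. (g has_derivative blinfun_apply (g' x)) (at x)) \<and> continuous_on S g')"

definition C2_on :: "'a::real_normed_vector set \<Rightarrow> ('a \<Rightarrow> 'b::real_normed_vector) \<Rightarrow> bool" where
  "C2_on S g \<longleftrightarrow>
     (\<exists>g' :: 'a \<Rightarrow> 'a \<Rightarrow>\<^sub>L 'b.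
        (\<forall>x\<in>S. (g has_derivative blinfun_apply (g' x)) (at x)) \<and> C1_on S g')"

definition C2_near :: "'a::real_normed_vector \<Rightarrow> ('a \<Rightarrow> 'b::real_normed_vector) \<Rightarrow> bool" where
  "C2_near x g \<longleftrightarrow> (\<exists>S. open S \<and> x \<in> S \<and> C2_on S g)"

definition local_max_at :: "'a::topological_space \<Rightarrow> ('a \<Rightarrow> real) \<Rightarrow> bool" where
  "local_max_at x g \<longleftrightarrow> (\<forall>\<^sub>F y in nhds x. g y \<le> g x)"

definition local_min_at :: "'a::topological_space \<Rightarrow> ('a \<Rightarrow> real) \<Rightarrow> bool" where
  "local_min_at x g \<longleftrightarrow> (\<forall>\<^sub>F y in nhds x. g x \<le> g y)"

definition spacetime :: "((real^3) \<times> real) set" where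
  "spacetime = UNIV \<times> {0<..}"

text \<open>The left-hand side of the equation for a test function, at the point \<open>(p, t)\<close>.\<close>

definition parabolic_op ::
  "real^2^2 \<Rightarrow> (real^3 \<Rightarrow> real^2 \<Rightarrow> real) \<Rightarrow> ((real^3) \<times> real \<Rightarrow> real) \<Rightarrow> real^3 \<Rightarrow> real \<Rightarrow> real" where
  "parabolic_op A f \<phi> p t =
     deriv (\<lambda>s. \<phi> (p, s)) t
     - trace (A ** hhess_sym (\<lambda>q. \<phi> (q, t)) p)
     + f p (hgrad (\<lambda>q. \<phi> (q, t)) p)"

text \<open>As \<open>spacetime\<close> is open, a local extremum relative to \<open>spacetime\<close> at one of its points
  is the same as a local extremum in \<open>(real^3) \<times> real\<close>.\<close>

definition visc_subsolution ::
  "real^2^2 \<Rightarrow> (real^3 \<Rightarrow> real^2 \<Rightarrow> real) \<Rightarrow> ((real^3) \<times> real \<Rightarrow> real) \<Rightarrow> bool" where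
  "visc_subsolution A f u \<longleftrightarrow> usc_on spacetime u \<and>
     (\<forall>\<phi> p0 t0. (p0, t0) \<in> spacetime \<and> C2_near (p0, t0) \<phi> \<and>
        local_max_at (p0, t0) (\<lambda>q. u q - \<phi> q) \<longrightarrow> parabolic_op A f \<phi> p0 t0 \<le> 0)"

definition visc_supersolution ::
  "real^2^2 \<Rightarrow> (real^3 \<Rightarrow> real^2 \<Rightarrow> real) \<Rightarrow> ((real^3) \<times> real \<Rightarrow> real) \<Rightarrow> bool" where
  "visc_supersolution A f u \<longleftrightarrow> lsc_on spacetime u \<and>
     (\<forall>\<phi> p0 t0. (p0, t0) \<in> spacetime \<and> C2_near (p0, t0) \<phi> \<and>
        local_min_at (p0, t0) (\<lambda>q. u q - \<phi> q) \<longrightarrow> parabolic_op A f \<phi> p0 t0 \<ge> 0)"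

definition visc_solution ::
  "real^2^2 \<Rightarrow> (real^3 \<Rightarrow> real^2 \<Rightarrow> real) \<Rightarrow> ((real^3) \<times> real \<Rightarrow> real) \<Rightarrow> bool" where
  "visc_solution A f u \<longleftrightarrow> continuous_on spacetime u \<and>
     visc_subsolution A f u \<and> visc_supersolution A f u"

definition exp_growth :: "((real^3) \<times> real \<Rightarrow> real) \<Rightarrow> bool" where
  "exp_growth u \<longleftrightarrow>
     (\<forall>T>0. \<exists>k>0. \<exists>C>0. \<forall>p. \<forall>t\<in>{0..T}. \<bar>u (p, t)\<bar> \<le> C * exp (k * jbracket p))"

end

(* Left translations of the Heisenberg group commute with the equation, so for horizontal h the
   functions u(h p) and u(h^-1 p) solve equations of the same type, and the concavity condition makes
   their average V a supersolution. The symmetry of u turns h-convexity into u <= V, which is then a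
   comparison statement.

   To compare without the theorem on sums, V is mollified by left translations, which commute with
   the equation. By concavity f is near each point below an affine function, up to a small error, so
   the solution is locally a supersolution of linear left-invariant equations. A continuous viscosity
   supersolution of such a linear equation dominates the smooth functions obtained from the resolvent
   of an approximating random walk on the group; this relation is linear, so it can be averaged, and
   the mollification is a classical supersolution. The subsolution u is compared with this smooth
   function plus a barrier of exponential growth at a maximum point. *)

theory Submission
  imports Defs
begin

section \<open>The group structure on space-time and second-order jets\<close>

text \<open>Two sides of the group must be kept apart. Jets are taken along right increments
  \<open>P \<star> Q\<close>, which produces left-invariant derivatives; mollification acts on the
  left factor of \<open>g \<star> P\<close>; associativity makes them commute. Condition (A2)
  measures \<open>p \<odot> hinv q\<close>, and the quotient of
  \<open>H \<star> (g \<star> P)\<close> by \<open>H \<star> P\<close> is the conjugate of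
  \<open>g\<close> by \<open>H\<close>, so freezing \<open>f\<close> over a mollification ball costs
  an error independent of the point. h-convexity lives on the other side, in
  \<open>p \<odot> h\<close>: the symmetry is applied at time 0 to pass to
  \<open>h \<odot> p\<close> and at time \<open>t\<close> to return. The obstacle is that a
  viscosity inequality holds only at touching points and cannot be integrated. The resolvent
  equation with parameter \<open>l\<close> turns it into a pointwise inequality between functions
  with error about \<open>c / l\<close>, which can be averaged; multiplying by \<open>l\<close>
  afterwards recovers the bound \<open>c\<close> on the generator. The random walk supplies a
  resolvent by a contraction, without existence theory for the equation, but one that is merely
  continuous; an inner mollification gives it the derivatives needed in the comparison.\<close>

type_synonym pt = "real \<times> real \<times> real \<times> real"
text \<open>The slots are the time derivative, the horizontal gradient, the derivative along the
  centre and the entries of the symmetric horizontal Hessian. Second derivatives that involve the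
  centre or time are left to the error term.\<close>

type_synonym jet = "real \<times> (real \<times> real) \<times> real \<times> (real \<times> real \<times> real)"

definition gmul :: "pt \<Rightarrow> pt \<Rightarrow> pt"  (infixl "\<star>" 70) where
  "P \<star> Q = (case P of (x, y, z, t) \<Rightarrow> case Q of (x', y', z', t') \<Rightarrow>
     (x + x', y + y', z + z' + (x * y' - x' * y) / 2, t + t'))"

definition ginv :: "pt \<Rightarrow> pt" where
  "ginv P = (case P of (x, y, z, t) \<Rightarrow> (- x, - y, - z, - t))"

lemma gmul_simp [simp]: "(x, y, z, t) \<star> (x', y', z', t') =
    (x + x', y + y', z + z' + (x * y' - x' * y) / 2, t + t')"
  by (simp add: gmul_def)

lemma ginv_simp [simp]: "ginv (x, y, z, t) = (- x, - y, - z, - t)"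
  by (simp add: ginv_def)

lemma gmul_assoc: "P \<star> Q \<star> R = P \<star> (Q \<star> R)"
  by (cases P; cases Q; cases R) (simp add: field_simps)

lemma gmul_0 [simp]: "P \<star> 0 = P" "0 \<star> P = P"
  by (cases P; simp add: zero_prod_def)+

lemma gmul_ginv [simp]: "P \<star> ginv P = 0" "ginv P \<star> P = 0"
  by (cases P; simp add: zero_prod_def)+

lemma gmul_ginv_cancel [simp]: "P \<star> (ginv P \<star> Q) = Q" "ginv P \<star> (P \<star> Q) = Q"
  "Q \<star> P \<star> ginv P = Q" "Q \<star> ginv P \<star> P = Q"
  by (simp_all add: gmul_assoc [symmetric]) (simp_all add: gmul_assoc)

lemma ginv_gmul: "ginv (P \<star> Q) = ginv Q \<star> ginv P"
  by (cases P; cases Q) (simp add: field_simps)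

lemma continuous_on_gmul [continuous_intros]:
  "continuous_on S f \<Longrightarrow> continuous_on S g \<Longrightarrow> continuous_on S (\<lambda>x. f x \<star> g x)"
  unfolding gmul_def case_prod_unfold by (intro continuous_intros) auto

lemma continuous_on_ginv [continuous_intros]:
  "continuous_on S f \<Longrightarrow> continuous_on S (\<lambda>x. ginv (f x))"
  unfolding ginv_def case_prod_unfold by (intro continuous_intros)

text \<open>The group coordinates are exponential, so the quadratic part in \<open>x\<close>,
  \<open>y\<close> of the expansion of \<open>F (P \<star> Q)\<close> carries the symmetrized
  products of \<open>X1\<close> and \<open>X2\<close>. The commutator shows up only in the
  coefficient of \<open>z\<close>.\<close>

definition jeval :: "jet \<Rightarrow> pt \<Rightarrow> real" where
  "jeval J Q = (case J of (\<alpha>, (b1, b2), c, (m11, m12, m22)) \<Rightarrow> case Q of (x, y, z, t) \<Rightarrow>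
     \<alpha> * t + b1 * x + b2 * y + c * z + (m11 * x\<^sup>2 + 2 * m12 * x * y + m22 * y\<^sup>2) / 2)"

lemma jeval_simp [simp]: "jeval (\<alpha>, (b1, b2), c, (m11, m12, m22)) (x, y, z, t) =
    \<alpha> * t + b1 * x + b2 * y + c * z + (m11 * x\<^sup>2 + 2 * m12 * x * y + m22 * y\<^sup>2) / 2"
  by (simp add: jeval_def)

lemma jeval_add: "jeval (J + J') Q = jeval J Q + jeval J' Q"
  by (cases J; cases J'; cases Q) (simp add: jeval_def case_prod_unfold field_simps)

lemma jeval_scaleR: "jeval (r *\<^sub>R J) Q = r * jeval J Q"
  by (cases J; cases Q) (simp add: jeval_def case_prod_unfold field_simps)

lemma jeval_minus: "jeval (- J) Q = - jeval J Q"
  using jeval_scaleR [of "-1"] by simp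

definition sqh :: "pt \<Rightarrow> real" where "sqh Q = (case Q of (x, y, z, t) \<Rightarrow> x\<^sup>2 + y\<^sup>2)"
definition sqv :: "pt \<Rightarrow> real" where "sqv Q = (case Q of (x, y, z, t) \<Rightarrow> z\<^sup>2 + t\<^sup>2)"

lemma sqh_simp [simp]: "sqh (x, y, z, t) = x\<^sup>2 + y\<^sup>2" by (simp add: sqh_def)
lemma sqv_simp [simp]: "sqv (x, y, z, t) = z\<^sup>2 + t\<^sup>2" by (simp add: sqv_def)
lemma sqh_nonneg [simp]: "0 \<le> sqh Q" and sqv_nonneg [simp]: "0 \<le> sqv Q"
  by (cases Q; simp)+

text \<open>The error is asymmetric: arbitrarily small in the horizontal square, any multiple of the
  vertical one. By Young's inequality this admits products such as \<open>x * z\<close> and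
  \<open>x * t\<close>, so the missing mixed second derivatives do no harm.\<close>

definition superjet :: "(pt \<Rightarrow> real) \<Rightarrow> pt \<Rightarrow> jet \<Rightarrow> bool" where
  "superjet F P J \<longleftrightarrow> (\<forall>\<eta>>0. \<exists>K. \<forall>\<^sub>F Q in nhds 0.
     F (P \<star> Q) \<le> F P + jeval J Q + \<eta> * sqh Q + K * sqv Q)"

definition subjet :: "(pt \<Rightarrow> real) \<Rightarrow> pt \<Rightarrow> jet \<Rightarrow> bool" where
  "subjet F P J \<longleftrightarrow> superjet (\<lambda>Q. - F Q) P (- J)"

definition jet_at :: "(pt \<Rightarrow> real) \<Rightarrow> pt \<Rightarrow> jet \<Rightarrow> bool" where
  "jet_at F P J \<longleftrightarrow> (\<forall>\<eta>>0. \<exists>K\<ge>0. \<forall>\<^sub>F Q in nhds 0.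
     \<bar>F (P \<star> Q) - F P - jeval J Q\<bar> \<le> \<eta> * sqh Q + K * sqv Q)"

section \<open>Test functions\<close>

lemma C1_onI:
  assumes "\<And>x. x \<in> S \<Longrightarrow> (g has_derivative blinfun_apply (g' x)) (at x)" "continuous_on S g'"
  shows "C1_on S g"
  using assms unfolding C1_on_def by blast

lemma C1_on_add:
  assumes "C1_on S f" "C1_on S g" shows "C1_on S (\<lambda>x. f x + g x)"
proof -
  obtain f' g' where *: "\<forall>x\<in>S. (f has_derivative blinfun_apply (f' x)) (at x)" "continuous_on S f'"
    "\<forall>x\<in>S. (g has_derivative blinfun_apply (g' x)) (at x)" "continuous_on S g'"
    using assms unfolding C1_on_def by blast
  show ?thesis
    by (rule C1_onI [where g' = "\<lambda>x. f' x + g' x"])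
      (use * in \<open>auto intro!: has_derivative_eq_rhs [OF has_derivative_add] continuous_intros simp: plus_blinfun.rep_eq\<close>)
qed

lemma C2_on_add:
  assumes "C2_on S f" "C2_on S g" shows "C2_on S (\<lambda>x. f x + g x)"
proof -
  obtain f' g' where *: "\<forall>x\<in>S. (f has_derivative blinfun_apply (f' x)) (at x)" "C1_on S f'"
    "\<forall>x\<in>S. (g has_derivative blinfun_apply (g' x)) (at x)" "C1_on S g'"
    using assms unfolding C2_on_def by blast
  show ?thesis unfolding C2_on_def
    by (rule exI [where x = "\<lambda>x. f' x + g' x"])
      (use * in \<open>auto intro!: has_derivative_eq_rhs [OF has_derivative_add] C1_on_add simp: plus_blinfun.rep_eq\<close>)
qed

text \<open>Sums of such products give all the quadratic polynomials needed as test functions. The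
  derivative \<open>h\<close> is affine in the point, so the second derivative is the constant
  \<open>H\<close>.\<close>

lemma C2_on_affine_mult:
  fixes f g :: "'a::real_normed_vector \<Rightarrow> real"
  assumes "bounded_linear f" "bounded_linear g"
  shows "C2_on UNIV (\<lambda>x. (f x + c) * (g x + d))"
proof -
  define F where "F = Blinfun f" define G where "G = Blinfun g"
  have F: "blinfun_apply F = f" and G: "blinfun_apply G = g"
    using assms by (auto simp: F_def G_def bounded_linear_Blinfun_apply)
  define h where "h x = (f x + c) *\<^sub>R G + (g x + d) *\<^sub>R F" for x
  have df: "(f has_derivative f) (at x)" "(g has_derivative g) (at x)" for x
    using assms by (simp_all add: bounded_linear_imp_has_derivative)
  have 1: "((\<lambda>x. (f x + c) * (g x + d)) has_derivative blinfun_apply (h x)) (at x)" for x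
    by (rule has_derivative_eq_rhs, (rule derivative_intros df)+)
      (auto simp: h_def plus_blinfun.rep_eq scaleR_blinfun.rep_eq F G fun_eq_iff)
  have bl: "bounded_linear (\<lambda>y. f y *\<^sub>R G + g y *\<^sub>R F)"
    using assms by (intro bounded_linear_add bounded_linear_scaleR_const bounded_linear_intros) 
  define H where "H = Blinfun (\<lambda>y. f y *\<^sub>R G + g y *\<^sub>R F)"
  have H: "blinfun_apply H = (\<lambda>y. f y *\<^sub>R G + g y *\<^sub>R F)"
    using bl by (simp add: H_def bounded_linear_Blinfun_apply)
  have "C1_on UNIV h"
  proof (rule C1_onI [where g' = "\<lambda>_. H"])
    fix x show "(h has_derivative blinfun_apply H) (at x)"
      unfolding h_def H
      by (rule has_derivative_eq_rhs, (rule derivative_intros df)+) (auto simp: fun_eq_iff)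
  qed auto
  with 1 show ?thesis unfolding C2_on_def by blast
qed

lemma bounded_linear_nth_fst: "bounded_linear (\<lambda>X::(real^3) \<times> real. fst X $ i)"
  by (intro bounded_linear_compose [OF bounded_linear_vec_nth bounded_linear_fst])

text \<open>\<open>Q\<close> is \<open>ginv P \<star> X\<close> in coordinates: the jet polynomial
  is transported to the base point by a left translation, under which the equation's differential
  operators are invariant.\<close>

definition quadratic_test ::
  "real \<Rightarrow> jet \<Rightarrow> real \<Rightarrow> pt \<Rightarrow> (real^3) \<times> real \<Rightarrow> real" where
  "quadratic_test C J K P X = (case P of (x0, y0, z0, t0) \<Rightarrow>
     (let Q = (fst X $ 1 - x0, fst X $ 2 - y0,
               fst X $ 3 - z0 - (x0 * fst X $ 2 - fst X $ 1 * y0) / 2, snd X - t0)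
      in C + jeval J Q + K * sqv Q))"

lemma C2_on_affine:
  fixes f :: "'a::real_normed_vector \<Rightarrow> real"
  assumes "bounded_linear f"
  shows "C2_on UNIV (\<lambda>x. f x + c)"
  using C2_on_affine_mult [OF assms bounded_linear_zero, of c 1] by simp

lemma C2_on_quadratic_test: "C2_on UNIV (quadratic_test C J K P)"
proof -
  obtain \<alpha> b1 b2 c m11 m12 m22 where J: "J = (\<alpha>, (b1, b2), c, (m11, m12, m22))" by (cases J) auto
  obtain x0 y0 z0 t0 where P: "P = (x0, y0, z0, t0)" by (cases P) auto
  define l1 l2 l3 l4 :: "(real^3) \<times> real \<Rightarrow> real" where
    "l1 = (\<lambda>X. fst X $ 1)" and "l2 = (\<lambda>X. fst X $ 2)" and
    "l3 = (\<lambda>X. fst X $ 3 - (x0 * fst X $ 2 - fst X $ 1 * y0) / 2)" and "l4 = (\<lambda>X. snd X)"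
  have bl: "bounded_linear l1" "bounded_linear l2" "bounded_linear l3" "bounded_linear l4"
    unfolding l1_def l2_def l3_def l4_def
    by (intro bounded_linear_sub bounded_linear_divide [THEN bounded_linear_compose]
        bounded_linear_const_mult bounded_linear_mult_const bounded_linear_nth_fst bounded_linear_snd)+
  note mu = C2_on_affine_mult [OF bounded_linear_const_mult [OF bl(1)] bl(1)]
    C2_on_affine_mult [OF bounded_linear_const_mult [OF bl(1)] bl(2)]
    C2_on_affine_mult [OF bounded_linear_const_mult [OF bl(2)] bl(2)]
    C2_on_affine_mult [OF bounded_linear_const_mult [OF bl(3)] bl(3)]
    C2_on_affine_mult [OF bounded_linear_const_mult [OF bl(4)] bl(4)]
  have "bounded_linear (\<lambda>X. \<alpha> * l4 X + b1 * l1 X + b2 * l2 X + c * l3 X)"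
    by (intro bounded_linear_add bounded_linear_const_mult bl)
  note aff = C2_on_affine [OF this]
  have "C2_on UNIV (\<lambda>X. (\<alpha> * l4 X + b1 * l1 X + b2 * l2 X + c * l3 X
        + (C - \<alpha> * t0 - b1 * x0 - b2 * y0 - c * z0))
      + (m11 / 2 * l1 X + m11 / 2 * (- x0)) * (l1 X + (- x0)) + (m12 * l1 X + m12 * (- x0)) * (l2 X + (- y0))
      + (m22 / 2 * l2 X + m22 / 2 * (- y0)) * (l2 X + (- y0))
      + (K * l3 X + K * (- z0)) * (l3 X + (- z0)) + (K * l4 X + K * (- t0)) * (l4 X + (- t0)))"
    by (intro C2_on_add aff mu)
  also have "(\<lambda>X. (\<alpha> * l4 X + b1 * l1 X + b2 * l2 X + c * l3 X
        + (C - \<alpha> * t0 - b1 * x0 - b2 * y0 - c * z0))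
      + (m11 / 2 * l1 X + m11 / 2 * (- x0)) * (l1 X + (- x0)) + (m12 * l1 X + m12 * (- x0)) * (l2 X + (- y0))
      + (m22 / 2 * l2 X + m22 / 2 * (- y0)) * (l2 X + (- y0))
      + (K * l3 X + K * (- z0)) * (l3 X + (- z0)) + (K * l4 X + K * (- t0)) * (l4 X + (- t0)))
     = quadratic_test C J K P"
  proof
    fix X
    have q: "quadratic_test C J K P X = C + (\<alpha> * (l4 X - t0) + b1 * (l1 X - x0) + b2 * (l2 X - y0) + c * (l3 X - z0)
       + (m11 * (l1 X - x0)\<^sup>2 + 2 * m12 * (l1 X - x0) * (l2 X - y0) + m22 * (l2 X - y0)\<^sup>2) / 2)
       + K * ((l3 X - z0)\<^sup>2 + (l4 X - t0)\<^sup>2)"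
      unfolding quadratic_test_def J P Let_def l1_def l2_def l3_def l4_def
      by (simp add: algebra_simps)
    show "(\<alpha> * l4 X + b1 * l1 X + b2 * l2 X + c * l3 X
        + (C - \<alpha> * t0 - b1 * x0 - b2 * y0 - c * z0))
      + (m11 / 2 * l1 X + m11 / 2 * (- x0)) * (l1 X + (- x0)) + (m12 * l1 X + m12 * (- x0)) * (l2 X + (- y0))
      + (m22 / 2 * l2 X + m22 / 2 * (- y0)) * (l2 X + (- y0))
      + (K * l3 X + K * (- z0)) * (l3 X + (- z0)) + (K * l4 X + K * (- t0)) * (l4 X + (- t0))
      = quadratic_test C J K P X"
      unfolding q power2_eq_square by (simp add: field_simps)
  qed
  finally show ?thesis .
qed

text \<open>Along coordinate lines the test functions and their horizontal derivatives are
  polynomials of degree at most two, so every derivative can be read off as a coefficient.\<close>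

lemma deriv_quadratic:
  fixes g :: "real \<Rightarrow> real"
  assumes "\<And>s. g (r + s) = A + B * s + C * s\<^sup>2"
  shows "deriv g r = B"
proof -
  have "g = (\<lambda>s. A + B * (s - r) + C * (s - r)\<^sup>2)"
    using assms [of "_ - r"] by auto
  moreover have "((\<lambda>s. A + B * (s - r) + C * (s - r)\<^sup>2) has_real_derivative B) (at r)"
    by (auto intro!: derivative_eq_intros)
  ultimately show ?thesis by (simp add: DERIV_imp_deriv)
qed

lemma partial_quadratic:
  assumes "\<And>s. v (p + s *\<^sub>R axis i 1) = A + B * s + C * s\<^sup>2"
  shows "partial i v p = B"
  unfolding partial_def using assms by (intro deriv_quadratic [where A = A and C = C]) simp

lemma axis_nth3: "(axis (i::3) (1::real)) $ j = (if i = j then 1 else 0)"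
  by (simp add: axis_def)

text \<open>At the base point \<open>X1 (X2 v)\<close> and \<open>X2 (X1 v)\<close> equal
  \<open>m12 + c / 2\<close> and \<open>m12 - c / 2\<close>: they differ by the commutator, and the
  symmetrization removes \<open>c\<close>. The terms with \<open>K\<close> disappear because the
  left-invariant vertical coordinate \<open>l\<close> and its horizontal derivatives vanish there,
  and likewise for the time coordinate.\<close>

lemma parabolic_op_quadratic_test:
  fixes A :: "real^2^2"
  assumes P: "P = (x0, y0, z0, t0)" and J: "J = (\<alpha>, (b1, b2), c, (m11, m12, m22))"
  shows "parabolic_op A f (quadratic_test C J K P) (vector [x0, y0, z0]) t0 =
    \<alpha> - (A$1$1 * m11 + (A$1$2 + A$2$1) * m12 + A$2$2 * m22) + f (vector [x0, y0, z0]) (vector [b1, b2])"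
proof -
  let ?v = "\<lambda>q. quadratic_test C J K P (q, t0)"
  let ?p = "vector [x0, y0, z0] :: real^3"
  define l where "l q = q$3 - z0 - (x0 * q$2 - q$1 * y0) / 2" for q :: "real^3"
  have v: "?v q = C + b1 * (q$1 - x0) + b2 * (q$2 - y0) + c * l q
      + (m11 * (q$1 - x0)\<^sup>2 + 2 * m12 * (q$1 - x0) * (q$2 - y0) + m22 * (q$2 - y0)\<^sup>2) / 2
      + K * (l q)\<^sup>2" for q
    by (simp add: quadratic_test_def P J Let_def l_def)
  have one: "(3::3) \<noteq> 1" "(3::3) \<noteq> 2" "(1::3) \<noteq> 2" "(1::3) \<noteq> 3" "(2::3) \<noteq> 1" "(2::3) \<noteq> 3" by auto
  note ax = axis_nth3 one
  have d1: "partial 1 ?v q = b1 + c * y0 / 2 + m11 * (q$1 - x0) + m12 * (q$2 - y0) + K * l q * y0" for q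
    by (rule partial_quadratic [where A = "?v q" and C = "m11 / 2 + K * y0\<^sup>2 / 4"])
      (simp add: v l_def ax, simp add: field_simps power2_eq_square)
  have d2: "partial 2 ?v q = b2 - c * x0 / 2 + m12 * (q$1 - x0) + m22 * (q$2 - y0) - K * l q * x0" for q
    by (rule partial_quadratic [where A = "?v q" and C = "m22 / 2 + K * x0\<^sup>2 / 4"])
      (simp add: v l_def ax, simp add: field_simps power2_eq_square)
  have d3: "partial 3 ?v q = c + 2 * K * l q" for q
    by (rule partial_quadratic [where A = "?v q" and C = "K"])
      (simp add: v l_def ax, simp add: field_simps power2_eq_square)
  have l0: "l ?p = 0" by (simp add: l_def)
  have x1: "X1 ?v = (\<lambda>q. b1 + c * y0 / 2 + m11 * (q$1 - x0) + m12 * (q$2 - y0) + K * l q * y0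
      - q$2 / 2 * (c + 2 * K * l q))"
    and x2: "X2 ?v = (\<lambda>q. b2 - c * x0 / 2 + m12 * (q$1 - x0) + m22 * (q$2 - y0) - K * l q * x0
      + q$1 / 2 * (c + 2 * K * l q))"
    by (auto simp: X1_def X2_def d1 d2 d3)
  have h: "hgrad ?v ?p = vector [b1, b2]"
    by (simp add: hgrad_def x1 x2 l0)
  have p11: "partial 1 (X1 ?v) ?p = m11"
    by (rule partial_quadratic [where A = "X1 ?v ?p" and C = 0])
      (simp add: x1 l_def ax, simp add: field_simps power2_eq_square)
  have p31: "partial 3 (X1 ?v) ?p = 0"
    by (rule partial_quadratic [where A = "X1 ?v ?p" and C = 0])
      (simp add: x1 l_def ax, simp add: field_simps power2_eq_square)
  have p21: "partial 2 (X1 ?v) ?p = m12 - c / 2"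
    by (rule partial_quadratic [where A = "X1 ?v ?p" and C = "K * x0 / 2"])
      (simp add: x1 l_def ax, simp add: field_simps power2_eq_square)
  have p12: "partial 1 (X2 ?v) ?p = m12 + c / 2"
    by (rule partial_quadratic [where A = "X2 ?v ?p" and C = "K * y0 / 2"])
      (simp add: x2 l_def ax, simp add: field_simps power2_eq_square)
  have p32: "partial 3 (X2 ?v) ?p = 0"
    by (rule partial_quadratic [where A = "X2 ?v ?p" and C = 0])
      (simp add: x2 l_def ax, simp add: field_simps power2_eq_square)
  have p22: "partial 2 (X2 ?v) ?p = m22"
    by (rule partial_quadratic [where A = "X2 ?v ?p" and C = 0])
      (simp add: x2 l_def ax, simp add: field_simps power2_eq_square)
  have H: "hhess_sym ?v ?p = vector [vector [m11, m12], vector [m12, m22]]"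
    unfolding hhess_sym_def Let_def X1_def [of "X1 ?v"] X1_def [of "X2 ?v"] X2_def [of "X1 ?v"] X2_def [of "X2 ?v"]
      p11 p31 p21 p12 p32 p22 by simp
  have tr: "trace (A ** hhess_sym ?v ?p) = A$1$1 * m11 + (A$1$2 + A$2$1) * m12 + A$2$2 * m22"
    unfolding H trace_def matrix_matrix_mult_def by (simp add: sum_2 algebra_simps)
  have dt: "deriv (\<lambda>s. quadratic_test C J K P (?p, s)) t0 = \<alpha>"
    by (rule deriv_quadratic [where A = C and C = K])
      (simp add: quadratic_test_def P J Let_def algebra_simps)
  show ?thesis
    unfolding parabolic_op_def dt tr h ..
qed

section \<open>Viscosity inequalities in terms of jets\<close>

definition space_time :: "pt \<Rightarrow> (real^3) \<times> real" where
  "space_time P = (case P of (x, y, z, t) \<Rightarrow> (vector [x, y, z], t))"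

lemma space_time_simp [simp]: "space_time (x, y, z, t) = (vector [x, y, z], t)"
  by (simp add: space_time_def)

lemma vector3_eta: "vector [p$1, p$2, p$3] = (p::real^3)"
  by (simp add: vec_eq_iff forall_3)

text \<open>The slack \<open>\<eta>\<close> in the horizontal directions is put into the Hessian of the test function, and
  the multiple of \<open>sqv\<close> does not contribute to the equation.\<close>

lemma superjet_test_function:
  fixes u :: "(real^3) \<times> real \<Rightarrow> real"
  assumes P: "P = (x0, y0, z0, t0)" and J: "J = (\<alpha>, (b1, b2), c, (m11, m12, m22))"
    and sj: "superjet (\<lambda>P. u (space_time P)) P J" and \<eta>: "\<eta> > 0"
  obtains K where "local_max_at (vector [x0, y0, z0], t0)
    (\<lambda>X. u X - quadratic_test 0 (\<alpha>, (b1, b2), c, (m11 + 2 * \<eta>, m12, m22 + 2 * \<eta>)) K P X)"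
proof -
  obtain K where K: "\<forall>\<^sub>F Q in nhds 0. u (space_time (P \<star> Q)) \<le> u (space_time P) + jeval J Q + \<eta> * sqh Q + K * sqv Q"
    using sj \<eta> unfolding superjet_def by blast
  let ?J = "(\<alpha>, (b1, b2), c, (m11 + 2 * \<eta>, m12, m22 + 2 * \<eta>))"
  let ?X0 = "(vector [x0, y0, z0], t0) :: (real^3) \<times> real"
  \<comment> \<open>\<open>R X\<close> is the increment \<open>ginv P \<star> X\<close> that leads
    from the base point to \<open>X\<close>.\<close>
  define R :: "(real^3) \<times> real \<Rightarrow> pt" where "R X = (fst X $ 1 - x0, fst X $ 2 - y0,
     fst X $ 3 - z0 - (x0 * fst X $ 2 - fst X $ 1 * y0) / 2, snd X - t0)" for X
  have RX: "space_time (P \<star> R X) = X" for X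
    by (cases X) (simp add: P R_def field_simps vector3_eta)
  have "isCont R ?X0"
    unfolding R_def by (intro continuous_intros) auto
  moreover have R0: "R ?X0 = 0" by (simp add: R_def zero_prod_def)
  ultimately have "filterlim R (nhds 0) (nhds ?X0)"
    by (metis isCont_def tendsto_at_iff_tendsto_nhds)
  then have ev: "\<forall>\<^sub>F X in nhds ?X0. u (space_time (P \<star> R X)) \<le> u (space_time P) + jeval J (R X) + \<eta> * sqh (R X) + K * sqv (R X)"
    using K by (rule filterlim_iff [THEN iffD1, rule_format])
  have q: "quadratic_test 0 ?J K P X = jeval J (R X) + \<eta> * sqh (R X) + K * sqv (R X)" for X
    by (simp add: quadratic_test_def P J Let_def R_def) (simp add: field_simps)
  have "local_max_at ?X0 (\<lambda>X. u X - quadratic_test 0 ?J K P X)"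
    unfolding local_max_at_def q
    by (rule eventually_mono [OF ev]) (auto simp: RX R0, simp add: P J zero_prod_def)
  then show thesis by (rule that)
qed

lemma le_from_all_eps:
  fixes a b k :: real
  assumes "\<And>\<eta>. \<eta> > 0 \<Longrightarrow> a \<le> b + k * \<eta>"
  shows "a \<le> b"
proof (rule field_le_epsilon)
  fix e :: real assume e: "e > 0"
  have "a \<le> b + k * (e / (\<bar>k\<bar> + 1))" using e by (intro assms) auto
  also have "k * (e / (\<bar>k\<bar> + 1)) \<le> e"
    using e by (simp add: field_simps) (smt (verit) mult_less_0_iff abs_ge_self mult_right_mono)
  finally show "a \<le> b + e" by simp
qed

lemma C2_near_quadratic_test: "C2_near X (quadratic_test C J K P)"
  unfolding C2_near_def using C2_on_quadratic_test by blast

text \<open>Enlarging the diagonal of the Hessian by \<open>2 * \<eta>\<close> costs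
  \<open>2 * (A$1$1 + A$2$2) * \<eta>\<close> in the equation, and \<eta> is arbitrary. The constant
  \<open>K\<close> may depend on \<eta> because it does not enter the operator.\<close>

lemma visc_subsolution_superjet:
  fixes A :: "real^2^2"
  assumes sub: "visc_subsolution A f u" and "t0 > 0"
    and sj: "superjet (\<lambda>P. u (space_time P)) (x0, y0, z0, t0) (\<alpha>, (b1, b2), c, (m11, m12, m22))"
  shows "\<alpha> - (A$1$1 * m11 + (A$1$2 + A$2$1) * m12 + A$2$2 * m22) + f (vector [x0, y0, z0]) (vector [b1, b2]) \<le> 0"
proof -
  have "\<alpha> - (A$1$1 * m11 + (A$1$2 + A$2$1) * m12 + A$2$2 * m22) + f (vector [x0, y0, z0]) (vector [b1, b2])
     \<le> 0 + (2 * A$1$1 + 2 * A$2$2) * \<eta>" if \<eta>: "\<eta> > 0" for \<eta>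
  proof -
    obtain K where "local_max_at (vector [x0, y0, z0], t0)
      (\<lambda>X. u X - quadratic_test 0 (\<alpha>, (b1, b2), c, (m11 + 2 * \<eta>, m12, m22 + 2 * \<eta>)) K (x0, y0, z0, t0) X)"
      using superjet_test_function [OF refl refl sj \<eta>] .
    then have "parabolic_op A f (quadratic_test 0 (\<alpha>, (b1, b2), c, (m11 + 2 * \<eta>, m12, m22 + 2 * \<eta>)) K (x0, y0, z0, t0))
       (vector [x0, y0, z0]) t0 \<le> 0"
      using sub \<open>t0 > 0\<close> C2_near_quadratic_test unfolding visc_subsolution_def spacetime_def by blast
    then show ?thesis
      unfolding parabolic_op_quadratic_test [OF refl refl] by (simp add: algebra_simps)
  qed
  then show ?thesis by (rule le_from_all_eps)
qed

lemma uminus_quadratic_test: "- quadratic_test 0 J K P X = quadratic_test 0 (- J) (- K) P X"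
  by (cases P) (simp add: quadratic_test_def Let_def jeval_minus)

lemma visc_supersolution_subjet:
  fixes A :: "real^2^2"
  assumes sup: "visc_supersolution A f u" and "t0 > 0"
    and sj: "subjet (\<lambda>P. u (space_time P)) (x0, y0, z0, t0) (\<alpha>, (b1, b2), c, (m11, m12, m22))"
  shows "\<alpha> - (A$1$1 * m11 + (A$1$2 + A$2$1) * m12 + A$2$2 * m22) + f (vector [x0, y0, z0]) (vector [b1, b2]) \<ge> 0"
proof -
  have "0 \<le> (\<alpha> - (A$1$1 * m11 + (A$1$2 + A$2$1) * m12 + A$2$2 * m22) + f (vector [x0, y0, z0]) (vector [b1, b2]))
     + (2 * A$1$1 + 2 * A$2$2) * \<eta>" if \<eta>: "\<eta> > 0" for \<eta>
  proof -
    have sj': "superjet (\<lambda>P. (\<lambda>X. - u X) (space_time P)) (x0, y0, z0, t0) (- \<alpha>, (- b1, - b2), - c, (- m11, - m12, - m22))"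
      using sj unfolding subjet_def by simp
    obtain K where K: "local_max_at (vector [x0, y0, z0], t0)
      (\<lambda>X. - u X - quadratic_test 0 (- \<alpha>, (- b1, - b2), - c, (- m11 + 2 * \<eta>, - m12, - m22 + 2 * \<eta>)) K (x0, y0, z0, t0) X)"
      using superjet_test_function [OF refl refl sj' \<eta>] .
    let ?q = "quadratic_test 0 (\<alpha>, (b1, b2), c, (m11 - 2 * \<eta>, m12, m22 - 2 * \<eta>)) (- K) (x0, y0, z0, t0)"
    have q: "?q X = - quadratic_test 0 (- \<alpha>, (- b1, - b2), - c, (- m11 + 2 * \<eta>, - m12, - m22 + 2 * \<eta>)) K (x0, y0, z0, t0) X" for X
      unfolding uminus_quadratic_test by simp
    have "local_min_at (vector [x0, y0, z0], t0) (\<lambda>X. u X - ?q X)"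
      using K unfolding local_min_at_def local_max_at_def q by eventually_elim simp
    then have "parabolic_op A f ?q (vector [x0, y0, z0]) t0 \<ge> 0"
      using sup \<open>t0 > 0\<close> C2_near_quadratic_test unfolding visc_supersolution_def spacetime_def by blast
    then show ?thesis
      unfolding parabolic_op_quadratic_test [OF refl refl] by (simp add: algebra_simps)
  qed
  then show ?thesis by (rule le_from_all_eps)
qed

section \<open>Calculus of second-order jets\<close>

text \<open>The two-sided superjet error, isolated as a class closed under sums, multiples and
  squares, so that the chain rule becomes algebra. It is wider than little-o of the squared norm:
  \<open>z\<^sup>2\<close> and \<open>x * z\<close> belong to it.\<close>

definition negl :: "(pt \<Rightarrow> real) \<Rightarrow> bool" where
  "negl r \<longleftrightarrow> (\<forall>\<eta>>0. \<exists>K\<ge>0. \<forall>\<^sub>F Q in nhds 0. \<bar>r Q\<bar> \<le> \<eta> * sqh Q + K * sqv Q)"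

definition order1 :: "(pt \<Rightarrow> real) \<Rightarrow> bool" where
  "order1 r \<longleftrightarrow> (\<exists>K\<ge>0. \<forall>\<^sub>F Q in nhds 0. (r Q)\<^sup>2 \<le> K * (sqh Q + sqv Q))"

lemma jet_at_negl: "jet_at F P J \<longleftrightarrow> negl (\<lambda>Q. F (P \<star> Q) - F P - jeval J Q)"
  by (simp add: jet_at_def negl_def)

lemma tendsto_coords: "((\<lambda>(x, y, z, t). x) \<longlongrightarrow> 0) (nhds (0::pt))" "((\<lambda>(x, y, z, t). y) \<longlongrightarrow> 0) (nhds (0::pt))"
  "((\<lambda>(x, y, z, t). z) \<longlongrightarrow> 0) (nhds (0::pt))" "((\<lambda>(x, y, z, t). t) \<longlongrightarrow> 0) (nhds (0::pt))"
proof -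
  have *: "((\<lambda>Q. Q) \<longlongrightarrow> (0::pt)) (nhds 0)" by (rule filterlim_ident)
  show "((\<lambda>(x, y, z, t). x) \<longlongrightarrow> 0) (nhds (0::pt))" "((\<lambda>(x, y, z, t). y) \<longlongrightarrow> 0) (nhds (0::pt))"
    "((\<lambda>(x, y, z, t). z) \<longlongrightarrow> 0) (nhds (0::pt))" "((\<lambda>(x, y, z, t). t) \<longlongrightarrow> 0) (nhds (0::pt))"
    using tendsto_fst [OF *] tendsto_fst [OF tendsto_snd [OF *]] tendsto_fst [OF tendsto_snd [OF tendsto_snd [OF *]]]
      tendsto_snd [OF tendsto_snd [OF tendsto_snd [OF *]]]
    by (simp_all add: case_prod_unfold)
qed

lemma tendsto_sqh_sqv: "((\<lambda>Q. K1 * sqh Q + K2 * sqv Q) \<longlongrightarrow> 0) (nhds 0)"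
proof -
  have "((\<lambda>Q. K1 * (((\<lambda>(x, y, z, t). x) Q)\<^sup>2 + ((\<lambda>(x, y, z, t). y) Q)\<^sup>2)
     + K2 * (((\<lambda>(x, y, z, t). z) Q)\<^sup>2 + ((\<lambda>(x, y, z, t). t) Q)\<^sup>2)) \<longlongrightarrow> K1 * (0\<^sup>2 + 0\<^sup>2) + K2 * (0\<^sup>2 + 0\<^sup>2)) (nhds (0::pt))"
    by (intro tendsto_intros tendsto_coords)
  then show ?thesis by (simp add: case_prod_unfold sqh_def sqv_def)
qed

lemma negl_add: assumes "negl r" "negl s" shows "negl (\<lambda>Q. r Q + s Q)"
  unfolding negl_def
proof (intro allI impI)
  fix \<eta> :: real assume "\<eta> > 0"
  then have "\<eta> / 2 > 0" by simp
  obtain K where K: "K \<ge> 0" "\<forall>\<^sub>F Q in nhds 0. \<bar>r Q\<bar> \<le> \<eta> / 2 * sqh Q + K * sqv Q"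
    using assms(1) \<open>\<eta> / 2 > 0\<close> unfolding negl_def by blast
  obtain L where L: "L \<ge> 0" "\<forall>\<^sub>F Q in nhds 0. \<bar>s Q\<bar> \<le> \<eta> / 2 * sqh Q + L * sqv Q"
    using assms(2) \<open>\<eta> / 2 > 0\<close> unfolding negl_def by blast
  have "\<forall>\<^sub>F Q in nhds 0. \<bar>r Q + s Q\<bar> \<le> \<eta> * sqh Q + (K + L) * sqv Q"
    using K(2) L(2) by eventually_elim (simp add: algebra_simps)
  then show "\<exists>K\<ge>0. \<forall>\<^sub>F Q in nhds 0. \<bar>r Q + s Q\<bar> \<le> \<eta> * sqh Q + K * sqv Q"
    using K(1) L(1) by (intro exI [of _ "K + L"]) auto
qed

lemma negl_cmul: assumes "negl r" shows "negl (\<lambda>Q. k * r Q)"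
  unfolding negl_def
proof (intro allI impI)
  fix \<eta> :: real assume "\<eta> > 0"
  then have "\<eta> / (\<bar>k\<bar> + 1) > 0" by simp
  then obtain K where K: "K \<ge> 0" "\<forall>\<^sub>F Q in nhds 0. \<bar>r Q\<bar> \<le> \<eta> / (\<bar>k\<bar> + 1) * sqh Q + K * sqv Q"
    using assms unfolding negl_def by blast
  have "\<forall>\<^sub>F Q in nhds 0. \<bar>k * r Q\<bar> \<le> \<eta> * sqh Q + ((\<bar>k\<bar> + 1) * K) * sqv Q"
    using K(2)
  proof eventually_elim
    case (elim Q)
    have "\<bar>k * r Q\<bar> \<le> (\<bar>k\<bar> + 1) * \<bar>r Q\<bar>" by (simp add: abs_mult mult_right_mono)
    also have "\<dots> \<le> (\<bar>k\<bar> + 1) * (\<eta> / (\<bar>k\<bar> + 1) * sqh Q + K * sqv Q)"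
      using elim by (intro mult_left_mono) auto
    also have "\<dots> = \<eta> * sqh Q + ((\<bar>k\<bar> + 1) * K) * sqv Q"
      by (simp add: field_simps)
    finally show ?case .
  qed
  then show "\<exists>K\<ge>0. \<forall>\<^sub>F Q in nhds 0. \<bar>k * r Q\<bar> \<le> \<eta> * sqh Q + K * sqv Q"
    using K(1) by (intro exI [of _ "(\<bar>k\<bar> + 1) * K"]) auto
qed

lemma negl_mono:
  assumes "negl r" "\<forall>\<^sub>F Q in nhds 0. \<bar>s Q\<bar> \<le> \<bar>r Q\<bar>" shows "negl s"
  unfolding negl_def
proof (intro allI impI)
  fix \<eta> :: real assume "\<eta> > 0"
  then obtain K where K: "K \<ge> 0" "\<forall>\<^sub>F Q in nhds 0. \<bar>r Q\<bar> \<le> \<eta> * sqh Q + K * sqv Q"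
    using assms(1) unfolding negl_def by blast
  have "\<forall>\<^sub>F Q in nhds 0. \<bar>s Q\<bar> \<le> \<eta> * sqh Q + K * sqv Q"
    using K(2) assms(2) by eventually_elim simp
  then show "\<exists>K\<ge>0. \<forall>\<^sub>F Q in nhds 0. \<bar>s Q\<bar> \<le> \<eta> * sqh Q + K * sqv Q"
    using K(1) by blast
qed

lemma negl_sq_add: assumes "negl (\<lambda>Q. (r Q)\<^sup>2)" "negl (\<lambda>Q. (s Q)\<^sup>2)" shows "negl (\<lambda>Q. (r Q + s Q)\<^sup>2)"
proof (rule negl_mono)
  show "negl (\<lambda>Q. 2 * (r Q)\<^sup>2 + 2 * (s Q)\<^sup>2)"
    by (intro negl_add negl_cmul assms)
  have "(a + b)\<^sup>2 \<le> 2 * a\<^sup>2 + 2 * b\<^sup>2" for a b :: real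
    using zero_le_power2 [of "a - b"] by (simp add: power2_eq_square algebra_simps)
  then show "\<forall>\<^sub>F Q in nhds 0. \<bar>(r Q + s Q)\<^sup>2\<bar> \<le> \<bar>2 * (r Q)\<^sup>2 + 2 * (s Q)\<^sup>2\<bar>" 
    by (intro always_eventually allI) (simp)
qed

lemma eventually_le_1_of_tendsto_0:
  fixes g :: "'a \<Rightarrow> real"
  assumes "(g \<longlongrightarrow> 0) F" "e > 0" shows "\<forall>\<^sub>F x in F. \<bar>g x\<bar> < e"
  using tendstoD [OF assms] by (simp add: dist_real_def)

lemma negl_sq: assumes "negl r" shows "negl (\<lambda>Q. (r Q)\<^sup>2)"
proof (rule negl_mono [OF assms])
  obtain K where K: "K \<ge> 0" "\<forall>\<^sub>F Q in nhds 0. \<bar>r Q\<bar> \<le> 1 * sqh Q + K * sqv Q"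
    using assms unfolding negl_def by (meson zero_less_one)
  show "\<forall>\<^sub>F Q in nhds 0. \<bar>(r Q)\<^sup>2\<bar> \<le> \<bar>r Q\<bar>"
    using K(2) eventually_le_1_of_tendsto_0 [OF tendsto_sqh_sqv [of 1 K] zero_less_one]
  proof eventually_elim
    case (elim Q)
    then have "\<bar>r Q\<bar> \<le> 1" by linarith
    then have "\<bar>r Q\<bar> * \<bar>r Q\<bar> \<le> \<bar>r Q\<bar> * 1" by (intro mult_left_mono) auto
    then show ?case by (simp add: power2_eq_square abs_mult)
  qed
qed

text \<open>Weighted Young inequality: \<open>2 * \<bar>g * r\<bar> \<le> \<epsilon> * g\<^sup>2 +
  r\<^sup>2 / \<epsilon>\<close>. The weight \<epsilon> keeps the first share of \<open>sqh\<close>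
  below \<open>\<eta> / 2\<close>, and the smallness of \<open>r\<^sup>2\<close> is then demanded at
  level \<open>\<eta> / 2 * \<epsilon>\<close>. Asking this of the square only allows
  \<open>r\<close> to contain linear terms in \<open>z\<close> and \<open>t\<close>.\<close>

lemma order1_mult_negl:
  assumes "order1 g" "negl (\<lambda>Q. (r Q)\<^sup>2)" shows "negl (\<lambda>Q. g Q * r Q)"
  unfolding negl_def
proof (intro allI impI)
  fix \<eta> :: real assume \<eta>: "\<eta> > 0"
  obtain K where K: "K \<ge> 0" "\<forall>\<^sub>F Q in nhds 0. (g Q)\<^sup>2 \<le> K * (sqh Q + sqv Q)"
    using assms(1) unfolding order1_def by blast
  define \<epsilon> where "\<epsilon> = \<eta> / (2 * (K + 1))"
  have \<epsilon>: "\<epsilon> > 0" using \<eta> K by (simp add: \<epsilon>_def)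
  have "\<eta> / 2 * \<epsilon> > 0" using \<eta> \<epsilon> by simp
  then obtain L where L: "L \<ge> 0" "\<forall>\<^sub>F Q in nhds 0. \<bar>(r Q)\<^sup>2\<bar> \<le> (\<eta> / 2 * \<epsilon>) * sqh Q + L * sqv Q"
    using assms(2) unfolding negl_def by blast
  have "\<forall>\<^sub>F Q in nhds 0. \<bar>g Q * r Q\<bar> \<le> \<eta> * sqh Q + (\<epsilon> * K + L / \<epsilon>) * sqv Q"
    using K(2) L(2)
  proof eventually_elim
    case (elim Q)
    have 1: "\<epsilon> * K \<le> \<eta> / 2" using \<eta> K by (simp add: \<epsilon>_def field_simps)
    have "2 * \<bar>g Q * r Q\<bar> \<le> \<epsilon> * (g Q)\<^sup>2 + (r Q)\<^sup>2 / \<epsilon>"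
    proof -
      have "0 \<le> (\<epsilon> * \<bar>g Q\<bar> - \<bar>r Q\<bar>)\<^sup>2 / \<epsilon>" using \<epsilon> by simp
      also have "\<dots> = \<epsilon> * (g Q)\<^sup>2 + (r Q)\<^sup>2 / \<epsilon> - 2 * \<bar>g Q * r Q\<bar>"
        using \<epsilon> by (simp add: power2_diff abs_mult field_simps power2_eq_square)
      finally show ?thesis by simp
    qed
    moreover have "\<epsilon> * (g Q)\<^sup>2 \<le> \<epsilon> * (K * (sqh Q + sqv Q))" using elim \<epsilon> by (intro mult_left_mono) auto
    moreover have "(r Q)\<^sup>2 / \<epsilon> \<le> ((\<eta> / 2 * \<epsilon>) * sqh Q + L * sqv Q) / \<epsilon>" using elim \<epsilon> by (intro divide_right_mono) auto
    moreover have "((\<eta> / 2 * \<epsilon>) * sqh Q + L * sqv Q) / \<epsilon> = \<eta> / 2 * sqh Q + L / \<epsilon> * sqv Q"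
      using \<epsilon> by (simp add: field_simps)
    moreover have "\<epsilon> * K * sqh Q \<le> \<eta> / 2 * sqh Q" using 1 by (intro mult_right_mono) auto
    moreover have "0 \<le> \<epsilon> * K * sqv Q" "0 \<le> L / \<epsilon> * sqv Q" "0 \<le> \<eta> * sqh Q" using \<epsilon> \<eta> K L by auto
    ultimately show ?case by (simp add: algebra_simps)
  qed
  then show "\<exists>K\<ge>0. \<forall>\<^sub>F Q in nhds 0. \<bar>g Q * r Q\<bar> \<le> \<eta> * sqh Q + K * sqv Q"
    using K(1) L(1) \<epsilon> by (intro exI [of _ "\<epsilon> * K + L / \<epsilon>"]) auto
qed

lemma order1_horizontal: "order1 (\<lambda>(x, y, z, t). b1 * x + b2 * y)"
  unfolding order1_def
proof (intro exI [of _ "2 * (b1\<^sup>2 + b2\<^sup>2)"] conjI always_eventually allI)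
  fix Q :: pt obtain x y z t where Q: "Q = (x, y, z, t)" by (cases Q) auto
  have "(b1 * x + b2 * y)\<^sup>2 \<le> (b1\<^sup>2 + b2\<^sup>2) * (x\<^sup>2 + y\<^sup>2)"
    using zero_le_power2 [of "b1 * y - b2 * x"] by (simp add: power2_eq_square algebra_simps)
  also have "\<dots> \<le> 2 * (b1\<^sup>2 + b2\<^sup>2) * (x\<^sup>2 + y\<^sup>2 + (z\<^sup>2 + t\<^sup>2))"
    by (intro mult_mono) auto
  finally show "(case Q of (x, y, z, t) \<Rightarrow> b1 * x + b2 * y)\<^sup>2 \<le> 2 * (b1\<^sup>2 + b2\<^sup>2) * (sqh Q + sqv Q)"
    by (simp add: Q)
qed auto

lemma negl_sq_vertical: "negl (\<lambda>Q. (case Q of (x, y, z, t) \<Rightarrow> \<alpha> * t + c * z)\<^sup>2)"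
  unfolding negl_def
proof (intro allI impI)
  fix \<eta> :: real assume \<eta>: "\<eta> > 0"
  have "\<bar>(case Q of (x, y, z, t) \<Rightarrow> \<alpha> * t + c * z)\<^sup>2\<bar> \<le> \<eta> * sqh Q + (\<alpha>\<^sup>2 + c\<^sup>2) * sqv Q" for Q
  proof -
    obtain x y z t where Q: "Q = (x, y, z, t)" by (cases Q) auto
    have "(\<alpha> * t + c * z)\<^sup>2 \<le> (\<alpha>\<^sup>2 + c\<^sup>2) * (z\<^sup>2 + t\<^sup>2)"
      using zero_le_power2 [of "\<alpha> * z - c * t"] by (simp add: power2_eq_square algebra_simps)
    moreover have "0 \<le> \<eta> * (x\<^sup>2 + y\<^sup>2)" using \<eta> by simp
    ultimately show ?thesis by (simp add: Q)
  qed
  then show "\<exists>K\<ge>0. \<forall>\<^sub>F Q in nhds 0. \<bar>(case Q of (x, y, z, t) \<Rightarrow> \<alpha> * t + c * z)\<^sup>2\<bar> \<le> \<eta> * sqh Q + K * sqv Q"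
    by (intro exI [of _ "\<alpha>\<^sup>2 + c\<^sup>2"]) (auto intro: always_eventually)
qed

lemma negl_sq_quadratic:
  "negl (\<lambda>Q. (case Q of (x, y, z, t) \<Rightarrow> (m11 * x\<^sup>2 + 2 * m12 * x * y + m22 * y\<^sup>2) / 2)\<^sup>2)"
  unfolding negl_def
proof (intro allI impI)
  fix \<eta> :: real assume \<eta>: "\<eta> > 0"
  define C where "C = \<bar>m11\<bar> + \<bar>m12\<bar> + \<bar>m22\<bar>"
  have b: "\<bar>case Q of (x, y, z, t) \<Rightarrow> (m11 * x\<^sup>2 + 2 * m12 * x * y + m22 * y\<^sup>2) / 2\<bar> \<le> C * sqh Q" for Q
  proof -
    obtain x y z t where Q: "Q = (x, y, z, t)" by (cases Q) auto
    have *: "\<bar>(a + b + d) / 2\<bar> \<le> k" if "\<bar>a\<bar> \<le> A" "\<bar>d\<bar> \<le> D" "\<bar>b\<bar> \<le> B" "0 \<le> A" "0 \<le> B" "0 \<le> D" "k = A + B + D"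
      for a b d k A B D :: real using that by (auto simp: abs_le_iff)
    have xy: "2 * \<bar>x * y\<bar> \<le> x\<^sup>2 + y\<^sup>2"
      using zero_le_power2 [of "\<bar>x\<bar> - \<bar>y\<bar>"] by (simp add: power2_diff abs_mult)
    have 1: "\<bar>m11 * x\<^sup>2\<bar> \<le> \<bar>m11\<bar> * (x\<^sup>2 + y\<^sup>2)" "\<bar>m22 * y\<^sup>2\<bar> \<le> \<bar>m22\<bar> * (x\<^sup>2 + y\<^sup>2)"
      by (auto simp: abs_mult intro: mult_left_mono)
    have 2: "\<bar>2 * m12 * x * y\<bar> \<le> \<bar>m12\<bar> * (x\<^sup>2 + y\<^sup>2)"
      using mult_left_mono [OF xy abs_ge_zero [of m12]] by (simp add: abs_mult mult.assoc mult.left_commute)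
    have 3: "0 \<le> \<bar>m11\<bar> * (x\<^sup>2 + y\<^sup>2)" "0 \<le> \<bar>m12\<bar> * (x\<^sup>2 + y\<^sup>2)" "0 \<le> \<bar>m22\<bar> * (x\<^sup>2 + y\<^sup>2)" by auto
    have 4: "C * sqh Q = \<bar>m11\<bar> * (x\<^sup>2 + y\<^sup>2) + \<bar>m12\<bar> * (x\<^sup>2 + y\<^sup>2) + \<bar>m22\<bar> * (x\<^sup>2 + y\<^sup>2)"
      unfolding Q C_def sqh_simp by (simp only: distrib_right)
    have "\<bar>(m11 * x\<^sup>2 + 2 * m12 * x * y + m22 * y\<^sup>2) / 2\<bar> \<le> C * sqh Q"
      by (rule * [OF 1 2 3(1,2,3) 4])
    then show ?thesis by (simp add: Q)
  qed
  have C: "C \<ge> 0" by (simp add: C_def)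
  have "\<forall>\<^sub>F Q in nhds 0. \<bar>(case Q of (x, y, z, t) \<Rightarrow> (m11 * x\<^sup>2 + 2 * m12 * x * y + m22 * y\<^sup>2) / 2)\<^sup>2\<bar> \<le> \<eta> * sqh Q + 0 * sqv Q"
    using eventually_le_1_of_tendsto_0 [OF tendsto_sqh_sqv [of "C\<^sup>2" 0] \<eta>]
  proof eventually_elim
    case (elim Q)
    have "\<bar>case Q of (x, y, z, t) \<Rightarrow> (m11 * x\<^sup>2 + 2 * m12 * x * y + m22 * y\<^sup>2) / 2\<bar>\<^sup>2 \<le> (C * sqh Q)\<^sup>2"
      using b by (intro power_mono) auto
    also have "\<dots> = (C\<^sup>2 * sqh Q) * sqh Q" by (simp add: power2_eq_square algebra_simps)
    also have "\<dots> \<le> \<eta> * sqh Q" using elim by (intro mult_right_mono) auto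
    finally show ?case by simp
  qed
  then show "\<exists>K\<ge>0. \<forall>\<^sub>F Q in nhds 0. \<bar>(case Q of (x, y, z, t) \<Rightarrow> (m11 * x\<^sup>2 + 2 * m12 * x * y + m22 * y\<^sup>2) / 2)\<^sup>2\<bar>
     \<le> \<eta> * sqh Q + K * sqv Q" by blast
qed

lemma jet_at_add:
  assumes "jet_at F P J" "jet_at G P J'" shows "jet_at (\<lambda>Q. F Q + G Q) P (J + J')"
  using negl_add [OF assms [unfolded jet_at_negl]] unfolding jet_at_negl jeval_add by (simp add: algebra_simps)

lemma jet_at_cmul:
  assumes "jet_at F P J" shows "jet_at (\<lambda>Q. k * F Q) P (k *\<^sub>R J)"
  using negl_cmul [OF assms [unfolded jet_at_negl], of k] unfolding jet_at_negl jeval_scaleR by (simp add: algebra_simps)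

lemma jet_at_exact:
  assumes "\<And>Q. F (P \<star> Q) = F P + jeval J Q" shows "jet_at F P J"
  unfolding jet_at_def assms by (auto intro!: exI [of _ 0] always_eventually mult_nonneg_nonneg)

lemma jet_at_coords:
  "jet_at (\<lambda>(x, y, z, t). x) (X, Y, Z, T) (0, (1, 0), 0, (0, 0, 0))"
  "jet_at (\<lambda>(x, y, z, t). y) (X, Y, Z, T) (0, (0, 1), 0, (0, 0, 0))"
  "jet_at (\<lambda>(x, y, z, t). z) (X, Y, Z, T) (0, (- Y / 2, X / 2), 1, (0, 0, 0))"
  "jet_at (\<lambda>(x, y, z, t). t) (X, Y, Z, T) (1, (0, 0), 0, (0, 0, 0))"
  by (rule jet_at_exact; auto simp: field_simps)+

lemma jet_at_const: "jet_at (\<lambda>_. k) P 0"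
  by (rule jet_at_exact) (auto simp: jeval_def zero_prod_def)

text \<open>The chain rule, with \<open>d1\<close> and \<open>d2\<close> the first and second
  derivative of the outer function. The Hessian gains \<open>d2\<close> times the rank-one matrix of
  the horizontal gradient; squares of the vertical and time derivatives are absorbed by the error
  class.\<close>

definition jcomp :: "real \<Rightarrow> real \<Rightarrow> jet \<Rightarrow> jet" where
  "jcomp d1 d2 J = (case J of (\<alpha>, (b1, b2), c, (m11, m12, m22)) \<Rightarrow>
     (d1 * \<alpha>, (d1 * b1, d1 * b2), d1 * c,
      (d1 * m11 + d2 * b1\<^sup>2, d1 * m12 + d2 * b1 * b2, d1 * m22 + d2 * b2\<^sup>2)))"

lemma jcomp_simp [simp]: "jcomp d1 d2 (\<alpha>, (b1, b2), c, (m11, m12, m22)) = 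
     (d1 * \<alpha>, (d1 * b1, d1 * b2), d1 * c,
      (d1 * m11 + d2 * b1\<^sup>2, d1 * m12 + d2 * b1 * b2, d1 * m22 + d2 * b2\<^sup>2))"
  by (simp add: jcomp_def)

text \<open>The mean value inequality is applied to the remainder: differentiability of
  \<open>f'\<close> at the single point \<open>y\<close> bounds its derivative by
  \<open>\<eta> * \<bar>s\<bar>\<close> near 0.\<close>

lemma second_order_Peano:
  fixes f :: "real \<Rightarrow> real"
  assumes f: "\<forall>\<^sub>F s in nhds y. (f has_real_derivative f' s) (at s)"
    and f': "(f' has_real_derivative f2) (at y)" and \<eta>: "\<eta> > 0"
  shows "\<forall>\<^sub>F d in nhds 0. \<bar>f (y + d) - f y - f' y * d - f2 * d\<^sup>2 / 2\<bar> \<le> \<eta> * d\<^sup>2"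
proof -
  obtain r1 where r1: "r1 > 0" "\<And>s. dist s y < r1 \<Longrightarrow> (f has_real_derivative f' s) (at s)"
    using f unfolding eventually_nhds_metric by blast
  have "((\<lambda>s. (f' (y + s) - f' y) / s) \<longlongrightarrow> f2) (at 0)"
    using f' unfolding DERIV_def by simp
  then have "\<forall>\<^sub>F s in at 0. dist ((f' (y + s) - f' y) / s) f2 < \<eta>"
    using \<eta> by (rule tendstoD)
  then obtain r2 where r2: "r2 > 0" "\<And>s. s \<noteq> 0 \<Longrightarrow> dist s 0 < r2 \<Longrightarrow> dist ((f' (y + s) - f' y) / s) f2 < \<eta>"
    unfolding eventually_at by blast
  have r2': "\<bar>f' (y + s) - f' y - f2 * s\<bar> \<le> \<eta> * \<bar>s\<bar>" if "\<bar>s\<bar> < r2" for s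
  proof (cases "s = 0")
    case False
    then have "\<bar>(f' (y + s) - f' y) / s - f2\<bar> \<le> \<eta>" using r2(2) [of s] that by (simp add: dist_real_def)
    then have "\<bar>(f' (y + s) - f' y) / s - f2\<bar> * \<bar>s\<bar> \<le> \<eta> * \<bar>s\<bar>" by (intro mult_right_mono) auto
    moreover have "((f' (y + s) - f' y) / s - f2) * s = f' (y + s) - f' y - f2 * s"
      using False by (simp add: field_simps)
    then have "\<bar>(f' (y + s) - f' y) / s - f2\<bar> * \<bar>s\<bar> = \<bar>f' (y + s) - f' y - f2 * s\<bar>"
      by (simp only: abs_mult [symmetric])
    ultimately show ?thesis by simp
  qed simp
  show ?thesis unfolding eventually_nhds_metric
  proof (intro exI [of _ "min r1 r2"] conjI allI impI)
    show "min r1 r2 > 0" using r1 r2 by simp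
    fix d :: real assume d: "dist d 0 < min r1 r2"
    define g where "g s = f (y + s) - f y - f' y * s - f2 * s\<^sup>2 / 2" for s
    have "norm (g d - g 0) \<le> (\<eta> * \<bar>d\<bar>) * norm (d - 0)"
    proof (rule field_differentiable_bound [where S = "cball 0 \<bar>d\<bar>"])
      fix s :: real assume "s \<in> cball 0 \<bar>d\<bar>"
      then have s: "\<bar>s\<bar> \<le> \<bar>d\<bar>" by simp
      have "(f has_real_derivative f' (y + s)) (at (y + s))"
        using s d by (intro r1(2)) (simp add: dist_real_def)
      then have "((\<lambda>s. f (y + s)) has_real_derivative f' (y + s)) (at s)"
        by (simp add: DERIV_shift add.commute)
      then have "(g has_real_derivative f' (y + s) - f' y - f2 * s) (at s)"
        unfolding g_def by (auto intro!: derivative_eq_intros)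
      then show "(g has_field_derivative f' (y + s) - f' y - f2 * s) (at s within cball 0 \<bar>d\<bar>)"
        by (rule has_field_derivative_at_within)
      show "norm (f' (y + s) - f' y - f2 * s) \<le> \<eta> * \<bar>d\<bar>"
      proof -
        have "\<bar>f' (y + s) - f' y - f2 * s\<bar> \<le> \<eta> * \<bar>s\<bar>"
          using s d by (intro r2') (simp add: dist_real_def)
        also have "\<dots> \<le> \<eta> * \<bar>d\<bar>" using s \<eta> by (intro mult_left_mono) auto
        finally show ?thesis by simp
      qed
    qed auto
    then show "\<bar>f (y + d) - f y - f' y * d - f2 * d\<^sup>2 / 2\<bar> \<le> \<eta> * d\<^sup>2"
      by (simp add: g_def power2_eq_square abs_mult [symmetric] mult.assoc)
  qed
qed

text \<open>The increment of \<open>F\<close> splits into its horizontal linear part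
  \<open>L\<close> and a rest \<open>w\<close> whose square is negligible. In the quadratic term of
  the outer expansion only \<open>(L Q)\<^sup>2\<close> survives, since the cross term
  \<open>L Q * w Q\<close> is negligible by \<open>order1_mult_negl\<close>.\<close>

lemma jet_at_comp:
  assumes F: "jet_at F P J"
    and f: "\<forall>\<^sub>F s in nhds (F P). (f has_real_derivative f' s) (at s)"
    and f': "(f' has_real_derivative f2) (at (F P))"
  shows "jet_at (\<lambda>Q. f (F Q)) P (jcomp (f' (F P)) f2 J)"
proof -
  obtain \<alpha> b1 b2 c m11 m12 m22 where J: "J = (\<alpha>, (b1, b2), c, (m11, m12, m22))" by (cases J) auto
  define e where "e Q = F (P \<star> Q) - F P - jeval J Q" for Q
  define L :: "pt \<Rightarrow> real" where "L = (\<lambda>(x, y, z, t). b1 * x + b2 * y)"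
  define v :: "pt \<Rightarrow> real" where "v = (\<lambda>(x, y, z, t). \<alpha> * t + c * z)"
  define m :: "pt \<Rightarrow> real" where "m = (\<lambda>(x, y, z, t). (m11 * x\<^sup>2 + 2 * m12 * x * y + m22 * y\<^sup>2) / 2)"
  define w where "w Q = v Q + m Q + e Q" for Q
  define d where "d Q = F (P \<star> Q) - F P" for Q
  have e: "negl e" using F unfolding jet_at_negl e_def .
  have L: "order1 L" unfolding L_def by (rule order1_horizontal)
  have w: "negl (\<lambda>Q. (w Q)\<^sup>2)"
    unfolding w_def v_def m_def by (intro negl_sq_add negl_sq_vertical negl_sq_quadratic negl_sq e)
  have dLw: "d Q = L Q + w Q" for Q
    by (cases Q) (simp add: d_def w_def e_def L_def v_def m_def J)
  have Lw: "negl (\<lambda>Q. L Q * w Q)" by (rule order1_mult_negl [OF L w])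
  obtain K1 where K1: "K1 \<ge> 0" "\<forall>\<^sub>F Q in nhds 0. (L Q)\<^sup>2 \<le> K1 * (sqh Q + sqv Q)"
    using L unfolding order1_def by blast
  obtain K2 where K2: "K2 \<ge> 0" "\<forall>\<^sub>F Q in nhds 0. \<bar>(w Q)\<^sup>2\<bar> \<le> 1 * sqh Q + K2 * sqv Q"
    using w unfolding negl_def by (meson zero_less_one)
  define K where "K = 2 * K1 + 2 + 2 * K2"
  have K: "K > 0" using K1 K2 by (simp add: K_def)
  have dK: "\<forall>\<^sub>F Q in nhds 0. (d Q)\<^sup>2 \<le> K * (sqh Q + sqv Q)"
    using K1(2) K2(2)
  proof eventually_elim
    case (elim Q)
    have 1: "(d Q)\<^sup>2 \<le> 2 * (L Q)\<^sup>2 + 2 * (w Q)\<^sup>2"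
      unfolding dLw using zero_le_power2 [of "L Q - w Q"] by (simp add: power2_eq_square algebra_simps)
    have 2: "0 \<le> K2 * sqh Q" using K2 by simp
    have 3: "K * (sqh Q + sqv Q) = 2 * (K1 * (sqh Q + sqv Q)) + 2 * (1 * sqh Q + K2 * sqv Q) + 2 * sqv Q + 2 * (K2 * sqh Q)"
      by (simp add: K_def algebra_simps)
    have *: "a \<le> k" if "a \<le> 2 * l + 2 * b" "l \<le> A" "b \<le> B" "k = 2 * A + 2 * B + 2 * v + 2 * D" "0 \<le> D" "0 \<le> v"
      for a k l b A B v D :: real using that by linarith
    show ?case by (rule * [OF 1 elim(1) elim(2) [unfolded abs_power2] 3 2 sqv_nonneg])
  qed
  have d0: "(d \<longlongrightarrow> 0) (nhds 0)"
  proof -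
    have "((\<lambda>Q. (d Q)\<^sup>2) \<longlongrightarrow> 0) (nhds 0)"
    proof (rule tendsto_sandwich [where f = "\<lambda>_. 0", OF _ dK])
      show "((\<lambda>Q. K * (sqh Q + sqv Q)) \<longlongrightarrow> 0) (nhds 0)"
        using tendsto_sqh_sqv [of K K] by (simp add: distrib_left)
      show "((\<lambda>_. 0) \<longlongrightarrow> (0::real)) (nhds (0::pt))" by simp
    qed auto
    then have "((\<lambda>Q. sqrt ((d Q)\<^sup>2)) \<longlongrightarrow> sqrt 0) (nhds 0)" by (rule tendsto_real_sqrt)
    then show ?thesis by (simp add: tendsto_rabs_zero_iff)
  qed
  define r where "r Q = f (F P + d Q) - f (F P) - f' (F P) * d Q - f2 * (d Q)\<^sup>2 / 2" for Q
  have r: "negl r" unfolding negl_def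
  proof (intro allI impI)
    fix \<eta> :: real assume \<eta>: "\<eta> > 0"
    then have "\<eta> / K > 0" using K by simp
    from eventually_compose_filterlim [OF second_order_Peano [OF f f' this] d0]
    have "\<forall>\<^sub>F Q in nhds 0. \<bar>r Q\<bar> \<le> \<eta> / K * (d Q)\<^sup>2"
      unfolding r_def .
    with dK have "\<forall>\<^sub>F Q in nhds 0. \<bar>r Q\<bar> \<le> \<eta> * sqh Q + \<eta> * sqv Q"
    proof eventually_elim
      case (elim Q)
      have "\<eta> / K * (d Q)\<^sup>2 \<le> \<eta> / K * (K * (sqh Q + sqv Q))" using elim \<eta> K by (intro mult_left_mono) auto
      also have "\<dots> = \<eta> * sqh Q + \<eta> * sqv Q" using K by (simp add: field_simps)
      finally show ?case using elim by simp
    qed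
    then show "\<exists>K\<ge>0. \<forall>\<^sub>F Q in nhds 0. \<bar>r Q\<bar> \<le> \<eta> * sqh Q + K * sqv Q" using \<eta> by (intro exI [of _ \<eta>]) auto
  qed
  have "negl (\<lambda>Q. r Q + (f' (F P) * e Q + (f2 * (L Q * w Q) + f2 / 2 * (w Q)\<^sup>2)))"
    by (intro negl_add negl_cmul r e Lw w)
  moreover have "f (F (P \<star> Q)) - f (F P) - jeval (jcomp (f' (F P)) f2 J) Q =
      r Q + (f' (F P) * e Q + (f2 * (L Q * w Q) + f2 / 2 * (w Q)\<^sup>2))" for Q
  proof -
    obtain x y z t where Q: "Q = (x, y, z, t)" by (cases Q) auto
    have 1: "f (F (P \<star> Q)) - f (F P) = r Q + f' (F P) * d Q + f2 * (d Q)\<^sup>2 / 2"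
      by (simp add: r_def d_def)
    have 2: "jeval (jcomp (f' (F P)) f2 J) Q = f' (F P) * jeval J Q + f2 * (L Q)\<^sup>2 / 2"
      by (simp add: J Q L_def) (simp add: field_simps power2_eq_square)
    have 3: "d Q = jeval J Q + e Q" by (simp add: d_def e_def)
    have 4: "(d Q)\<^sup>2 = (L Q)\<^sup>2 + 2 * (L Q * w Q) + (w Q)\<^sup>2" by (simp add: dLw power2_sum)
    show ?thesis unfolding 1 2 4 unfolding 3 by (simp add: algebra_simps add_divide_distrib)
  qed
  ultimately show ?thesis unfolding jet_at_negl by simp
qed

lemma superjet_of_touching:
  assumes "jet_at \<phi> P J" "\<forall>\<^sub>F Q in nhds 0. w (P \<star> Q) - w P \<le> \<phi> (P \<star> Q) - \<phi> P"
  shows "superjet w P J"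
  unfolding superjet_def
proof (intro allI impI)
  fix \<eta> :: real assume "\<eta> > 0"
  then obtain K where "\<forall>\<^sub>F Q in nhds 0. \<bar>\<phi> (P \<star> Q) - \<phi> P - jeval J Q\<bar> \<le> \<eta> * sqh Q + K * sqv Q"
    using assms(1) unfolding jet_at_def by blast
  with assms(2) have "\<forall>\<^sub>F Q in nhds 0. w (P \<star> Q) \<le> w P + jeval J Q + \<eta> * sqh Q + K * sqv Q"
    by eventually_elim linarith
  then show "\<exists>K. \<forall>\<^sub>F Q in nhds 0. w (P \<star> Q) \<le> w P + jeval J Q + \<eta> * sqh Q + K * sqv Q" ..
qed

lemma subjet_of_touching:
  assumes "jet_at \<phi> P J" "\<forall>\<^sub>F Q in nhds 0. \<phi> (P \<star> Q) - \<phi> P \<le> w (P \<star> Q) - w P"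
  shows "subjet w P J"
  unfolding subjet_def
proof (rule superjet_of_touching)
  show "jet_at (\<lambda>Q. - \<phi> Q) P (- J)" using jet_at_cmul [OF assms(1), of "-1"] by simp
  show "\<forall>\<^sub>F Q in nhds 0. - w (P \<star> Q) - - w P \<le> - \<phi> (P \<star> Q) - - \<phi> P"
    using assms(2) by eventually_elim simp
qed

section \<open>Haar measure and mollification\<close>

lemma nn_integral_shift:
  fixes f :: "real \<Rightarrow> ennreal"
  assumes "f \<in> borel_measurable borel"
  shows "(\<integral>\<^sup>+x. f (x + a) \<partial>lborel) = (\<integral>\<^sup>+x. f x \<partial>lborel)"
  using nn_integral_real_affine [OF assms, of 1 a] by (simp add: add.commute)

lemma nn_integral_pt:
  fixes f :: "pt \<Rightarrow> ennreal"
  assumes [measurable]: "f \<in> borel_measurable borel"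
  shows "(\<integral>\<^sup>+P. f P \<partial>lborel) = (\<integral>\<^sup>+x. \<integral>\<^sup>+y. \<integral>\<^sup>+z. \<integral>\<^sup>+t. f (x, y, z, t) \<partial>lborel \<partial>lborel \<partial>lborel \<partial>lborel)"
proof -
  have P: "(\<integral>\<^sup>+P. g P \<partial>lborel) = (\<integral>\<^sup>+x. \<integral>\<^sup>+y. g (x, y) \<partial>lborel \<partial>lborel)"
    if "g \<in> borel_measurable borel" for g :: "'a::euclidean_space \<times> 'b::euclidean_space \<Rightarrow> ennreal"
    using lborel.nn_integral_fst [of g lborel] that by (simp add: lborel_prod)
  show ?thesis
    by (subst P, measurable)+
qed

lemma borel_measurable_gmul [measurable]: "(\<lambda>P. P \<star> R) \<in> borel_measurable borel"
  by (intro borel_measurable_continuous_onI continuous_intros)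

text \<open>Right translation shifts each coordinate by an amount depending only on the coordinates
  integrated further out, so with the order of integration \<open>x\<close>, \<open>y\<close>,
  \<open>z\<close>, \<open>t\<close> it reduces to translations of the line. Invariance on the right
  is what moves an increment from the mollified function onto the kernel.\<close>

lemma nn_integral_gmul:
  fixes f :: "pt \<Rightarrow> ennreal"
  assumes f [measurable]: "f \<in> borel_measurable borel"
  shows "(\<integral>\<^sup>+P. f (P \<star> R) \<partial>lborel) = (\<integral>\<^sup>+P. f P \<partial>lborel)"
proof -
  obtain a b c d where R: "R = (a, b, c, d)" by (cases R) auto
  have 1: "(\<integral>\<^sup>+t. f (u, v, w, t + d) \<partial>lborel) = (\<integral>\<^sup>+t. f (u, v, w, t) \<partial>lborel)" for u v w
    by (rule nn_integral_shift) measurable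
  have 2: "(\<integral>\<^sup>+z. \<integral>\<^sup>+t. f (u, v, z + e, t) \<partial>lborel \<partial>lborel) = (\<integral>\<^sup>+z. \<integral>\<^sup>+t. f (u, v, z, t) \<partial>lborel \<partial>lborel)" for u v e
    by (rule nn_integral_shift [of "\<lambda>z. \<integral>\<^sup>+t. f (u, v, z, t) \<partial>lborel"]) measurable
  have 3: "(\<integral>\<^sup>+y. \<integral>\<^sup>+z. \<integral>\<^sup>+t. f (u, y + b, z, t) \<partial>lborel \<partial>lborel \<partial>lborel)
      = (\<integral>\<^sup>+y. \<integral>\<^sup>+z. \<integral>\<^sup>+t. f (u, y, z, t) \<partial>lborel \<partial>lborel \<partial>lborel)" for u
    by (rule nn_integral_shift [of "\<lambda>y. \<integral>\<^sup>+z. \<integral>\<^sup>+t. f (u, y, z, t) \<partial>lborel \<partial>lborel"]) measurable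
  have 4: "(\<integral>\<^sup>+x. \<integral>\<^sup>+y. \<integral>\<^sup>+z. \<integral>\<^sup>+t. f (x + a, y, z, t) \<partial>lborel \<partial>lborel \<partial>lborel \<partial>lborel)
      = (\<integral>\<^sup>+x. \<integral>\<^sup>+y. \<integral>\<^sup>+z. \<integral>\<^sup>+t. f (x, y, z, t) \<partial>lborel \<partial>lborel \<partial>lborel \<partial>lborel)"
    by (rule nn_integral_shift [of "\<lambda>x. \<integral>\<^sup>+y. \<integral>\<^sup>+z. \<integral>\<^sup>+t. f (x, y, z, t) \<partial>lborel \<partial>lborel \<partial>lborel"]) measurable
  have "(\<lambda>P. f (P \<star> R)) \<in> borel_measurable borel" by measurable
  then have "(\<integral>\<^sup>+P. f (P \<star> R) \<partial>lborel)
      = (\<integral>\<^sup>+x. \<integral>\<^sup>+y. \<integral>\<^sup>+z. \<integral>\<^sup>+t. f (x + a, y + b, z + (c + (x * b - a * y) / 2), t + d) \<partial>lborel \<partial>lborel \<partial>lborel \<partial>lborel)"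
    by (subst nn_integral_pt) (simp_all add: R add.assoc)
  also have "\<dots> = (\<integral>\<^sup>+x. \<integral>\<^sup>+y. \<integral>\<^sup>+z. \<integral>\<^sup>+t. f (x, y, z, t) \<partial>lborel \<partial>lborel \<partial>lborel \<partial>lborel)"
    by (simp only: 1 2 3 4)
  finally show ?thesis by (simp add: nn_integral_pt [OF f])
qed

lemma lborel_distr_gmul: "distr lborel borel (\<lambda>P. P \<star> R) = (lborel :: pt measure)"
proof (rule measure_eqI)
  fix A :: "pt set" assume "A \<in> sets (distr lborel borel (\<lambda>P. P \<star> R))"
  then have [measurable]: "A \<in> sets borel" by simp
  have "emeasure (distr lborel borel (\<lambda>P. P \<star> R)) A = (\<integral>\<^sup>+P. indicator A P \<partial>distr lborel borel (\<lambda>P. P \<star> R))"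
    by simp
  also have "\<dots> = (\<integral>\<^sup>+P. indicator A (P \<star> R) \<partial>lborel)"
    by (subst nn_integral_distr) measurable
  also have "\<dots> = (\<integral>\<^sup>+P. indicator A P \<partial>lborel)"
    by (rule nn_integral_gmul) measurable
  finally show "emeasure (distr lborel borel (\<lambda>P. P \<star> R)) A = emeasure lborel A" by simp
qed simp

lemma integral_gmul:
  fixes f :: "pt \<Rightarrow> real"
  assumes "f \<in> borel_measurable borel"
  shows "(\<integral>P. f (P \<star> R) \<partial>lborel) = (\<integral>P. f P \<partial>lborel)"
  using integral_distr [of "\<lambda>P. P \<star> R" lborel borel f] assms by (simp add: lborel_distr_gmul)

lemma integrable_continuous_compact_support:
  fixes f :: "'a::euclidean_space \<Rightarrow> 'b::{banach, second_countable_topology}"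
  assumes "continuous_on UNIV f" "compact S" "\<And>x. x \<notin> S \<Longrightarrow> f x = 0"
  shows "integrable lborel f"
proof -
  have "integrable lborel (\<lambda>x. indicator S x *\<^sub>R f x)"
    using assms by (intro borel_integrable_compact) (auto intro: continuous_on_subset)
  moreover have "(\<lambda>x. indicator S x *\<^sub>R f x) = f"
    using assms(3) by (auto simp: indicator_def fun_eq_iff)
  ultimately show ?thesis by simp
qed

definition nsq :: "pt \<Rightarrow> real" where
  "nsq Q = (case Q of (x, y, z, t) \<Rightarrow> x\<^sup>2 + y\<^sup>2 + z\<^sup>2 + t\<^sup>2)"

lemma nsq_simp [simp]: "nsq (x, y, z, t) = x\<^sup>2 + y\<^sup>2 + z\<^sup>2 + t\<^sup>2"
  by (simp add: nsq_def)

lemma nsq_norm: "nsq Q = (norm Q)\<^sup>2"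
  by (cases Q) (simp add: norm_Pair)

lemma continuous_on_nsq [continuous_intros]:
  "continuous_on S f \<Longrightarrow> continuous_on S (\<lambda>x. nsq (f x))"
  unfolding nsq_norm by (intro continuous_intros)

text \<open>The fourth power of a positive part is three times continuously differentiable across
  the sphere, enough for a third-order Taylor remainder, and its derivatives stay piecewise
  polynomial. Normalization is left to \<open>mollify\<close>.\<close>

definition kern :: "real \<Rightarrow> pt \<Rightarrow> real" where
  "kern \<delta> Q = (max 0 (\<delta>\<^sup>2 - nsq Q)) ^ 4"

lemma kern_nonneg [simp]: "0 \<le> kern \<delta> Q"
  by (simp add: kern_def)

lemma kern_0: "\<delta> \<ge> 0 \<Longrightarrow> norm Q > \<delta> \<Longrightarrow> kern \<delta> Q = 0"
  using power_strict_mono [of \<delta> "norm Q" 2] by (simp add: kern_def nsq_norm max_def)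

lemma continuous_on_kern [continuous_intros]:
  "continuous_on S f \<Longrightarrow> continuous_on S (\<lambda>x. kern \<delta> (f x))"
  unfolding kern_def by (intro continuous_intros)

lemma integrable_kern_mult:
  assumes "\<delta> > 0" "continuous_on UNIV F"
  shows "integrable lborel (\<lambda>g. kern \<delta> g * F (g \<star> P))"
proof (rule integrable_continuous_compact_support)
  show "continuous_on UNIV (\<lambda>g. kern \<delta> g * F (g \<star> P))"
    by (intro continuous_intros continuous_on_compose2 [OF assms(2)]) auto
  show "kern \<delta> g * F (g \<star> P) = 0" if "g \<notin> cball 0 \<delta>" for g
    using that assms kern_0 [of \<delta> g] by auto
qed auto

lemma integrable_kern: "\<delta> > 0 \<Longrightarrow> integrable lborel (kern \<delta>)"
  using integrable_kern_mult [of \<delta> "\<lambda>_. 1" 0] by simp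

lemma integral_kern_pos:
  assumes "\<delta> > 0" shows "(\<integral>g. kern \<delta> g \<partial>lborel) > 0"
proof -
  have "0 < (3 * \<delta>\<^sup>2 / 4) ^ 4 * measure lborel (ball (0::pt) (\<delta> / 2))"
    using assms by (intro mult_pos_pos content_ball_pos) auto
  also have "\<dots> = (\<integral>g. (3 * \<delta>\<^sup>2 / 4) ^ 4 * indicator (ball (0::pt) (\<delta> / 2)) g \<partial>lborel)"
    using emeasure_lborel_ball_finite [of "0::pt"] by simp
  also have "\<dots> \<le> (\<integral>g. kern \<delta> g \<partial>lborel)"
  proof (rule integral_mono)
    show "integrable lborel (\<lambda>g. (3 * \<delta>\<^sup>2 / 4) ^ 4 * indicator (ball (0::pt) (\<delta> / 2)) g)"
      using emeasure_lborel_ball_finite [of "0::pt"] by (intro integrable_mult_right) simp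
    show "integrable lborel (kern \<delta>)" using assms by (rule integrable_kern)
    fix g :: pt
    show "(3 * \<delta>\<^sup>2 / 4) ^ 4 * indicator (ball 0 (\<delta> / 2)) g \<le> kern \<delta> g"
    proof (cases "g \<in> ball 0 (\<delta> / 2)")
      case True
      then have "(norm g)\<^sup>2 \<le> (\<delta> / 2)\<^sup>2" by (intro power_mono) auto
      then have "3 * \<delta>\<^sup>2 / 4 \<le> \<delta>\<^sup>2 - nsq g" by (simp add: nsq_norm power_divide)
      then have "3 * \<delta>\<^sup>2 / 4 \<le> max 0 (\<delta>\<^sup>2 - nsq g)" by (rule max.coboundedI2)
      then have "(3 * \<delta>\<^sup>2 / 4) ^ 4 \<le> kern \<delta> g" unfolding kern_def by (intro power_mono) auto
      then show ?thesis using True by simp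
    qed simp
  qed
  finally show ?thesis .
qed

definition mollify :: "real \<Rightarrow> (pt \<Rightarrow> real) \<Rightarrow> pt \<Rightarrow> real" where
  "mollify \<delta> F P = (\<integral>g. kern \<delta> g * F (g \<star> P) \<partial>lborel) / (\<integral>g. kern \<delta> g \<partial>lborel)"

lemma mollify_add:
  assumes "\<delta> > 0" "continuous_on UNIV F" "continuous_on UNIV G"
  shows "mollify \<delta> (\<lambda>P. F P + G P) P = mollify \<delta> F P + mollify \<delta> G P"
  unfolding mollify_def
  using Bochner_Integration.integral_add [OF integrable_kern_mult [OF assms(1,2)] integrable_kern_mult [OF assms(1,3)]]
  by (simp add: distrib_left add_divide_distrib)

lemma mollify_cmul: "mollify \<delta> (\<lambda>P. k * F P) P = k * mollify \<delta> F P"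
proof -
  have "(\<lambda>g. kern \<delta> g * (k * F (g \<star> P))) = (\<lambda>g. k * (kern \<delta> g * F (g \<star> P)))"
    by (simp add: fun_eq_iff)
  then have "(\<integral>g. kern \<delta> g * (k * F (g \<star> P)) \<partial>lborel) = k * (\<integral>g. kern \<delta> g * F (g \<star> P) \<partial>lborel)"
    by (simp only: integral_mult_right_zero)
  then show ?thesis by (simp add: mollify_def)
qed

lemma mollify_mono:
  assumes "\<delta> > 0" "continuous_on UNIV F" "continuous_on UNIV G"
    "\<And>g. norm g \<le> \<delta> \<Longrightarrow> F (g \<star> P) \<le> G (g \<star> P')"
  shows "mollify \<delta> F P \<le> mollify \<delta> G P'"
  unfolding mollify_def
proof (intro divide_right_mono integral_mono integrable_kern_mult assms)
  fix g :: pt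
  show "kern \<delta> g * F (g \<star> P) \<le> kern \<delta> g * G (g \<star> P')"
  proof (cases "norm g \<le> \<delta>")
    case True then show ?thesis by (intro mult_left_mono assms) auto
  qed (use assms(1) kern_0 [of \<delta> g] in auto)
qed (use integral_kern_pos [OF assms(1)] in auto)

lemma mollify_const: "\<delta> > 0 \<Longrightarrow> mollify \<delta> (\<lambda>_. k) P = k"
  using integral_kern_pos [of \<delta>] by (simp add: mollify_def)

lemma mollify_add_const:
  assumes "\<delta> > 0" "continuous_on UNIV F"
  shows "mollify \<delta> (\<lambda>P. F P + k) P = mollify \<delta> F P + k"
  using mollify_add [OF assms continuous_on_const] mollify_const [OF assms(1)] by simp

lemma mollify_cong:
  assumes "\<delta> > 0" "continuous_on UNIV F" "continuous_on UNIV G"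
    "\<And>g. norm g \<le> \<delta> \<Longrightarrow> F (g \<star> P) = G (g \<star> P')"
  shows "mollify \<delta> F P = mollify \<delta> G P'"
  using assms(4) by (intro antisym mollify_mono assms(1-3)) simp_all

lemma mollify_bounds:
  assumes "\<delta> > 0" "continuous_on UNIV F" "\<And>g. norm g \<le> \<delta> \<Longrightarrow> \<bar>F (g \<star> P) - k\<bar> \<le> e"
  shows "\<bar>mollify \<delta> F P - k\<bar> \<le> e"
proof -
  have "mollify \<delta> F P \<le> mollify \<delta> (\<lambda>_. k + e) P"
  proof (rule mollify_mono)
    show "F (g \<star> P) \<le> k + e" if "norm g \<le> \<delta>" for g using assms(3) [OF that] by linarith
  qed (use assms in auto)
  moreover have "mollify \<delta> (\<lambda>_. k - e) P \<le> mollify \<delta> F P"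
  proof (rule mollify_mono)
    show "k - e \<le> F (g \<star> P)" if "norm g \<le> \<delta>" for g using assms(3) [OF that] by linarith
  qed (use assms in auto)
  ultimately show ?thesis using assms(1) by (simp add: mollify_const)
qed

lemma continuous_on_mollify_translate: "continuous_on UNIV F \<Longrightarrow> continuous_on UNIV (\<lambda>P. F (P \<star> h))"
  by (rule continuous_on_compose2 [of UNIV F]) (auto intro!: continuous_intros)

text \<open>Averaging over left factors commutes with right shifts by associativity. An operator
  built from right shifts, such as the random walk average below, therefore passes through the
  mollification.\<close>

lemma mollify_translate: "mollify \<delta> (\<lambda>P. F (P \<star> h)) P = mollify \<delta> F (P \<star> h)"
  by (simp add: mollify_def gmul_assoc)

section \<open>Second-order Taylor expansion of mollified functions\<close>

definition ubox :: "pt set" where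
  "ubox = {(x, y, z, t). \<bar>x\<bar> \<le> 1 \<and> \<bar>y\<bar> \<le> 1 \<and> \<bar>z\<bar> \<le> 1 \<and> \<bar>t\<bar> \<le> 1}"

text \<open>Third order in the parabolic scaling: for horizontal increments of size \<open>s\<close>
  and vertical or time increments of size \<open>s\<^sup>2\<close>, all terms are of order
  \<open>s ^ 3\<close>.\<close>

definition rem3 :: "pt \<Rightarrow> real" where
  "rem3 Q = (case Q of (x, y, z, t) \<Rightarrow>
     (\<bar>x\<bar> + \<bar>y\<bar>) ^ 3 + (\<bar>z\<bar> + \<bar>t\<bar>) * (\<bar>x\<bar> + \<bar>y\<bar> + (\<bar>z\<bar> + \<bar>t\<bar>)))"

lemma rem3_nonneg [simp]: "0 \<le> rem3 Q"
  by (cases Q) (auto simp: rem3_def intro!: add_nonneg_nonneg mult_nonneg_nonneg)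

text \<open>In contrast to \<open>jet_at\<close>, the bound holds on a fixed box with an explicit
  constant. One constant can then serve for a family of functions and points, and the step of a
  random walk can be chosen after it.\<close>

definition taylor2 :: "(pt \<Rightarrow> real) \<Rightarrow> pt \<Rightarrow> jet \<Rightarrow> real \<Rightarrow> bool" where
  "taylor2 F P J K \<longleftrightarrow> (\<forall>Q\<in>ubox. \<bar>F (P \<star> Q) - F P - jeval J Q\<bar> \<le> K * rem3 Q)"

text \<open>The factor \<open>11 = 1 + 4 + 6\<close> covers the case where \<open>s\<close> is
  nonnegative and \<open>s + d\<close> negative: then \<open>s \<le> \<bar>d\<bar>\<close>, and each
  of the three remaining terms is bounded by its coefficient times \<open>d ^ 4\<close>.\<close>

lemma pos_part_pow4_taylor:
  fixes s d :: real
  shows "\<bar>(max 0 (s + d)) ^ 4 - (max 0 s) ^ 4 - 4 * (max 0 s) ^ 3 * d - 6 * (max 0 s)\<^sup>2 * d\<^sup>2\<bar>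
    \<le> 4 * max 0 s * \<bar>d\<bar> ^ 3 + 11 * d ^ 4"
proof -
  consider "s \<ge> 0" "s + d \<ge> 0" | "s \<ge> 0" "s + d < 0" | "s < 0" "s + d \<ge> 0" | "s < 0" "s + d < 0" by linarith
  then show ?thesis
  proof cases
    case 1
    then have eq: "(max 0 (s + d)) ^ 4 - (max 0 s) ^ 4 - 4 * (max 0 s) ^ 3 * d - 6 * (max 0 s)\<^sup>2 * d\<^sup>2 = 4 * s * d ^ 3 + d ^ 4"
      by (simp add: max_def) (simp add: power2_eq_square power3_eq_cube power4_eq_xxxx algebra_simps)
    have "\<bar>4 * s * d ^ 3 + d ^ 4\<bar> \<le> \<bar>4 * s * d ^ 3\<bar> + \<bar>d ^ 4\<bar>" by (rule abs_triangle_ineq)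
    moreover have "\<bar>4 * s * d ^ 3\<bar> = 4 * s * \<bar>d\<bar> ^ 3" using 1 by (simp add: abs_mult power_abs)
    moreover have "\<bar>d ^ 4\<bar> \<le> 11 * d ^ 4" by simp
    ultimately have "\<bar>4 * s * d ^ 3 + d ^ 4\<bar> \<le> 4 * s * \<bar>d\<bar> ^ 3 + 11 * d ^ 4" by linarith
    then show ?thesis using 1 eq by (simp add: max_def)
  next
    case 2
    define e where "e = - d"
    have e: "s \<le> e" "0 \<le> e" using 2 by (auto simp: e_def)
    have mx: "max 0 (s + d) = 0" "max 0 s = s" using 2 by auto
    have de: "d = - e" "\<bar>d\<bar> = e" using e by (auto simp: e_def)
    have 3: "s ^ 4 \<le> e ^ 4" using 2 e by (intro power_mono) auto
    have "s ^ 3 * e \<le> e ^ 3 * e" "s\<^sup>2 * e\<^sup>2 \<le> e\<^sup>2 * e\<^sup>2"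
      using 2 e by (intro mult_right_mono power_mono; simp)+
    then have 4: "s ^ 3 * e \<le> e ^ 4" "s\<^sup>2 * e\<^sup>2 \<le> e ^ 4"
      by (simp_all add: power3_eq_cube power4_eq_xxxx power2_eq_square)
    have 5: "0 \<le> s ^ 4" "0 \<le> s\<^sup>2 * e\<^sup>2" "0 \<le> s * e ^ 3" "0 \<le> s ^ 3 * e" using 2 e by auto
    have "\<bar>- (s ^ 4) + 4 * (s ^ 3 * e) - 6 * (s\<^sup>2 * e\<^sup>2)\<bar> \<le> 4 * (s * e ^ 3) + 11 * e ^ 4"
      using 3 4 5 by (intro abs_leI) linarith+
    then show ?thesis unfolding mx de(2) unfolding de(1) by (simp add: mult.assoc)
  next
    case 3
    have "(s + d) ^ 4 \<le> \<bar>d\<bar> ^ 4" using 3 by (intro power_mono) auto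
    moreover have "0 \<le> \<bar>d\<bar> ^ 4" by simp
    ultimately have "(s + d) ^ 4 \<le> 11 * \<bar>d\<bar> ^ 4" by linarith
    then show ?thesis using 3 by (simp add: max_def)
  next
    case 4
    then show ?thesis by (simp add: max_def)
  qed
qed

text \<open>The jet at \<open>Q = 0\<close> of
  \<open>kern \<delta> (g \<star> ginv (P \<star> Q \<star> ginv P))\<close>. The factors
  \<open>l1\<close>, \<open>l2\<close> are the horizontal derivatives of
  \<open>\<delta>\<^sup>2 - nsq\<close> along this curve of points; \<open>e1\<close>,
  \<open>e2\<close> collect the central terms produced by the conjugation and by the product with
  \<open>g\<close>. Of \<open>P\<close> only \<open>X\<close> and \<open>Y\<close> enter.\<close>

definition kjet :: "real \<Rightarrow> pt \<Rightarrow> pt \<Rightarrow> jet" where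
  "kjet \<delta> P g = (case P of (X, Y, Z, T) \<Rightarrow> case g of (g1, g2, g3, g4) \<Rightarrow>
    let m = max 0 (\<delta>\<^sup>2 - nsq g); e1 = Y + g2 / 2; e2 = X + g1 / 2;
        l1 = 2 * (g1 - g3 * e1); l2 = 2 * (g2 + g3 * e2)
    in (8 * m ^ 3 * g4, (4 * m ^ 3 * l1, 4 * m ^ 3 * l2), 8 * m ^ 3 * g3,
        (- 8 * m ^ 3 * (1 + e1\<^sup>2) + 12 * m\<^sup>2 * l1\<^sup>2,
         8 * m ^ 3 * e1 * e2 + 12 * m\<^sup>2 * l1 * l2,
         - 8 * m ^ 3 * (1 + e2\<^sup>2) + 12 * m\<^sup>2 * l2\<^sup>2)))"

lemma continuous_on_kjet: "continuous_on UNIV (kjet \<delta> P)"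
  unfolding kjet_def case_prod_unfold Let_def
  by (intro continuous_intros) auto

lemma kjet_0: "\<delta> \<ge> 0 \<Longrightarrow> norm g > \<delta> \<Longrightarrow> kjet \<delta> P g = 0"
  using power_strict_mono [of \<delta> "norm g" 2]
  by (cases P; cases g) (simp add: kjet_def nsq_norm Let_def max_def zero_prod_def del: nsq_simp)

lemma bounded_linear_jeval: "bounded_linear (\<lambda>J. jeval J Q)"
  unfolding linear_conv_bounded_linear [symmetric]
  by (intro linearI) (simp_all add: jeval_add jeval_scaleR)

lemma abs_mult_le: "\<bar>a\<bar> \<le> A \<Longrightarrow> \<bar>b\<bar> \<le> B \<Longrightarrow> \<bar>a * b\<bar> \<le> A * (B::real)"
  unfolding abs_mult by (intro mult_mono) auto

text \<open>\<open>a\<close> and \<open>b\<close> stand for the horizontal and the vertical size of the increment, \<open>p\<close> for the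
  linear part of \<open>d\<close> in the horizontal variables and \<open>q\<close> for its quadratic part.\<close>

lemma kern_remainder_bound:
  fixes m d p q a b H :: real
  assumes H: "H \<ge> 1" and m: "0 \<le> m" "m \<le> H" and a: "0 \<le> a" "a \<le> 2" and b: "0 \<le> b" "b \<le> 2"
    and p: "\<bar>p\<bar> \<le> 4 * H\<^sup>2 * a" and q: "\<bar>q\<bar> \<le> 2 * H\<^sup>2 * a\<^sup>2"
    and v: "\<bar>v\<bar> \<le> 4 * H * b" and junk: "\<bar>junk\<bar> \<le> 8 * H * (b * (a + b))"
    and d: "d = p + v - q - junk" and m_eq: "m = max 0 s"
  shows "\<bar>(max 0 (s + d)) ^ 4 - (max 0 s) ^ 4 - 4 * (max 0 s) ^ 3 * (p + v - q) - 6 * (max 0 s)\<^sup>2 * p\<^sup>2\<bar>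
    \<le> 10 ^ 13 * H ^ 8 * (a ^ 3 + b * (a + b))"
proof -
  define r where "r = a ^ 3 + b * (a + b)"
  have r0: "r \<ge> 0" using a b by (auto simp: r_def intro!: add_nonneg_nonneg mult_nonneg_nonneg)
  define n where "n = a + b"
  have n: "0 \<le> n" "n \<le> 4" using a b by (auto simp: n_def)
  have bn: "b * n \<le> r" using a by (simp add: r_def n_def)
  have Hp: "1 \<le> H ^ k" for k using H by (rule one_le_power)
  have Hle: "H \<le> H\<^sup>2" using H by (simp add: self_le_power)
  have a2: "a\<^sup>2 \<le> 2 * a" using a by (simp add: power2_eq_square mult_right_mono)
  have junk': "\<bar>junk\<bar> \<le> 16 * H\<^sup>2 * b * 2"
  proof -
    have "8 * H * (b * n) \<le> 8 * H\<^sup>2 * (b * 4)"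
      using Hle b n H by (intro mult_mono) auto
    moreover have "\<bar>junk\<bar> \<le> 8 * H * (b * n)" using junk by (simp add: n_def)
    ultimately show ?thesis by (simp only: mult_ac)
  qed
  have v': "\<bar>v\<bar> \<le> 4 * H\<^sup>2 * b" using v mult_right_mono [OF Hle b(1)] by simp
  have dp: "\<bar>d - p\<bar> \<le> 36 * H\<^sup>2 * (a\<^sup>2 + b)"
  proof -
    have "\<bar>d - p\<bar> \<le> \<bar>v\<bar> + \<bar>q\<bar> + \<bar>junk\<bar>" unfolding d by linarith
    moreover have "36 * H\<^sup>2 * (a\<^sup>2 + b) = 4 * H\<^sup>2 * b + 2 * H\<^sup>2 * a\<^sup>2 + 16 * H\<^sup>2 * b * 2 + 34 * (H\<^sup>2 * a\<^sup>2)"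
      by (simp add: algebra_simps)
    moreover have "0 \<le> H\<^sup>2 * a\<^sup>2" by simp
    ultimately show ?thesis using v' q junk' by linarith
  qed
  have dn: "\<bar>d\<bar> \<le> 76 * H\<^sup>2 * n"
  proof -
    have "\<bar>d\<bar> \<le> \<bar>d - p\<bar> + \<bar>p\<bar>" by linarith
    moreover have "36 * H\<^sup>2 * (a\<^sup>2 + b) \<le> 36 * H\<^sup>2 * (2 * a + b)" using a2 by (intro mult_left_mono) auto
    moreover have "76 * H\<^sup>2 * n = 36 * H\<^sup>2 * (2 * a + b) + 4 * H\<^sup>2 * a + 40 * (H\<^sup>2 * b)" by (simp add: n_def algebra_simps)
    moreover have "0 \<le> H\<^sup>2 * b" using b by simp
    ultimately show ?thesis using p dp by linarith
  qed
  have dpp: "\<bar>d + p\<bar> \<le> 80 * H\<^sup>2 * n"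
  proof -
    have "4 * H\<^sup>2 * a \<le> 4 * H\<^sup>2 * n" using a b by (intro mult_left_mono) (auto simp: n_def)
    then show ?thesis using dn p by (simp add: algebra_simps)
  qed
  have an: "(a\<^sup>2 + b) * n \<le> 3 * r"
  proof -
    have "a\<^sup>2 * b \<le> 2 * a * b" using a2 b by (intro mult_right_mono) auto
    also have "\<dots> \<le> 2 * (b * n)" using b by (simp add: n_def algebra_simps)
    finally have "a\<^sup>2 * b \<le> 2 * (b * n)" .
    moreover have "(a\<^sup>2 + b) * n = a ^ 3 + a\<^sup>2 * b + b * n"
      by (simp add: n_def power2_eq_square power3_eq_cube algebra_simps)
    moreover have "r = a ^ 3 + b * n" by (simp add: r_def n_def)
    moreover have "0 \<le> a ^ 3" using a by simp
    ultimately show ?thesis by linarith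
  qed
  have d2: "\<bar>d\<^sup>2 - p\<^sup>2\<bar> \<le> 8640 * H ^ 4 * r"
  proof -
    have "d\<^sup>2 - p\<^sup>2 = (d - p) * (d + p)" by (simp add: power2_eq_square algebra_simps)
    then have "\<bar>d\<^sup>2 - p\<^sup>2\<bar> \<le> (36 * H\<^sup>2 * (a\<^sup>2 + b)) * (80 * H\<^sup>2 * n)"
      using abs_mult_le [OF dp dpp] by simp
    also have "\<dots> = 2880 * H ^ 4 * ((a\<^sup>2 + b) * n)" by (simp add: power2_eq_square power4_eq_xxxx)
    also have "\<dots> \<le> 2880 * H ^ 4 * (3 * r)" using an by (intro mult_left_mono) auto
    finally show ?thesis by simp
  qed
  have n3: "n ^ 3 \<le> 13 * r"
  proof -
    have "n ^ 3 = a ^ 3 + b * (3 * a\<^sup>2 + 3 * (a * b) + b\<^sup>2)"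
      by (simp add: n_def power3_eq_cube power2_eq_square algebra_simps)
    also have "\<dots> \<le> a ^ 3 + b * (6 * a + 6 * a + 2 * b)"
    proof -
      have "a * b \<le> a * 2" "b\<^sup>2 \<le> 2 * b" using a b by (auto simp: power2_eq_square intro: mult_left_mono mult_right_mono)
      then show ?thesis using a2 b by (intro add_left_mono mult_left_mono) auto
    qed
    also have "\<dots> \<le> a ^ 3 + 12 * (b * n)" using b by (simp add: n_def algebra_simps)
    also have "\<dots> \<le> 13 * r" using bn b n a unfolding r_def n_def by (simp add: algebra_simps)
    finally show ?thesis .
  qed
  have d3: "\<bar>d\<bar> ^ 3 \<le> 76 ^ 3 * H ^ 6 * (13 * r)"
  proof -
    have "\<bar>d\<bar> ^ 3 \<le> (76 * H\<^sup>2 * n) ^ 3" using dn by (intro power_mono) auto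
    also have "\<dots> = 76 ^ 3 * H ^ 6 * n ^ 3" by (simp add: power_mult_distrib power_mult [symmetric])
    also have "\<dots> \<le> 76 ^ 3 * H ^ 6 * (13 * r)" using n3 by (intro mult_left_mono) auto
    finally show ?thesis .
  qed
  \<comment> \<open>The numerical factor is \<open>76 ^ 3 * 13 * (4 + 11 * 76 * 4)\<close>, from
    \<open>H \<le> H\<^sup>2\<close> and \<open>n \<le> 4\<close>, rounded up to a power of ten.
    Only its independence of the point and of the increment matters.\<close>
  have R: "4 * m * \<bar>d\<bar> ^ 3 + 11 * d ^ 4 \<le> 10 ^ 12 * H ^ 8 * r"
  proof -
    have "d ^ 4 = \<bar>d\<bar> ^ 3 * \<bar>d\<bar>" by (simp add: power3_eq_cube power4_eq_xxxx)
    then have "4 * m * \<bar>d\<bar> ^ 3 + 11 * d ^ 4 = \<bar>d\<bar> ^ 3 * (4 * m + 11 * \<bar>d\<bar>)" by (simp add: algebra_simps)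
    also have "\<dots> \<le> (76 ^ 3 * H ^ 6 * (13 * r)) * (4 * H\<^sup>2 + 11 * (76 * H\<^sup>2 * 4))"
    proof (intro mult_mono add_mono)
      have "76 * H\<^sup>2 * n \<le> 76 * H\<^sup>2 * 4" using n by (intro mult_left_mono) auto
      then show "\<bar>d\<bar> \<le> 76 * H\<^sup>2 * 4" using dn by linarith
    qed (use d3 m Hle r0 in auto)
    also have "\<dots> = (76 ^ 3 * 13 * 3348) * (H ^ 8 * r)" by (simp add: algebra_simps power_add [symmetric])
    also have "\<dots> \<le> 10 ^ 12 * (H ^ 8 * r)" using r0 by (intro mult_right_mono) auto
    finally show ?thesis by simp
  qed
  have Hk: "H ^ k * r \<le> H ^ 8 * r" if "k \<le> 8" for k
    using H r0 that by (intro mult_right_mono power_increasing) auto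
  have mk: "m ^ k \<le> H ^ k" for k using m by (intro power_mono) auto
  have e1: "\<bar>4 * m ^ 3 * junk\<bar> \<le> 32 * (H ^ 8 * r)"
  proof -
    have "\<bar>4 * m ^ 3 * junk\<bar> \<le> (4 * H ^ 3) * (8 * H * (b * n))"
      using mk [of 3] m junk by (intro abs_mult_le) (auto simp: n_def abs_mult)
    also have "\<dots> = 32 * (H ^ 4 * (b * n))" by (simp add: power3_eq_cube power4_eq_xxxx)
    also have "\<dots> \<le> 32 * (H ^ 4 * r)" using bn H by (intro mult_left_mono) auto
    finally show ?thesis using Hk [of 4] by simp
  qed
  have e2: "\<bar>6 * m\<^sup>2 * (d\<^sup>2 - p\<^sup>2)\<bar> \<le> 51840 * (H ^ 8 * r)"
  proof -
    have "\<bar>6 * m\<^sup>2 * (d\<^sup>2 - p\<^sup>2)\<bar> \<le> (6 * H\<^sup>2) * (8640 * H ^ 4 * r)"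
      using mk [of 2] m d2 by (intro abs_mult_le) (auto simp: abs_mult)
    also have "\<dots> = 51840 * (H ^ 6 * r)" by (simp add: algebra_simps power_add [symmetric])
    finally show ?thesis using Hk [of 6] by simp
  qed
  have e3: "\<bar>(max 0 (s + d)) ^ 4 - m ^ 4 - 4 * m ^ 3 * d - 6 * m\<^sup>2 * d\<^sup>2\<bar> \<le> 10 ^ 12 * (H ^ 8 * r)"
    using pos_part_pow4_taylor [of s d] R unfolding m_eq [symmetric] by simp
  have "(max 0 (s + d)) ^ 4 - m ^ 4 - 4 * m ^ 3 * (p + v - q) - 6 * m\<^sup>2 * p\<^sup>2
      = ((max 0 (s + d)) ^ 4 - m ^ 4 - 4 * m ^ 3 * d - 6 * m\<^sup>2 * d\<^sup>2) - 4 * m ^ 3 * junk + 6 * m\<^sup>2 * (d\<^sup>2 - p\<^sup>2)"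
    unfolding d by (simp add: algebra_simps)
  moreover have "0 \<le> H ^ 8 * r" using r0 H by simp
  moreover have "\<bar>u\<bar> \<le> 10 ^ 13 * w" if "u = A - B + C" "0 \<le> w" "\<bar>B\<bar> \<le> 32 * w" "\<bar>C\<bar> \<le> 51840 * w" "\<bar>A\<bar> \<le> 10 ^ 12 * w"
    for u A B C w :: real using that unfolding abs_le_iff by (intro conjI; simp)
  ultimately have "\<bar>(max 0 (s + d)) ^ 4 - m ^ 4 - 4 * m ^ 3 * (p + v - q) - 6 * m\<^sup>2 * p\<^sup>2\<bar> \<le> 10 ^ 13 * (H ^ 8 * r)"
    using e1 e2 e3 by blast
  then show ?thesis unfolding m_eq [symmetric] r_def by (simp add: mult.assoc)
qed

lemma abs_le_norm_pt:
  assumes "norm (x, y, z, t) \<le> (r::real)"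
  shows "\<bar>x\<bar> \<le> r" "\<bar>y\<bar> \<le> r" "\<bar>z\<bar> \<le> r" "\<bar>t\<bar> \<le> (r::real)"
proof -
  have "norm x \<le> norm (x, y, z, t)" by (rule norm_fst_le)
  then show "\<bar>x\<bar> \<le> r" using assms by simp
  have "norm (y, z, t) \<le> norm (x, y, z, t)" by (rule norm_snd_le)
  then have 1: "norm (y, z, t) \<le> r" using assms by linarith
  have "norm y \<le> norm (y, z, t)" by (rule norm_fst_le)
  then show "\<bar>y\<bar> \<le> r" using 1 by simp
  have "norm (z, t) \<le> norm (y, z, t)" by (rule norm_snd_le)
  then have 2: "norm (z, t) \<le> r" using 1 by linarith
  have "norm z \<le> norm (z, t)" "norm t \<le> norm (z, t)" by (rule norm_fst_le, rule norm_snd_le)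
  then show "\<bar>z\<bar> \<le> r" "\<bar>t\<bar> \<le> r" using 2 by auto
qed

lemma norm_pt_le: "norm (x, y, z, t) \<le> \<bar>x\<bar> + \<bar>y\<bar> + \<bar>z\<bar> + \<bar>t :: real\<bar>" for x y z t :: real
  using norm_Pair_le [of x "(y, z, t)"] norm_Pair_le [of y "(z, t)"] norm_Pair_le [of z t] by simp

text \<open>Outside the ball of radius \<rho> both kernels vanish: if the translated argument has
  norm at most \<delta>, undoing the translation leaves three coordinates of \<open>g\<close> below
  \<open>\<delta> + 1\<close> and the central one below \<open>2 * \<delta> + 1 + 2 * R\<close>,
  which add up to \<rho>. \<open>H\<close> bounds the coordinates of \<open>g\<close>, the
  coefficients \<open>e1\<close>, \<open>e2\<close> and the kernel base \<open>m\<close> at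
  once.\<close>

lemma kern_taylor:
  assumes \<delta>: "\<delta> > 0" and R: "R \<ge> 0" and P: "P = (X, Y, Z, T)" and XY: "\<bar>X\<bar> \<le> R" "\<bar>Y\<bar> \<le> R"
    and Q: "Q \<in> ubox" and \<rho>: "\<rho> = 5 * \<delta> + 4 + 2 * R" and H: "H = \<rho> + R + \<delta>\<^sup>2"
  shows "\<bar>kern \<delta> (g \<star> ginv (P \<star> Q \<star> ginv P)) - kern \<delta> g - jeval (kjet \<delta> P g) Q\<bar>
    \<le> 10 ^ 13 * H ^ 8 * rem3 Q * indicator (cball 0 \<rho>) g"
proof -
  obtain x y z t where Qe: "Q = (x, y, z, t)" by (cases Q) auto
  have q1: "\<bar>x\<bar> \<le> 1" "\<bar>y\<bar> \<le> 1" "\<bar>z\<bar> \<le> 1" "\<bar>t\<bar> \<le> 1" using Q by (auto simp: Qe ubox_def)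
  obtain g1 g2 g3 g4 where g: "g = (g1, g2, g3, g4)" by (cases g) auto
  define g' where "g' = g \<star> ginv (P \<star> Q \<star> ginv P)"
  have \<rho>\<delta>: "\<rho> \<ge> \<delta>" "\<rho> \<ge> 1" using \<delta> R \<rho> by auto
  show ?thesis
  proof (cases "norm g \<le> \<rho>")
    case False
    have "kern \<delta> g = 0" "kjet \<delta> P g = 0" using False \<rho>\<delta> \<delta> by (auto intro!: kern_0 kjet_0)
    moreover have "kern \<delta> g' = 0"
    proof (rule kern_0)
      show "\<delta> < norm g'"
      proof (rule ccontr)
        assume "\<not> \<delta> < norm g'"
        then have n: "norm g' \<le> \<delta>" by simp
        obtain a b c d where g': "g' = (a, b, c, d)" by (cases g') auto
        note ab = abs_le_norm_pt [OF n [unfolded g']]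
        have "g = g' \<star> (P \<star> Q \<star> ginv P)" by (simp add: g'_def)
        then have ge: "g = (a + x, b + y, c + (z + (X * y - x * Y)) + (a * y - x * b) / 2, d + t)"
          by (simp add: g' P Qe field_simps)
        note m = abs_mult_le [OF XY(1) q1(2)] abs_mult_le [OF q1(1) XY(2)]
          abs_mult_le [OF ab(1) q1(2)] abs_mult_le [OF q1(1) ab(2)]
        have 1: "\<bar>a + x\<bar> \<le> \<delta> + 1" "\<bar>b + y\<bar> \<le> \<delta> + 1" "\<bar>d + t\<bar> \<le> \<delta> + 1"
          using ab(1) q1(1) ab(2) q1(2) ab(4) q1(4) by (simp_all only: abs_le_iff) linarith+
        have 2: "\<bar>c + (z + (X * y - x * Y)) + (a * y - x * b) / 2\<bar> \<le> \<delta> + 1 + 2 * R + \<delta>"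
          using ab(3) q1(3) m unfolding abs_le_iff by (intro conjI; elim conjE; simp add: field_simps)
        have "norm g \<le> \<bar>a + x\<bar> + \<bar>b + y\<bar> + \<bar>c + (z + (X * y - x * Y)) + (a * y - x * b) / 2\<bar> + \<bar>d + t\<bar>"
          unfolding ge by (rule norm_pt_le)
        also have "\<dots> \<le> (\<delta> + 1) + (\<delta> + 1) + (\<delta> + 1 + 2 * R + \<delta>) + (\<delta> + 1)"
          by (intro add_mono 1 2)
        finally show False using False \<rho> by simp
      qed
    qed (use \<delta> in simp)
    moreover have "jeval 0 Q = 0" by (simp add: Qe zero_prod_def)
    ultimately show ?thesis using False unfolding g'_def [symmetric] by simp
  next
    case True
    note gb = abs_le_norm_pt [OF True [unfolded g]]
    define e1 where "e1 = Y + g2 / 2" define e2 where "e2 = X + g1 / 2"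
    have HR: "H \<ge> 1" "\<rho> \<le> H" "\<delta>\<^sup>2 \<le> H"
      using \<rho>\<delta> R H zero_le_power2 [of \<delta>] by linarith+
    have gH: "\<bar>g1\<bar> \<le> H" "\<bar>g2\<bar> \<le> H" "\<bar>g3\<bar> \<le> H" "\<bar>g4\<bar> \<le> H" using gb HR by auto
    have eH: "\<bar>e1\<bar> \<le> H" "\<bar>e2\<bar> \<le> H" 
      using gb(1,2) XY \<rho>\<delta> H zero_le_power2 [of \<delta>] unfolding e1_def e2_def by linarith+
    define l1 where "l1 = 2 * (g1 - g3 * e1)" define l2 where "l2 = 2 * (g2 + g3 * e2)"
    define a where "a = \<bar>x\<bar> + \<bar>y\<bar>" define b where "b = \<bar>z\<bar> + \<bar>t\<bar>"
    define p where "p = l1 * x + l2 * y"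
    define f where "f = y * e2 - x * e1"
    define q where "q = x\<^sup>2 + y\<^sup>2 + f\<^sup>2"
    \<comment> \<open>\<open>v\<close> is the part linear in \<open>z\<close> and \<open>t\<close>;
      \<open>junk\<close> collects the quadratic terms containing \<open>z\<close> or
      \<open>t\<close>, which the jet does not record and which go into the remainder.\<close>
    define v where "v = 2 * g3 * z + 2 * g4 * t"
    define junk where "junk = 2 * z * f + z\<^sup>2 + t\<^sup>2"
    define s where "s = \<delta>\<^sup>2 - nsq g" define m where "m = max 0 s"
    have "H * 1 \<le> H * H" using HR by (intro mult_left_mono) auto
    then have HH: "H \<le> H\<^sup>2" by (simp add: power2_eq_square)
    have "\<bar>g3 * e1\<bar> \<le> H * H" "\<bar>g3 * e2\<bar> \<le> H * H" using gH eH by (auto intro!: abs_mult_le)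
    then have l: "\<bar>l1\<bar> \<le> 4 * H\<^sup>2" "\<bar>l2\<bar> \<le> 4 * H\<^sup>2"
      using gH HH unfolding l1_def l2_def power2_eq_square by (auto simp: abs_le_iff)
    have ab0: "0 \<le> a" "a \<le> 2" "0 \<le> b" "b \<le> 2" using q1 by (auto simp: a_def b_def)
    have p: "\<bar>p\<bar> \<le> 4 * H\<^sup>2 * a"
      using abs_mult_le [OF l(1) order_refl, of x] abs_mult_le [OF l(2) order_refl, of y]
      unfolding p_def a_def distrib_left by linarith
    have f: "\<bar>f\<bar> \<le> H * a"
    proof -
      have "\<bar>y * e2\<bar> \<le> \<bar>y\<bar> * H" "\<bar>x * e1\<bar> \<le> \<bar>x\<bar> * H" using eH by (auto intro!: abs_mult_le)
      then show ?thesis unfolding f_def a_def by (simp add: algebra_simps abs_le_iff)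
    qed
    have xy: "x\<^sup>2 + y\<^sup>2 \<le> a\<^sup>2" unfolding a_def by (simp add: power2_sum)
    have zt: "z\<^sup>2 + t\<^sup>2 \<le> b\<^sup>2" unfolding b_def by (simp add: power2_sum)
    have f2: "f\<^sup>2 \<le> H\<^sup>2 * a\<^sup>2" using power_mono [OF f abs_ge_zero, of 2] by (simp add: power_mult_distrib)
    have H2: "1 \<le> H\<^sup>2" using HR HH by linarith
    have q: "\<bar>q\<bar> \<le> 2 * H\<^sup>2 * a\<^sup>2"
      using xy f2 mult_right_mono [OF H2 zero_le_power2 [of a]] unfolding q_def by simp
    have v: "\<bar>v\<bar> \<le> 4 * H * b"
    proof -
      have "\<bar>g3 * z\<bar> \<le> H * \<bar>z\<bar>" "\<bar>g4 * t\<bar> \<le> H * \<bar>t\<bar>" using gH by (auto intro!: abs_mult_le)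
      moreover have "0 \<le> H * \<bar>z\<bar>" "0 \<le> H * \<bar>t\<bar>" using HR by auto
      ultimately show ?thesis unfolding v_def b_def distrib_left mult.assoc by linarith
    qed
    have junk: "\<bar>junk\<bar> \<le> 8 * H * (b * (a + b))"
    proof -
      have "\<bar>z * f\<bar> \<le> b * (H * a)" using f by (intro abs_mult_le) (auto simp: b_def)
      moreover have "b\<^sup>2 \<le> H * (b * b)" using mult_right_mono [OF HR(1), of "b * b"] by (simp add: power2_eq_square)
      moreover have "0 \<le> b * (H * a)" "0 \<le> H * (b * b)" using ab0 HR by auto
      moreover have "8 * H * (b * (a + b)) = 8 * (b * (H * a)) + 8 * (H * (b * b))" by (simp add: algebra_simps)
      ultimately show ?thesis using zt zero_le_power2 [of z] zero_le_power2 [of t] unfolding junk_def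
        by (simp only: mult.assoc)
    qed
    have m: "0 \<le> m" "m \<le> H"
      using HR by (auto simp: m_def s_def nsq_norm intro: order_trans [OF _ HR(3)])
    have g'e: "g' = (g1 - x, g2 - y, g3 - (z + f), g4 - t)"
      by (simp add: g'_def g P Qe f_def e1_def e2_def field_simps)
    define d where "d = p + v - q - junk"
    have "\<delta>\<^sup>2 - nsq g' = s + d"
      unfolding g'e s_def d_def p_def v_def q_def junk_def l1_def l2_def g f_def
      by (simp add: power2_eq_square algebra_simps)
    then have k': "kern \<delta> g' = (max 0 (s + d)) ^ 4" by (simp add: kern_def)
    have k: "kern \<delta> g = (max 0 s) ^ 4" by (simp add: kern_def s_def)
    have "kjet \<delta> P g = (8 * m ^ 3 * g4, (4 * m ^ 3 * l1, 4 * m ^ 3 * l2), 8 * m ^ 3 * g3,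
        (- 8 * m ^ 3 * (1 + e1\<^sup>2) + 12 * m\<^sup>2 * l1\<^sup>2, 8 * m ^ 3 * e1 * e2 + 12 * m\<^sup>2 * l1 * l2,
         - 8 * m ^ 3 * (1 + e2\<^sup>2) + 12 * m\<^sup>2 * l2\<^sup>2))"
      unfolding kjet_def P g m_def s_def l1_def l2_def e1_def e2_def Let_def prod.case ..
    then have j: "jeval (kjet \<delta> P g) Q = 4 * m ^ 3 * (p + v - q) + 6 * m\<^sup>2 * p\<^sup>2"
      by (simp add: Qe p_def v_def q_def f_def) (simp add: power2_eq_square field_simps)
    have "\<bar>(max 0 (s + d)) ^ 4 - (max 0 s) ^ 4 - 4 * (max 0 s) ^ 3 * (p + v - q) - 6 * (max 0 s)\<^sup>2 * p\<^sup>2\<bar>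
       \<le> 10 ^ 13 * H ^ 8 * (a ^ 3 + b * (a + b))"
      by (rule kern_remainder_bound [OF HR(1) m ab0 p q v junk d_def m_def])
    moreover have "rem3 Q = a ^ 3 + b * (a + b)" by (simp add: rem3_def Qe a_def b_def)
    ultimately show ?thesis using True unfolding g'_def [symmetric] k' k j m_def by (simp add: algebra_simps)
  qed
qed

lemma norm_lebesgue_integral_le:
  fixes f :: "'a \<Rightarrow> 'b::{banach, second_countable_topology}"
  assumes "integrable M f" "integrable M g" "\<And>x. norm (f x) \<le> g x"
  shows "norm (\<integral>x. f x \<partial>M) \<le> (\<integral>x. g x \<partial>M)"
  by (rule order.trans [OF Bochner_Integration.integral_norm_bound Bochner_Integration.integral_mono])
    (use assms in auto)

text \<open>Writing \<open>P \<star> Q = Q' \<star> P\<close> with the conjugate \<open>Q'\<close>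
  of \<open>Q\<close>, right invariance of the measure puts the increment on the kernel, so
  \<open>F\<close> enters only through its bound. The constant is therefore common to all
  \<open>F\<close> bounded by \<open>M\<close> and to all points with horizontal coordinates bounded
  by \<open>R\<close>; \<open>Z\<close> and \<open>T\<close> are free because conjugation does not
  see them.\<close>

lemma mollify_taylor2:
  assumes \<delta>: "\<delta> > 0" and R: "R \<ge> 0" and M: "M \<ge> 0"
  obtains K where "K \<ge> 0" "\<And>F X Y Z T. continuous_on UNIV F \<Longrightarrow> (\<And>P. \<bar>F P\<bar> \<le> M) \<Longrightarrow> \<bar>X\<bar> \<le> R \<Longrightarrow> \<bar>Y\<bar> \<le> R
    \<Longrightarrow> \<exists>J. norm J \<le> K \<and> taylor2 (mollify \<delta> F) (X, Y, Z, T) J K"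
proof -
  define \<rho> where "\<rho> = 5 * \<delta> + 4 + 2 * R"
  define H where "H = \<rho> + R + \<delta>\<^sup>2"
  have H0: "H \<ge> 0" using \<delta> R by (simp add: H_def \<rho>_def)
  define k0 where "k0 = (\<integral>g. kern \<delta> g \<partial>lborel)"
  have k0: "k0 > 0" unfolding k0_def by (rule integral_kern_pos [OF \<delta>])
  define V where "V = measure lborel (cball (0::pt) \<rho>)"
  have V: "V \<ge> 0" by (simp add: V_def)
  have "compact ({-R..R} \<times> {-R..R} \<times> cball (0::pt) \<delta>)" by (intro compact_Times) auto
  moreover have "continuous_on ({-R..R} \<times> {-R..R} \<times> cball (0::pt) \<delta>) (\<lambda>(X, Y, g). kjet \<delta> (X, Y, 0, 0) g)"
    unfolding kjet_def case_prod_unfold Let_def by (intro continuous_intros) auto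
  ultimately have "bounded ((\<lambda>(X, Y, g). kjet \<delta> (X, Y, 0, 0) g) ` ({-R..R} \<times> {-R..R} \<times> cball (0::pt) \<delta>))"
    by (intro compact_imp_bounded compact_continuous_image)
  then obtain B where B: "B > 0" "\<And>X Y g. \<bar>X\<bar> \<le> R \<Longrightarrow> \<bar>Y\<bar> \<le> R \<Longrightarrow> norm g \<le> \<delta> \<Longrightarrow> norm (kjet \<delta> (X, Y, 0, 0) g) \<le> B"
    unfolding bounded_pos by (fastforce simp: abs_le_iff)
  define K where "K = (10 ^ 13 * H ^ 8 * M * V + B * M * V) / k0"
  have K: "K \<ge> 0" using H0 M V B k0 by (simp add: K_def)
  show thesis
  proof (rule that [OF K])
    fix F :: "pt \<Rightarrow> real" and X Y Z T :: real
    assume F: "continuous_on UNIV F" "\<And>P. \<bar>F P\<bar> \<le> M" and XY: "\<bar>X\<bar> \<le> R" "\<bar>Y\<bar> \<le> R"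
    define P where "P = (X, Y, Z, T)"
    have FP: "continuous_on UNIV (\<lambda>g. F (g \<star> P))"
      by (rule continuous_on_compose2 [OF F(1)]) (auto intro!: continuous_intros)
    have ind: "integrable lborel (\<lambda>g. c * indicator (cball (0::pt) \<rho>) g :: real)"
      "(\<integral>g. c * indicator (cball (0::pt) \<rho>) g \<partial>lborel) = c * V" for c
      using emeasure_compact_finite [of "cball (0::pt) \<rho>"] by (simp_all add: V_def)
    define jf where "jf g = F (g \<star> P) *\<^sub>R kjet \<delta> P g" for g
    have kPe: "kjet \<delta> P g = kjet \<delta> (X, Y, 0, 0) g" for g by (simp add: P_def kjet_def)
    have ji: "integrable lborel jf"
    proof (rule integrable_continuous_compact_support)
      show "continuous_on UNIV jf" unfolding jf_def by (intro continuous_intros FP continuous_on_kjet)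
      show "jf g = 0" if "g \<notin> cball 0 \<delta>" for g using that \<delta> kjet_0 [of \<delta> g P] by (simp add: jf_def)
    qed auto
    define J where "J = (1 / k0) *\<^sub>R (\<integral>g. jf g \<partial>lborel)"
    have "norm (jf g) \<le> (B * M) * indicator (cball 0 \<rho>) g" for g
    proof (cases "norm g \<le> \<delta>")
      case True
      then have "norm g \<le> \<rho>" using \<delta> R by (simp add: \<rho>_def)
      moreover have "norm (jf g) \<le> M * B" unfolding jf_def kPe norm_scaleR using F(2) B True XY M by (intro mult_mono) auto
      ultimately show ?thesis by (simp add: mult.commute)
    next
      case False
      then show ?thesis using \<delta> B M kjet_0 [of \<delta> g P] by (simp add: jf_def)
    qed
    then have "norm (\<integral>g. jf g \<partial>lborel) \<le> (\<integral>g. (B * M) * indicator (cball (0::pt) \<rho>) g \<partial>lborel)"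
      using norm_lebesgue_integral_le [OF ji ind(1) [of "B * M"]] by blast
    then have nJ: "norm (\<integral>g. jf g \<partial>lborel) \<le> B * M * V" by (simp only: ind)
    have "norm J \<le> K"
    proof -
      have "norm J = norm (\<integral>g. jf g \<partial>lborel) / k0" using k0 by (simp add: J_def divide_inverse mult.commute)
      also have "\<dots> \<le> K" unfolding K_def using nJ H0 M V k0 by (intro divide_right_mono) (auto intro: add_increasing)
      finally show ?thesis .
    qed
    moreover have "taylor2 (mollify \<delta> F) P J K"
      unfolding taylor2_def
    proof
      fix Q assume Q: "Q \<in> ubox"
      define Q' where "Q' = P \<star> Q \<star> ginv P"
      have PQ: "P \<star> Q = Q' \<star> P" by (simp add: Q'_def)
      have cm: "continuous_on UNIV (\<lambda>g. kern \<delta> (g \<star> ginv Q') * F (g \<star> P))"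
        by (intro continuous_intros FP)
      have i0: "integrable lborel (\<lambda>g. kern \<delta> g * F (g \<star> P))" by (rule integrable_kern_mult [OF \<delta> F(1)])
      have ik: "integrable lborel (\<lambda>g. kern \<delta> (g \<star> ginv Q') * F (g \<star> P))"
      proof (rule integrable_continuous_compact_support [OF cm])
        show "compact ((\<lambda>g. g \<star> Q') ` cball 0 \<delta>)"
          by (intro compact_continuous_image continuous_intros) auto
        show "kern \<delta> (g \<star> ginv Q') * F (g \<star> P) = 0" if "g \<notin> (\<lambda>g. g \<star> Q') ` cball 0 \<delta>" for g
        proof -
          have "g \<star> ginv Q' \<notin> cball 0 \<delta>" using that by (metis gmul_ginv_cancel(4) imageI)
          then show ?thesis using \<delta> kern_0 [of \<delta> "g \<star> ginv Q'"] by simp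
        qed
      qed
      have "(\<integral>g. kern \<delta> g * F (g \<star> (P \<star> Q)) \<partial>lborel) = (\<integral>g. (\<lambda>g. kern \<delta> (g \<star> ginv Q') * F (g \<star> P)) (g \<star> Q') \<partial>lborel)"
        by (simp add: gmul_assoc PQ)
      also have "\<dots> = (\<integral>g. kern \<delta> (g \<star> ginv Q') * F (g \<star> P) \<partial>lborel)"
        by (rule integral_gmul) (rule borel_measurable_continuous_onI [OF cm])
      finally have I1: "(\<integral>g. kern \<delta> g * F (g \<star> (P \<star> Q)) \<partial>lborel) = (\<integral>g. kern \<delta> (g \<star> ginv Q') * F (g \<star> P) \<partial>lborel)" .
      have ij: "integrable lborel (\<lambda>g. jeval (jf g) Q)"
        by (rule integrable_bounded_linear [OF bounded_linear_jeval ji])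
      have I2: "jeval (\<integral>g. jf g \<partial>lborel) Q = (\<integral>g. jeval (jf g) Q \<partial>lborel)"
        by (rule integral_bounded_linear [OF bounded_linear_jeval ji, symmetric])
      have bd: "norm ((kern \<delta> (g \<star> ginv Q') * F (g \<star> P) - kern \<delta> g * F (g \<star> P)) - jeval (jf g) Q)
          \<le> (10 ^ 13 * H ^ 8 * rem3 Q * M) * indicator (cball 0 \<rho>) g" for g
      proof -
        have 1: "(kern \<delta> (g \<star> ginv Q') * F (g \<star> P) - kern \<delta> g * F (g \<star> P)) - jeval (jf g) Q
          = (kern \<delta> (g \<star> ginv Q') - kern \<delta> g - jeval (kjet \<delta> P g) Q) * F (g \<star> P)"
          by (simp add: jf_def jeval_scaleR algebra_simps)
        have 2: "\<bar>kern \<delta> (g \<star> ginv Q') - kern \<delta> g - jeval (kjet \<delta> P g) Q\<bar> \<le> 10 ^ 13 * H ^ 8 * rem3 Q * indicator (cball 0 \<rho>) g"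
          unfolding Q'_def by (rule kern_taylor [OF \<delta> R P_def XY Q \<rho>_def H_def])
        show ?thesis using abs_mult_le [OF 2 F(2) [of "g \<star> P"]]
          unfolding 1 real_norm_def by (simp only: mult_ac)
      qed
      have "norm ((\<integral>g. (kern \<delta> (g \<star> ginv Q') * F (g \<star> P) - kern \<delta> g * F (g \<star> P)) - jeval (jf g) Q \<partial>lborel))
        \<le> (\<integral>g. (10 ^ 13 * H ^ 8 * rem3 Q * M) * indicator (cball (0::pt) \<rho>) g \<partial>lborel)"
        by (rule norm_lebesgue_integral_le) (use ik i0 ij ind bd in \<open>auto intro!: Bochner_Integration.integrable_diff\<close>)
      then have b: "\<bar>(\<integral>g. kern \<delta> (g \<star> ginv Q') * F (g \<star> P) \<partial>lborel) - (\<integral>g. kern \<delta> g * F (g \<star> P) \<partial>lborel)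
          - jeval (\<integral>g. jf g \<partial>lborel) Q\<bar> \<le> 10 ^ 13 * H ^ 8 * rem3 Q * M * V"
        unfolding ind I2 by (simp add: ik i0 ij)
      have "mollify \<delta> F (P \<star> Q) - mollify \<delta> F P - jeval J Q
          = ((\<integral>g. kern \<delta> (g \<star> ginv Q') * F (g \<star> P) \<partial>lborel) - (\<integral>g. kern \<delta> g * F (g \<star> P) \<partial>lborel)
          - jeval (\<integral>g. jf g \<partial>lborel) Q) / k0"
        unfolding mollify_def I1 J_def jeval_scaleR k0_def [symmetric] by (simp add: diff_divide_distrib)
      then have "\<bar>mollify \<delta> F (P \<star> Q) - mollify \<delta> F P - jeval J Q\<bar> \<le> 10 ^ 13 * H ^ 8 * rem3 Q * M * V / k0"
        using b k0 by (simp add: divide_right_mono)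
      also have "\<dots> = (10 ^ 13 * H ^ 8 * M * V) / k0 * rem3 Q" by simp
      also have "\<dots> \<le> K * rem3 Q" unfolding K_def using B M V k0 by (intro mult_right_mono divide_right_mono) auto
      finally show "\<bar>mollify \<delta> F (P \<star> Q) - mollify \<delta> F P - jeval J Q\<bar> \<le> K * rem3 Q" .
    qed
    ultimately show "\<exists>J. norm J \<le> K \<and> taylor2 (mollify \<delta> F) (X, Y, Z, T) J K" unfolding P_def by blast
  qed
qed

section \<open>Linear left-invariant operators\<close>

lemma eventually_ubox: "\<forall>\<^sub>F Q in nhds 0. Q \<in> ubox"
  using eventually_le_1_of_tendsto_0 [OF tendsto_coords(1) zero_less_one]
    eventually_le_1_of_tendsto_0 [OF tendsto_coords(2) zero_less_one]
    eventually_le_1_of_tendsto_0 [OF tendsto_coords(3) zero_less_one]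
    eventually_le_1_of_tendsto_0 [OF tendsto_coords(4) zero_less_one]
  by eventually_elim (auto simp: ubox_def)

lemma negl_rem3: "negl rem3"
proof -
  define a b :: "pt \<Rightarrow> real" where "a = (\<lambda>(x, y, z, t). \<bar>x\<bar> + \<bar>y\<bar>)" and "b = (\<lambda>(x, y, z, t). \<bar>z\<bar> + \<bar>t\<bar>)"
  have sq: "(\<bar>x\<bar> + \<bar>y\<bar>)\<^sup>2 \<le> 2 * (x\<^sup>2 + y\<^sup>2)" for x y :: real
    using zero_le_power2 [of "\<bar>x\<bar> - \<bar>y\<bar>"] by (simp add: power2_sum power2_diff)
  have a2: "(a Q)\<^sup>2 \<le> 2 * sqh Q" and b2: "(b Q)\<^sup>2 \<le> 2 * sqv Q" for Q
  proof -
    obtain x y z t where Q: "Q = (x, y, z, t)" by (cases Q) auto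
    show "(a Q)\<^sup>2 \<le> 2 * sqh Q" "(b Q)\<^sup>2 \<le> 2 * sqv Q"
      unfolding Q a_def b_def sqh_simp sqv_simp prod.case by (rule sq)+
  qed
  have o: "order1 a" unfolding order1_def
  proof (intro exI [of _ 2] conjI always_eventually allI)
    fix Q show "(a Q)\<^sup>2 \<le> 2 * (sqh Q + sqv Q)" using a2 [of Q] sqv_nonneg [of Q] by argo
  qed simp
  have "negl (\<lambda>Q. (case Q of (x, y, z, t) \<Rightarrow> (2 * x\<^sup>2 + 2 * 0 * x * y + 2 * y\<^sup>2) / 2)\<^sup>2)"
    by (rule negl_sq_quadratic)
  also have "(\<lambda>Q. (case Q of (x, y, z, t) \<Rightarrow> (2 * x\<^sup>2 + 2 * 0 * x * y + 2 * y\<^sup>2) / 2)\<^sup>2) = (\<lambda>Q::pt. (sqh Q)\<^sup>2)"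
    by (auto simp: fun_eq_iff add_divide_distrib)
  finally have "negl (\<lambda>Q. 4 * (sqh Q)\<^sup>2)" by (rule negl_cmul)
  then have 1: "negl (\<lambda>Q. ((a Q)\<^sup>2)\<^sup>2)"
  proof (rule negl_mono, intro always_eventually allI)
    fix Q have "((a Q)\<^sup>2)\<^sup>2 \<le> (2 * sqh Q)\<^sup>2" by (rule power_mono [OF a2]) simp
    then show "\<bar>((a Q)\<^sup>2)\<^sup>2\<bar> \<le> \<bar>4 * (sqh Q)\<^sup>2\<bar>" by (simp add: power_mult_distrib)
  qed
  have "negl (\<lambda>Q. 2 * sqv Q)" unfolding negl_def
    by (auto intro!: exI [of _ 2] always_eventually add_increasing)
  then have 2: "negl (\<lambda>Q. (b Q)\<^sup>2)"
  proof (rule negl_mono, intro always_eventually allI)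
    fix Q show "\<bar>(b Q)\<^sup>2\<bar> \<le> \<bar>2 * sqv Q\<bar>" using b2 [of Q] by simp
  qed
  have "negl (\<lambda>Q. a Q * (a Q)\<^sup>2 + (a Q * b Q + (b Q)\<^sup>2))"
    by (intro negl_add order1_mult_negl o 1 2)
  also have "(\<lambda>Q. a Q * (a Q)\<^sup>2 + (a Q * b Q + (b Q)\<^sup>2)) = rem3"
    by (auto simp: fun_eq_iff rem3_def a_def b_def power2_eq_square power3_eq_cube algebra_simps)
  finally show ?thesis .
qed

lemma taylor2_jet_at:
  assumes "taylor2 F P J K" shows "jet_at F P J"
  unfolding jet_at_negl
proof (rule negl_mono [OF negl_cmul [OF negl_rem3, of K]])
  show "\<forall>\<^sub>F Q in nhds 0. \<bar>F (P \<star> Q) - F P - jeval J Q\<bar> \<le> \<bar>K * rem3 Q\<bar>"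
    using eventually_ubox
  proof eventually_elim
    case (elim Q)
    then have "\<bar>F (P \<star> Q) - F P - jeval J Q\<bar> \<le> K * rem3 Q" using assms by (auto simp: taylor2_def)
    then show ?case by linarith
  qed
qed

lemma tendsto_jeval: "(jeval J \<longlongrightarrow> 0) (nhds 0)"
proof -
  obtain \<alpha> b1 b2 c m11 m12 m22 where J: "J = (\<alpha>, (b1, b2), c, (m11, m12, m22))" by (cases J) auto
  have "((\<lambda>Q. \<alpha> * (\<lambda>(x, y, z, t). t) Q + b1 * (\<lambda>(x, y, z, t). x) Q + b2 * (\<lambda>(x, y, z, t). y) Q + c * (\<lambda>(x, y, z, t). z) Q
     + (m11 * ((\<lambda>(x, y, z, t). x) Q)\<^sup>2 + 2 * m12 * (\<lambda>(x, y, z, t). x) Q * (\<lambda>(x, y, z, t). y) Q + m22 * ((\<lambda>(x, y, z, t). y) Q)\<^sup>2) / 2)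
     \<longlongrightarrow> \<alpha> * 0 + b1 * 0 + b2 * 0 + c * 0 + (m11 * 0\<^sup>2 + 2 * m12 * 0 * 0 + m22 * 0\<^sup>2) / 2) (nhds (0::pt))"
    by (intro tendsto_intros tendsto_coords) auto
  moreover have "(\<lambda>Q. \<alpha> * (\<lambda>(x, y, z, t). t) Q + b1 * (\<lambda>(x, y, z, t). x) Q + b2 * (\<lambda>(x, y, z, t). y) Q + c * (\<lambda>(x, y, z, t). z) Q
     + (m11 * ((\<lambda>(x, y, z, t). x) Q)\<^sup>2 + 2 * m12 * (\<lambda>(x, y, z, t). x) Q * (\<lambda>(x, y, z, t). y) Q + m22 * ((\<lambda>(x, y, z, t). y) Q)\<^sup>2) / 2)
     = jeval J"
    by (auto simp: J fun_eq_iff)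
  ultimately show ?thesis by simp
qed

lemma jet_at_isCont:
  assumes "jet_at F P J" shows "isCont F P"
proof -
  obtain K where K: "K \<ge> 0" "\<forall>\<^sub>F Q in nhds 0. \<bar>F (P \<star> Q) - F P - jeval J Q\<bar> \<le> 1 * sqh Q + K * sqv Q"
    using assms unfolding jet_at_def by (meson zero_less_one)
  have "((\<lambda>Q. F (P \<star> Q) - F P - jeval J Q) \<longlongrightarrow> 0) (nhds 0)"
    by (rule Lim_null_comparison [OF _ tendsto_sqh_sqv [of 1 K]]) (use K(2) in simp)
  from tendsto_add [OF tendsto_add [OF this tendsto_jeval [of J]] tendsto_const [of "F P"]]
  have 1: "((\<lambda>Q. F (P \<star> Q)) \<longlongrightarrow> F P) (nhds 0)" by simp
  have "isCont (\<lambda>P'. ginv P \<star> P') P"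
    by (rule continuous_on_interior [of UNIV]) (auto intro!: continuous_intros)
  then have "((\<lambda>P'. ginv P \<star> P') \<longlongrightarrow> 0) (nhds P)"
    by (metis gmul_ginv(2) isCont_def tendsto_at_iff_tendsto_nhds)
  from filterlim_compose [OF 1 this] have "(F \<longlongrightarrow> F P) (nhds P)" by simp
  then show ?thesis by (metis isCont_def tendsto_at_iff_tendsto_nhds)
qed

lemma norm_jet_components:
  assumes "norm (\<alpha>, (b1, b2), c, (m11, m12, m22)) \<le> (K::real)"
  shows "\<bar>\<alpha>\<bar> \<le> K" "\<bar>b1\<bar> \<le> K" "\<bar>b2\<bar> \<le> K" "\<bar>c\<bar> \<le> K" "\<bar>m11\<bar> \<le> K" "\<bar>m12\<bar> \<le> K" "\<bar>m22\<bar> \<le> (K::real)"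
proof -
  have *: "norm a \<le> K \<and> norm b \<le> K" if "norm (a, b) \<le> K" for a :: "'a::real_normed_vector" and b :: "'b::real_normed_vector"
    using that norm_fst_le [of a b] norm_snd_le [of b a] by linarith
  have 1: "norm \<alpha> \<le> K" "norm ((b1, b2), c, (m11, m12, m22)) \<le> K" using * [OF assms] by auto
  have 2: "norm (b1, b2) \<le> K" "norm (c, (m11, m12, m22)) \<le> K" using * [OF 1(2)] by auto
  have 3: "norm b1 \<le> K" "norm b2 \<le> K" using * [OF 2(1)] by auto
  have 4: "norm c \<le> K" "norm (m11, m12, m22) \<le> K" using * [OF 2(2)] by auto
  have 5: "norm m11 \<le> K" "norm (m12, m22) \<le> K" using * [OF 4(2)] by auto
  have 6: "norm m12 \<le> K" "norm m22 \<le> K" using * [OF 5(2)] by auto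
  show "\<bar>\<alpha>\<bar> \<le> K" "\<bar>b1\<bar> \<le> K" "\<bar>b2\<bar> \<le> K" "\<bar>c\<bar> \<le> K" "\<bar>m11\<bar> \<le> K" "\<bar>m12\<bar> \<le> K" "\<bar>m22\<bar> \<le> K"
    using 1 3 4 5 6 by (simp_all only: real_norm_def)
qed

section \<open>The local barrier\<close>

definition barrier :: "pt \<Rightarrow> real" where
  "barrier = (\<lambda>(x, y, z, t). x ^ 4 + y ^ 4 + z\<^sup>2 + t\<^sup>2)"

definition barrier_jet :: "pt \<Rightarrow> jet" where
  "barrier_jet = (\<lambda>(X, Y, Z, T). (2 * T, (4 * X ^ 3 - Y * Z, 4 * Y ^ 3 + X * Z), 2 * Z,
     (12 * X\<^sup>2 + Y\<^sup>2 / 2, - X * Y / 2, 12 * Y\<^sup>2 + X\<^sup>2 / 2)))"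

lemma jet_at_pow4:
  assumes "jet_at F P J" shows "jet_at (\<lambda>Q. F Q ^ 4) P (jcomp (4 * F P ^ 3) (12 * (F P)\<^sup>2) J)"
proof (rule jet_at_comp [OF assms, where f = "\<lambda>s. s ^ 4" and f' = "\<lambda>s. 4 * s ^ 3"])
  show "\<forall>\<^sub>F s in nhds (F P). ((\<lambda>s. s ^ 4) has_real_derivative 4 * s ^ 3) (at s)"
    by (intro always_eventually allI) (auto intro!: derivative_eq_intros)
  show "((\<lambda>s. 4 * s ^ 3) has_real_derivative 12 * (F P)\<^sup>2) (at (F P))"
    by (auto intro!: derivative_eq_intros)
qed

lemma jet_at_square:
  assumes "jet_at F P J" shows "jet_at (\<lambda>Q. (F Q)\<^sup>2) P (jcomp (2 * F P) 2 J)"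
proof (rule jet_at_comp [OF assms, where f = "\<lambda>s. s\<^sup>2" and f' = "\<lambda>s. 2 * s"])
  show "\<forall>\<^sub>F s in nhds (F P). ((\<lambda>s. s\<^sup>2) has_real_derivative 2 * s) (at s)"
    by (intro always_eventually allI) (auto intro!: derivative_eq_intros)
  show "((\<lambda>s. 2 * s) has_real_derivative 2) (at (F P))"
    by (auto intro!: derivative_eq_intros)
qed

lemma jet_at_barrier: "jet_at barrier S (barrier_jet S)"
proof -
  obtain X Y Z T where S: "S = (X, Y, Z, T)" by (cases S) auto
  define cx cy cz ct :: "pt \<Rightarrow> real"
    where "cx = (\<lambda>(x, y, z, t). x)" and "cy = (\<lambda>(x, y, z, t). y)"
      and "cz = (\<lambda>(x, y, z, t). z)" and "ct = (\<lambda>(x, y, z, t). t)"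
  note c = jet_at_coords [of X Y Z T, folded cx_def cy_def cz_def ct_def]
  have v: "cx S = X" "cy S = Y" "cz S = Z" "ct S = T" by (auto simp: S cx_def cy_def cz_def ct_def)
  note c = c [folded S]
  have "jet_at (\<lambda>Q. cx Q ^ 4 + cy Q ^ 4 + (cz Q)\<^sup>2 + (ct Q)\<^sup>2) S
     (jcomp (4 * X ^ 3) (12 * X\<^sup>2) (0, (1, 0), 0, (0, 0, 0)) + jcomp (4 * Y ^ 3) (12 * Y\<^sup>2) (0, (0, 1), 0, (0, 0, 0))
      + jcomp (2 * Z) 2 (0, (- Y / 2, X / 2), 1, (0, 0, 0)) + jcomp (2 * T) 2 (1, (0, 0), 0, (0, 0, 0)))"
    by (intro jet_at_add jet_at_pow4 [OF c(1), unfolded v] jet_at_pow4 [OF c(2), unfolded v]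
        jet_at_square [OF c(3), unfolded v] jet_at_square [OF c(4), unfolded v])
  moreover have "(\<lambda>Q. cx Q ^ 4 + cy Q ^ 4 + (cz Q)\<^sup>2 + (ct Q)\<^sup>2) = barrier"
    by (auto simp: fun_eq_iff barrier_def cx_def cy_def cz_def ct_def)
  moreover have "jcomp (4 * X ^ 3) (12 * X\<^sup>2) (0, (1, 0), 0, (0, 0, 0)) + jcomp (4 * Y ^ 3) (12 * Y\<^sup>2) (0, (0, 1), 0, (0, 0, 0))
      + jcomp (2 * Z) 2 (0, (- Y / 2, X / 2), 1, (0, 0, 0)) + jcomp (2 * T) 2 (1, (0, 0), 0, (0, 0, 0)) = barrier_jet S"
    by (simp add: S barrier_jet_def power2_eq_square)
  ultimately show ?thesis by simp
qed

section \<open>Generators of random walks on the group and their resolvents\<close>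

locale left_invariant_operator =
  fixes a1 a2 p1 p2 q1 q2 :: real
begin

text \<open>The sign is such that supersolutions satisfy \<open>Lop J \<le> c\<close>. The diffusion
  matrix is given as the sum of the rank-one matrices of \<open>p\<close> and \<open>q\<close>, so
  that each vector is a direction in which the walk can step.\<close>

definition Lop :: "jet \<Rightarrow> real" where
  "Lop J = (case J of (\<alpha>, (b1, b2), c, (m11, m12, m22)) \<Rightarrow>
     - \<alpha> - (a1 * b1 + a2 * b2) + ((p1\<^sup>2 + q1\<^sup>2) * m11 + 2 * (p1 * p2 + q1 * q2) * m12 + (p2\<^sup>2 + q2\<^sup>2) * m22))"

lemma Lop_simp [simp]: "Lop (\<alpha>, (b1, b2), c, (m11, m12, m22)) =
     - \<alpha> - (a1 * b1 + a2 * b2) + ((p1\<^sup>2 + q1\<^sup>2) * m11 + 2 * (p1 * p2 + q1 * q2) * m12 + (p2\<^sup>2 + q2\<^sup>2) * m22)"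
  by (simp add: Lop_def)

lemma Lop_add: "Lop (J + J') = Lop J + Lop J'"
  by (cases J; cases J') (simp add: Lop_def case_prod_unfold algebra_simps)

lemma Lop_scaleR: "Lop (r *\<^sub>R J) = r * Lop J"
  by (cases J) (simp add: Lop_def case_prod_unfold algebra_simps)

text \<open>One step of the walk: backwards in time by \<open>s\<^sup>2\<close>, with drift
  \<open>- s\<^sup>2 * a\<close> and a jump along plus or minus \<open>p\<close> or
  \<open>q\<close>, each with probability 1/4. The factor 2 in the jumps compensates for this
  probability and for the 1/2 in the quadratic part of a jet, so that the second moments give the
  matrix of \<open>Lop\<close> exactly.\<close>

definition avg :: "real \<Rightarrow> (pt \<Rightarrow> real) \<Rightarrow> pt \<Rightarrow> real" where
  "avg s F P = (F (P \<star> (- s\<^sup>2 * a1 + 2 * s * p1, - s\<^sup>2 * a2 + 2 * s * p2, 0, - s\<^sup>2))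
     + F (P \<star> (- s\<^sup>2 * a1 - 2 * s * p1, - s\<^sup>2 * a2 - 2 * s * p2, 0, - s\<^sup>2))
     + F (P \<star> (- s\<^sup>2 * a1 + 2 * s * q1, - s\<^sup>2 * a2 + 2 * s * q2, 0, - s\<^sup>2))
     + F (P \<star> (- s\<^sup>2 * a1 - 2 * s * q1, - s\<^sup>2 * a2 - 2 * s * q2, 0, - s\<^sup>2))) / 4"

definition coeff_bound :: real where
  "coeff_bound = 1 + \<bar>a1\<bar> + \<bar>a2\<bar> + 2 * (\<bar>p1\<bar> + \<bar>p2\<bar> + \<bar>q1\<bar> + \<bar>q2\<bar>)"

lemma coeff_bound_ge_1: "coeff_bound \<ge> 1"
  by (simp add: coeff_bound_def)

lemma step_size:
  assumes s: "0 < s" "s * coeff_bound \<le> 1" and xy: "\<bar>x\<bar> \<le> s * coeff_bound" "\<bar>y\<bar> \<le> s * coeff_bound"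
  shows "(x, y, 0, - s\<^sup>2) \<in> ubox" "rem3 (x, y, 0, - s\<^sup>2) \<le> 11 * coeff_bound ^ 3 * s ^ 3"
proof -
  let ?B = coeff_bound
  have "s * 1 \<le> s * ?B" using s coeff_bound_ge_1 by (intro mult_left_mono) auto
  then have s1: "s \<le> 1" using s by linarith
  then have s2: "s\<^sup>2 \<le> s" using s by (simp add: power2_eq_square mult_left_le)
  show "(x, y, 0, - s\<^sup>2) \<in> ubox" using xy s s1 s2 by (auto simp: ubox_def)
  have "(\<bar>x\<bar> + \<bar>y\<bar>) ^ 3 \<le> (2 * (s * ?B)) ^ 3" using xy by (intro power_mono) auto
  also have "\<dots> = 8 * ?B ^ 3 * s ^ 3" by (simp add: power_mult_distrib)
  finally have 1: "(\<bar>x\<bar> + \<bar>y\<bar>) ^ 3 \<le> 8 * ?B ^ 3 * s ^ 3" .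
  have "s\<^sup>2 * (\<bar>x\<bar> + \<bar>y\<bar> + s\<^sup>2) \<le> s\<^sup>2 * (2 * (s * ?B) + s * ?B)"
    using xy s2 \<open>s * 1 \<le> s * ?B\<close> by (intro mult_left_mono) auto
  also have "\<dots> = 3 * ?B * s ^ 3" by (simp add: power2_eq_square power3_eq_cube)
  also have "\<dots> \<le> 3 * ?B ^ 3 * s ^ 3"
    using self_le_power [OF coeff_bound_ge_1, of 3] s by (intro mult_right_mono mult_left_mono) auto
  finally show "rem3 (x, y, 0, - s\<^sup>2) \<le> 11 * ?B ^ 3 * s ^ 3"
    using 1 by (simp add: rem3_def)
qed

text \<open>First-order jump terms cancel in pairs, and so do the products of jump and drift; the
  jet contributes \<open>s\<^sup>2 * Lop J\<close> up to the square of the drift, of order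
  \<open>s ^ 4\<close>. Of the 13, the Taylor remainder at the four points takes 11 and the squared
  drift 2.\<close>

lemma avg_consistent:
  assumes T: "taylor2 F P J K" and J: "norm J \<le> K" and s: "0 < s" "s * coeff_bound \<le> 1"
  shows "\<bar>avg s F P - F P - s\<^sup>2 * Lop J\<bar> \<le> 13 * coeff_bound ^ 3 * K * s ^ 3"
proof -
  let ?B = coeff_bound
  obtain \<alpha> b1 b2 c m11 m12 m22 where Je: "J = (\<alpha>, (b1, b2), c, (m11, m12, m22))" by (cases J) auto
  note m = norm_jet_components [OF J [unfolded Je]]
  have K: "K \<ge> 0" using J norm_ge_zero order_trans by blast
  have "s * 1 \<le> s * ?B" using s coeff_bound_ge_1 by (intro mult_left_mono) auto
  then have s1: "s \<le> 1" using s by linarith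
  then have s2: "s\<^sup>2 \<le> s" using s by (simp add: power2_eq_square mult_left_le)
  have b: "\<bar>- s\<^sup>2 * a + 2 * s * p\<bar> \<le> s * ?B" "\<bar>- s\<^sup>2 * a - 2 * s * p\<bar> \<le> s * ?B"
    if "\<bar>a\<bar> + 2 * \<bar>p\<bar> \<le> ?B" for a p
  proof -
    have 1: "\<bar>s\<^sup>2 * a\<bar> \<le> s * \<bar>a\<bar>" using s2 s by (simp add: abs_mult mult_right_mono)
    have 2: "\<bar>2 * s * p\<bar> = s * (2 * \<bar>p\<bar>)" using s by (simp add: abs_mult)
    have "s * (\<bar>a\<bar> + 2 * \<bar>p\<bar>) \<le> s * ?B" using that s by (intro mult_left_mono) auto
    then show "\<bar>- s\<^sup>2 * a + 2 * s * p\<bar> \<le> s * ?B" "\<bar>- s\<^sup>2 * a - 2 * s * p\<bar> \<le> s * ?B"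
      using 1 2 unfolding distrib_left by linarith+
  qed
  have le: "\<bar>a1\<bar> + 2 * \<bar>p1\<bar> \<le> ?B" "\<bar>a2\<bar> + 2 * \<bar>p2\<bar> \<le> ?B" "\<bar>a1\<bar> + 2 * \<bar>q1\<bar> \<le> ?B" "\<bar>a2\<bar> + 2 * \<bar>q2\<bar> \<le> ?B"
    by (auto simp: coeff_bound_def)
  have E: "\<bar>F (P \<star> (x, y, 0, - s\<^sup>2)) - F P - jeval J (x, y, 0, - s\<^sup>2)\<bar> \<le> 11 * ?B ^ 3 * K * s ^ 3"
    if "\<bar>x\<bar> \<le> s * ?B" "\<bar>y\<bar> \<le> s * ?B" for x y
  proof -
    have "\<bar>F (P \<star> (x, y, 0, - s\<^sup>2)) - F P - jeval J (x, y, 0, - s\<^sup>2)\<bar> \<le> K * rem3 (x, y, 0, - s\<^sup>2)"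
      using T step_size(1) [OF s that] unfolding taylor2_def by blast
    also have "\<dots> \<le> K * (11 * ?B ^ 3 * s ^ 3)" using step_size(2) [OF s that] K by (intro mult_left_mono)
    finally show ?thesis by (simp add: mult_ac)
  qed
  note E4 = E [OF b(1) [OF le(1)] b(1) [OF le(2)]] E [OF b(2) [OF le(1)] b(2) [OF le(2)]]
    E [OF b(1) [OF le(3)] b(1) [OF le(4)]] E [OF b(2) [OF le(3)] b(2) [OF le(4)]]
  define q where "q = (m11 * a1\<^sup>2 + 2 * m12 * a1 * a2 + m22 * a2\<^sup>2) / 2"
  have "jeval J (- s\<^sup>2 * a1 + 2 * s * p1, - s\<^sup>2 * a2 + 2 * s * p2, 0, - s\<^sup>2)
      + jeval J (- s\<^sup>2 * a1 - 2 * s * p1, - s\<^sup>2 * a2 - 2 * s * p2, 0, - s\<^sup>2)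
      + jeval J (- s\<^sup>2 * a1 + 2 * s * q1, - s\<^sup>2 * a2 + 2 * s * q2, 0, - s\<^sup>2)
      + jeval J (- s\<^sup>2 * a1 - 2 * s * q1, - s\<^sup>2 * a2 - 2 * s * q2, 0, - s\<^sup>2) = 4 * (s\<^sup>2 * Lop J + s ^ 4 * q)"
    by (simp add: Je q_def) (simp add: power2_eq_square power4_eq_xxxx field_simps)
  moreover have "\<bar>s ^ 4 * q\<bar> \<le> 2 * ?B ^ 3 * K * s ^ 3"
  proof -
    have aB: "\<bar>a1\<bar> \<le> ?B" "\<bar>a2\<bar> \<le> ?B" by (auto simp: coeff_bound_def)
    have 1: "\<bar>m11 * (a1 * a1)\<bar> \<le> K * (?B * ?B)" "\<bar>m12 * (a1 * a2)\<bar> \<le> K * (?B * ?B)" "\<bar>m22 * (a2 * a2)\<bar> \<le> K * (?B * ?B)"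
      using m aB by (auto intro!: abs_mult_le)
    have "q = (m11 * (a1 * a1) + 2 * (m12 * (a1 * a2)) + m22 * (a2 * a2)) / 2" by (simp add: q_def power2_eq_square)
    then have "\<bar>q\<bar> \<le> 2 * (K * (?B * ?B))" using 1 unfolding abs_le_iff by (intro conjI; elim conjE; simp)
    also have "\<dots> \<le> 2 * (K * ?B ^ 3)"
      using coeff_bound_ge_1 K by (intro mult_left_mono) (auto simp: power3_eq_cube mult_left_le)
    finally have q: "\<bar>q\<bar> \<le> 2 * (K * ?B ^ 3)" .
    have "s ^ 4 \<le> s ^ 3" using s s1 by (intro power_decreasing) auto
    then have "\<bar>s ^ 4\<bar> \<le> s ^ 3" by simp
    from abs_mult_le [OF this q] show ?thesis by (simp add: mult_ac)
  qed
  moreover have "\<bar>(F1 + F2 + F3 + F4) / 4 - f - l\<bar> \<le> E + G"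
    if "\<bar>F1 - f - j1\<bar> \<le> E" "\<bar>F2 - f - j2\<bar> \<le> E" "\<bar>F3 - f - j3\<bar> \<le> E" "\<bar>F4 - f - j4\<bar> \<le> E"
      "j1 + j2 + j3 + j4 = 4 * (l + r)" "\<bar>r\<bar> \<le> G" for F1 F2 F3 F4 f l j1 j2 j3 j4 r E G :: real
  proof -
    have 1: "(F1 + F2 + F3 + F4) / 4 - f - l = ((F1 - f - j1) + (F2 - f - j2) + (F3 - f - j3) + (F4 - f - j4)) / 4 + r"
      using that(5) by (simp add: field_simps)
    have 2: "\<bar>(x1 + x2 + x3 + x4) / 4\<bar> \<le> E" if "\<bar>x1\<bar> \<le> E" "\<bar>x2\<bar> \<le> E" "\<bar>x3\<bar> \<le> E" "\<bar>x4\<bar> \<le> E" for x1 x2 x3 x4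
      using that by argo
    show ?thesis unfolding 1 using 2 [OF that(1-4)] that(6) by (intro order.trans [OF abs_triangle_ineq] add_mono)
  qed
  ultimately have "\<bar>avg s F P - F P - s\<^sup>2 * Lop J\<bar> \<le> 11 * ?B ^ 3 * K * s ^ 3 + 2 * ?B ^ 3 * K * s ^ 3"
    using E4 unfolding avg_def by blast
  also have "11 * ?B ^ 3 * K * s ^ 3 + 2 * ?B ^ 3 * K * s ^ 3 = 13 * ?B ^ 3 * K * s ^ 3"
    by (simp add: algebra_simps)
  finally show ?thesis .
qed

lemma continuous_on_avg:
  assumes "continuous_on UNIV F" shows "continuous_on UNIV (avg s F)"
  unfolding avg_def by (intro continuous_intros continuous_on_mollify_translate assms) auto

text \<open>The resolvent of the random walk with step \<open>avg s\<close>.\<close>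

lemma resolvent_exists:
  assumes F: "continuous_on UNIV F" "\<And>P. \<bar>F P\<bar> \<le> M" and l: "l > 0" and s: "s > 0"
  obtains v where "continuous_on UNIV v" "\<And>P. \<bar>v P\<bar> \<le> M" "\<And>P. avg s v P - v P = l * s\<^sup>2 * (v P - F P)"
proof -
  \<comment> \<open>Solved for \<open>v\<close>, the resolvent equation reads
    \<open>v = (1 - \<theta>) * F + \<theta> * avg s v\<close>. As \<open>avg\<close> does not
    increase the supremum norm, the right-hand side is a contraction with factor \<theta>, and the
    same convex combination yields the bound by \<open>M\<close>.\<close>
  define \<theta> where "\<theta> = 1 / (1 + l * s\<^sup>2)"
  have ls: "l * s\<^sup>2 > 0" using l s by simp
  have \<theta>: "0 < \<theta>" "\<theta> < 1" using ls by (auto simp: \<theta>_def)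
  define T where "T v = (\<lambda>P. (1 - \<theta>) * F P + \<theta> * avg s v P)" for v
  have avg_le: "\<bar>avg s v P\<bar> \<le> B" if "\<And>P. \<bar>v P\<bar> \<le> B" for v P B
  proof -
    have "\<bar>(x1 + x2 + x3 + x4) / 4\<bar> \<le> B" if "\<bar>x1\<bar> \<le> B" "\<bar>x2\<bar> \<le> B" "\<bar>x3\<bar> \<le> B" "\<bar>x4\<bar> \<le> B" for x1 x2 x3 x4
      using that by argo
    then show ?thesis using that unfolding avg_def by blast
  qed
  have Tb: "T (apply_bcontfun v) \<in> bcontfun" for v :: "(pt, real) bcontfun"
  proof -
    obtain B where B: "\<And>P. \<bar>apply_bcontfun v P\<bar> \<le> B"
      using bounded_apply_bcontfun [of v] unfolding bounded_iff by auto
    have "\<bar>T (apply_bcontfun v) P\<bar> \<le> M + B" for P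
    proof -
      have "\<bar>(1 - \<theta>) * F P\<bar> \<le> 1 * M" "\<bar>\<theta> * avg s (apply_bcontfun v) P\<bar> \<le> 1 * B"
        using \<theta> by (intro abs_mult_le F(2) avg_le [OF B]; simp)+
      then show ?thesis unfolding T_def by argo
    qed
    then have "bounded (range (T (apply_bcontfun v)))" by (auto intro!: boundedI)
    moreover have "continuous_on UNIV (T (apply_bcontfun v))"
      unfolding T_def by (intro continuous_intros F(1) continuous_on_avg) auto
    ultimately show ?thesis by (simp add: bcontfun_def)
  qed
  define TT where "TT v = Bcontfun (T (apply_bcontfun v))" for v :: "(pt, real) bcontfun"
  have TT: "apply_bcontfun (TT v) = T (apply_bcontfun v)" for v
    unfolding TT_def by (rule Bcontfun_inverse [OF Tb])
  have "\<exists>!v. TT v = v"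
  proof (rule banach_fix_type [of \<theta>])
    show "\<forall>x y. dist (TT x) (TT y) \<le> \<theta> * dist x y"
    proof (intro allI dist_bound)
      fix x y P
      have "avg s (apply_bcontfun x) P - avg s (apply_bcontfun y) P = avg s (\<lambda>P. apply_bcontfun x P - apply_bcontfun y P) P"
        by (simp add: avg_def field_simps)
      moreover have "\<bar>avg s (\<lambda>P. apply_bcontfun x P - apply_bcontfun y P) P\<bar> \<le> dist x y"
        by (rule avg_le) (use dist_bounded [of x _ y] in \<open>simp add: dist_real_def\<close>)
      ultimately have "\<theta> * \<bar>avg s (apply_bcontfun x) P - avg s (apply_bcontfun y) P\<bar> \<le> \<theta> * dist x y"
        using \<theta> by (intro mult_left_mono) auto
      moreover have "\<bar>(f + \<theta> * a) - (f + \<theta> * b)\<bar> = \<theta> * \<bar>a - b\<bar>" for f a b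
        using \<theta> by (simp add: abs_mult flip: right_diff_distrib)
      ultimately show "dist (apply_bcontfun (TT x) P) (apply_bcontfun (TT y) P) \<le> \<theta> * dist x y"
        unfolding TT T_def dist_real_def by simp
    qed
  qed (use \<theta> in auto)
  then obtain v0 where v0: "TT v0 = v0" by blast
  define v where "v = apply_bcontfun v0"
  have fixp: "v P = (1 - \<theta>) * F P + \<theta> * avg s v P" for P
    using TT [of v0] unfolding v0 v_def [symmetric] T_def by metis
  show thesis
  proof (rule that)
    show "continuous_on UNIV v" by (simp add: v_def)
    show "avg s v P - v P = l * s\<^sup>2 * (v P - F P)" for P
    proof -
      have "(1 + l * s\<^sup>2) * v P = (1 + l * s\<^sup>2) * ((1 - \<theta>) * F P + \<theta> * avg s v P)" using fixp by metis
      also have "\<dots> = ((1 + l * s\<^sup>2) - (1 + l * s\<^sup>2) * \<theta>) * F P + ((1 + l * s\<^sup>2) * \<theta>) * avg s v P"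
        by (simp add: algebra_simps)
      also have "(1 + l * s\<^sup>2) * \<theta> = 1" using ls by (simp add: \<theta>_def)
      also have "(1 + l * s\<^sup>2 - 1) * F P + 1 * avg s v P = l * s\<^sup>2 * F P + avg s v P" by simp
      finally show ?thesis by (simp add: algebra_simps)
    qed
    show "\<bar>v P\<bar> \<le> M" for P
    proof -
      have bv: "bdd_above (range (\<lambda>P. \<bar>v P\<bar>))"
        using bounded_apply_bcontfun [of v0] unfolding v_def bounded_iff bdd_above_def by auto
      define B where "B = (SUP P. \<bar>v P\<bar>)"
      have B: "\<bar>v P\<bar> \<le> B" for P unfolding B_def using bv by (rule cSUP_upper [rotated]) simp
      have "\<bar>v P\<bar> \<le> (1 - \<theta>) * M + \<theta> * B" for P
      proof -
        have "\<bar>(1 - \<theta>) * F P\<bar> \<le> (1 - \<theta>) * M" "\<bar>\<theta> * avg s v P\<bar> \<le> \<theta> * B"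
          using \<theta> by (intro abs_mult_le F(2) avg_le [OF B]; simp)+
        then show ?thesis using fixp [of P] by argo
      qed
      then have "B \<le> (1 - \<theta>) * M + \<theta> * B" unfolding B_def by (intro cSUP_least) auto
      then have "(1 - \<theta>) * B \<le> (1 - \<theta>) * M" by (simp add: algebra_simps)
      then have "B \<le> M" using \<theta> by simp
      then show ?thesis using B [of P] by linarith
    qed
  qed
qed

end

section \<open>Local comparison of a viscosity supersolution with a resolvent\<close>

definition cube :: "real \<Rightarrow> pt set" where
  "cube r = {-r..r} \<times> {-r..r} \<times> {-r..r} \<times> {-r..r}"

lemma mem_cube: "(x, y, z, t) \<in> cube r \<longleftrightarrow> \<bar>x\<bar> \<le> r \<and> \<bar>y\<bar> \<le> r \<and> \<bar>z\<bar> \<le> r \<and> \<bar>t\<bar> \<le> r"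
  by (auto simp: cube_def)

lemma compact_cube: "compact (cube r)"
  unfolding cube_def by (intro compact_Times) auto

lemma ubox_cube: "ubox = cube 1"
  by (auto simp: ubox_def mem_cube)

lemma eventually_gmul:
  assumes "open U" "S \<in> U" shows "\<forall>\<^sub>F Q in nhds 0. S \<star> Q \<in> U"
proof -
  have "isCont (\<lambda>Q. S \<star> Q) 0"
    by (rule continuous_on_interior [of UNIV]) (auto intro!: continuous_intros)
  then have "((\<lambda>Q. S \<star> Q) \<longlongrightarrow> S) (nhds 0)"
    by (metis gmul_0(1) isCont_def tendsto_at_iff_tendsto_nhds)
  then show ?thesis using assms by (rule topological_tendstoD)
qed

lemma eventually_cube:
  assumes "\<bar>x\<bar> < r" "\<bar>y\<bar> < r" "\<bar>z\<bar> < r" "\<bar>t\<bar> < r"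
  shows "\<forall>\<^sub>F Q in nhds 0. (x, y, z, t) \<star> Q \<in> cube r"
proof -
  have "open ({-r<..<r} \<times> {-r<..<r} \<times> {-r<..<r} \<times> {-r<..<r})" by (intro open_Times) auto
  moreover have "(x, y, z, t) \<in> {-r<..<r} \<times> {-r<..<r} \<times> {-r<..<r} \<times> {-r<..<r}"
    using assms by (auto simp: abs_less_iff)
  ultimately have "\<forall>\<^sub>F Q in nhds 0. (x, y, z, t) \<star> Q \<in> {-r<..<r} \<times> {-r<..<r} \<times> {-r<..<r} \<times> {-r<..<r}"
    by (rule eventually_gmul)
  then show ?thesis by eventually_elim (auto simp: cube_def)
qed

lemma continuous_on_barrier [continuous_intros]:
  "continuous_on S f \<Longrightarrow> continuous_on S (\<lambda>x. barrier (f x))"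
  unfolding barrier_def case_prod_unfold by (intro continuous_intros)

lemma barrier_nonneg: "0 \<le> barrier S"
  by (cases S) (simp add: barrier_def)

lemma barrier_0: "barrier 0 = 0"
  by (simp add: barrier_def zero_prod_def)

lemma barrier_boundary:
  assumes "0 \<le> r" "r \<le> 1" "\<not> (\<bar>x\<bar> < r \<and> \<bar>y\<bar> < r \<and> \<bar>z\<bar> < r \<and> \<bar>t\<bar> < r)"
  shows "r ^ 4 \<le> barrier (x, y, z, t)"
proof -
  have *: "r ^ 4 \<le> u ^ 4" "r ^ 4 \<le> u\<^sup>2" if "r \<le> \<bar>u\<bar>" for u
  proof -
    have "r ^ 4 \<le> \<bar>u\<bar> ^ 4" using that assms by (intro power_mono) auto
    then show "r ^ 4 \<le> u ^ 4" by simp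
    have "r ^ 4 \<le> r\<^sup>2" using assms by (intro power_decreasing) auto
    also have "\<dots> \<le> \<bar>u\<bar>\<^sup>2" using that assms by (intro power_mono) auto
    finally show "r ^ 4 \<le> u\<^sup>2" by simp
  qed
  have n: "0 \<le> x ^ 4" "0 \<le> y ^ 4" "0 \<le> z\<^sup>2" "0 \<le> t\<^sup>2" by simp_all
  consider "r \<le> \<bar>x\<bar>" | "r \<le> \<bar>y\<bar>" | "r \<le> \<bar>z\<bar>" | "r \<le> \<bar>t\<bar>" using assms(3) by force
  then show ?thesis
  proof cases
    case 1 then show ?thesis using *(1) [of x] n unfolding barrier_def prod.case by linarith
  next
    case 2 then show ?thesis using *(1) [of y] n unfolding barrier_def prod.case by linarith
  next
    case 3 then show ?thesis using *(2) [of z] n unfolding barrier_def prod.case by linarith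
  next
    case 4 then show ?thesis using *(2) [of t] n unfolding barrier_def prod.case by linarith
  qed
qed

lemma continuous_on_mollify:
  assumes "\<delta> > 0" "continuous_on UNIV F" "\<And>P. \<bar>F P\<bar> \<le> M"
  shows "continuous_on UNIV (mollify \<delta> F)"
proof (rule continuous_at_imp_continuous_on, intro ballI)
  fix P :: pt
  obtain X Y Z T where P: "P = (X, Y, Z, T)" by (cases P) auto
  have M: "M \<ge> 0" using assms(3) [of 0] by linarith
  have R: "\<bar>X\<bar> + \<bar>Y\<bar> \<ge> 0" by simp
  obtain K where "\<And>F X' Y' Z T. continuous_on UNIV F \<Longrightarrow> (\<And>P. \<bar>F P\<bar> \<le> M) \<Longrightarrow> \<bar>X'\<bar> \<le> \<bar>X\<bar> + \<bar>Y\<bar> \<Longrightarrow> \<bar>Y'\<bar> \<le> \<bar>X\<bar> + \<bar>Y\<bar>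
    \<Longrightarrow> \<exists>J. norm J \<le> K \<and> taylor2 (mollify \<delta> F) (X', Y', Z, T) J K"
    using mollify_taylor2 [OF assms(1) R M] by metis
  from this [of F X Y Z T] obtain J where "taylor2 (mollify \<delta> F) P J K" using assms P by auto
  then show "isCont (mollify \<delta> F) P" by (intro jet_at_isCont taylor2_jet_at)
qed

context left_invariant_operator
begin

lemma mollify_avg:
  assumes "\<delta> > 0" "continuous_on UNIV F"
  shows "mollify \<delta> (avg s F) P = avg s (mollify \<delta> F) P"
proof -
  have "mollify \<delta> (\<lambda>P. (1 / 4) * (F (P \<star> h1) + F (P \<star> h2) + F (P \<star> h3) + F (P \<star> h4))) P
      = (1 / 4) * (mollify \<delta> F (P \<star> h1) + mollify \<delta> F (P \<star> h2) + mollify \<delta> F (P \<star> h3) + mollify \<delta> F (P \<star> h4))" for h1 h2 h3 h4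
    unfolding mollify_cmul
    by (simp add: mollify_add [OF assms(1)] mollify_translate continuous_on_mollify_translate assms continuous_on_add)
  then show ?thesis unfolding avg_def by simp
qed

text \<open>The equation is linear and built from right shifts, so the mollified resolvent solves it
  exactly for the mollified data. This gives a solution with derivatives while keeping the discrete
  equation.\<close>

lemma mollify_resolvent:
  assumes "\<delta> > 0" "continuous_on UNIV F" "continuous_on UNIV v" "\<And>P. avg s v P - v P = k * (v P - F P)"
  shows "avg s (mollify \<delta> v) P - mollify \<delta> v P = k * (mollify \<delta> v P - mollify \<delta> F P)"
proof -
  have "avg s v = (\<lambda>P. (1 + k) * v P + (- k) * F P)" using assms(4) by (auto simp: fun_eq_iff algebra_simps)
  then have "avg s (mollify \<delta> v) P = mollify \<delta> (\<lambda>P. (1 + k) * v P + (- k) * F P) P"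
    using mollify_avg [OF assms(1,3)] by metis
  also have "\<dots> = (1 + k) * mollify \<delta> v P + (- k) * mollify \<delta> F P"
    unfolding mollify_cmul [symmetric] using assms by (intro mollify_add continuous_intros)
  finally show ?thesis by (simp add: algebra_simps)
qed

text \<open>The horizontal gradient and Hessian of the barrier vanish at the origin, which is why
  its horizontal powers are four. Its generator is thus small near 0 and is controlled elsewhere by
  the barrier itself through \<open>u \<le> \<zeta> / 4 + u\<^sup>2 / \<zeta>\<close>. Horizontal
  squares would leave a constant contribution, amplified by the large factor \<open>M\<close> of the
  comparison.\<close>

lemma Lop_barrier:
  assumes \<zeta>: "\<zeta> > 0"
  obtains C where "C \<ge> 0" "\<And>S. S \<in> ubox \<Longrightarrow> Lop (barrier_jet S) \<le> \<zeta> + C * barrier S"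
proof -
  define A11 A12 A22 where "A11 = p1\<^sup>2 + q1\<^sup>2" and "A12 = p1 * p2 + q1 * q2" and "A22 = p2\<^sup>2 + q2\<^sup>2"
  define D where "D = 5 * \<bar>a1\<bar> + 5 * \<bar>a2\<bar> + 13 * \<bar>A11\<bar> + \<bar>A12\<bar> + 13 * \<bar>A22\<bar>"
  have D: "D \<ge> 0" by (simp add: D_def)
  define C where "C = 2 / \<zeta> + D\<^sup>2 / \<zeta> + D"
  have C: "C \<ge> 0" "2 / \<zeta> \<le> C" "D\<^sup>2 / \<zeta> \<le> C" "D \<le> C" using D \<zeta> by (auto simp: C_def)
  show thesis
  proof (rule that [OF C(1)])
    fix S assume S: "S \<in> ubox"
    obtain X Y Z T where Se: "S = (X, Y, Z, T)" by (cases S) auto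
    have b: "\<bar>X\<bar> \<le> 1" "\<bar>Y\<bar> \<le> 1" using S by (auto simp: Se ubox_def)
    define W where "W = X\<^sup>2 + Y\<^sup>2 + Z\<^sup>2"
    have cu: "\<bar>u ^ 3\<bar> \<le> u\<^sup>2" if "\<bar>u\<bar> \<le> 1" for u :: real
    proof -
      have "\<bar>u\<bar> ^ 3 \<le> \<bar>u\<bar>\<^sup>2" using that by (intro power_decreasing) auto
      then show ?thesis by (simp add: power_abs)
    qed
    have pr: "\<bar>u * v\<bar> \<le> (u\<^sup>2 + v\<^sup>2) / 2" for u v :: real
      using zero_le_power2 [of "\<bar>u\<bar> - \<bar>v\<bar>"] by (simp add: power2_diff abs_mult)
    have sq: "0 \<le> X\<^sup>2" "0 \<le> Y\<^sup>2" "0 \<le> Z\<^sup>2" by simp_all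
    have 1: "\<bar>4 * X ^ 3 - Y * Z\<bar> \<le> 5 * W" using cu [OF b(1)] pr [of Y Z] sq unfolding W_def by argo
    have 2: "\<bar>4 * Y ^ 3 + X * Z\<bar> \<le> 5 * W" using cu [OF b(2)] pr [of X Z] sq unfolding W_def by argo
    have 3: "\<bar>12 * X\<^sup>2 + Y\<^sup>2 / 2\<bar> \<le> 13 * W" "\<bar>12 * Y\<^sup>2 + X\<^sup>2 / 2\<bar> \<le> 13 * W" using sq unfolding W_def by argo+
    have 4: "\<bar>X * Y\<bar> \<le> W" using pr [of X Y] sq unfolding W_def by argo
    have L: "Lop (barrier_jet S) = - (2 * T) - a1 * (4 * X ^ 3 - Y * Z) - a2 * (4 * Y ^ 3 + X * Z)
        + A11 * (12 * X\<^sup>2 + Y\<^sup>2 / 2) - A12 * (X * Y) + A22 * (12 * Y\<^sup>2 + X\<^sup>2 / 2)"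
      by (simp add: Se barrier_jet_def A11_def A12_def A22_def)
    have "Lop (barrier_jet S) \<le> 2 * \<bar>T\<bar> + \<bar>a1\<bar> * (5 * W) + \<bar>a2\<bar> * (5 * W) + \<bar>A11\<bar> * (13 * W) + \<bar>A12\<bar> * W + \<bar>A22\<bar> * (13 * W)"
    proof -
      have le: "k * u \<le> \<bar>k\<bar> * U" "- (k * u) \<le> \<bar>k\<bar> * U" if "\<bar>u\<bar> \<le> U" for k u U :: real
        using abs_mult_le [OF order_refl [of "\<bar>k\<bar>"] that] by linarith+
      show ?thesis unfolding L
        using le(2) [OF 1, of a1] le(2) [OF 2, of a2] le(1) [OF 3(1), of A11] le(2) [OF 4, of A12] le(1) [OF 3(2), of A22]
        by linarith
    qed
    also have "\<dots> = 2 * \<bar>T\<bar> + D * W" by (simp add: D_def algebra_simps)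
    also have "\<dots> \<le> \<zeta> + C * barrier S"
    proof -
      have yo: "u \<le> \<zeta> / 4 + u\<^sup>2 / \<zeta>" for u
      proof -
        have "0 \<le> (u - \<zeta> / 2)\<^sup>2 / \<zeta>" using \<zeta> by simp
        also have "\<dots> = \<zeta> / 4 + u\<^sup>2 / \<zeta> - u" using \<zeta> by (simp add: power2_diff field_simps power2_eq_square)
        finally show ?thesis by simp
      qed
      have T: "2 * \<bar>T\<bar> \<le> \<zeta> / 2 + 2 / \<zeta> * T\<^sup>2" using yo [of "\<bar>T\<bar>"] by simp
      have X: "D * X\<^sup>2 \<le> \<zeta> / 4 + D\<^sup>2 / \<zeta> * X ^ 4" "D * Y\<^sup>2 \<le> \<zeta> / 4 + D\<^sup>2 / \<zeta> * Y ^ 4"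
        using yo [of "D * X\<^sup>2"] yo [of "D * Y\<^sup>2"] by (simp_all add: power_mult_distrib power_mult [symmetric])
      have "2 / \<zeta> * T\<^sup>2 \<le> C * T\<^sup>2" "D\<^sup>2 / \<zeta> * X ^ 4 \<le> C * X ^ 4" "D\<^sup>2 / \<zeta> * Y ^ 4 \<le> C * Y ^ 4" "D * Z\<^sup>2 \<le> C * Z\<^sup>2"
        using C by (intro mult_right_mono; simp)+
      moreover have "C * barrier S = C * X ^ 4 + C * Y ^ 4 + C * Z\<^sup>2 + C * T\<^sup>2" by (simp add: barrier_def Se algebra_simps)
      moreover have "D * W = D * X\<^sup>2 + D * Y\<^sup>2 + D * Z\<^sup>2" by (simp add: W_def algebra_simps)
      ultimately show ?thesis using T X by linarith
    qed
    finally show "Lop (barrier_jet S) \<le> \<zeta> + C * barrier S" .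
  qed
qed

text \<open>At an interior minimum of \<open>w - v + M * barrier\<close> over a cube,
  \<open>v - M * barrier\<close> touches \<open>w\<close> from below, so the supersolution property
  bounds \<open>Lop\<close> of the jet of \<open>v\<close>. Consistency of the walk converts this
  into a bound on \<open>l * (v - F)\<close>, and \<open>l \<ge> C\<close> absorbs the barrier term.
  \<open>M\<close> is chosen so that the minimized function is at least
  \<open>\<bar>c\<bar> + 1\<close> on the boundary, where the estimate is immediate because
  \<open>l \<ge> 1\<close>.\<close>

lemma comparison:
  assumes w: "continuous_on UNIV w" and v: "continuous_on UNIV v"
    and super: "\<And>Q J. Q \<in> cube r \<Longrightarrow> subjet w (P1 \<star> Q) J \<Longrightarrow> Lop J \<le> c"
    and r: "0 < r" "r \<le> 1"
    and wM: "\<And>Q. Q \<in> cube r \<Longrightarrow> \<bar>w (P1 \<star> Q)\<bar> \<le> M0" and vM: "\<And>Q. Q \<in> cube r \<Longrightarrow> \<bar>v (P1 \<star> Q)\<bar> \<le> M0"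
    and vT: "\<And>Q. Q \<in> cube r \<Longrightarrow> \<exists>J. norm J \<le> K \<and> taylor2 v (P1 \<star> Q) J K"
    and res: "\<And>P. avg s v P - v P = l * s\<^sup>2 * (v P - F P)"
    and Fw: "\<And>Q. Q \<in> cube r \<Longrightarrow> F (P1 \<star> Q) \<le> w (P1 \<star> Q) + \<omega>"
    and bar: "\<And>S. S \<in> ubox \<Longrightarrow> Lop (barrier_jet S) \<le> \<zeta> + C * barrier S"
    and s: "0 < s" "s * coeff_bound \<le> 1"
    and l: "l \<ge> 1" "l \<ge> C" and M: "M = (2 * M0 + \<bar>c\<bar> + 1) / r ^ 4" and pos: "\<omega> \<ge> 0" "\<zeta> \<ge> 0" "K \<ge> 0"
  shows "v P1 - \<omega> - (c + M * \<zeta> + 13 * coeff_bound ^ 3 * K * s) / l \<le> w P1"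
proof -
  define E where "E = 13 * coeff_bound ^ 3 * K * s"
  have E: "E \<ge> 0" using pos s coeff_bound_ge_1 by (simp add: E_def)
  have M0: "M0 \<ge> 0" using wM [of 0] r by (auto simp: zero_prod_def mem_cube intro: order_trans [OF abs_ge_zero])
  have Mp: "M \<ge> 0" using M0 r by (simp add: M)
  define g where "g Q = w (P1 \<star> Q) - v (P1 \<star> Q) + M * barrier Q" for Q
  have "continuous_on (cube r) g" unfolding g_def
    by (intro continuous_intros continuous_on_compose2 [OF w] continuous_on_compose2 [OF v]) auto
  moreover have "cube r \<noteq> {}" using r mem_cube [of 0 0 0 0 r] by auto
  ultimately obtain S where S: "S \<in> cube r" "\<And>Q. Q \<in> cube r \<Longrightarrow> g S \<le> g Q"
    using continuous_attains_inf [OF compact_cube] by blast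
  obtain x y z t where Se: "S = (x, y, z, t)" by (cases S) auto
  have "0 \<in> cube r" using r by (simp add: zero_prod_def mem_cube)
  then have g0: "g S \<le> w P1 - v P1" using S(2) [of 0] by (simp add: g_def barrier_0)
  have rhs: "- ((c + M * \<zeta> + E) / l) \<le> \<bar>c\<bar>"
  proof -
    have "- (c + M * \<zeta> + E) \<le> \<bar>c\<bar>" using mult_nonneg_nonneg [OF Mp pos(2)] E by linarith
    also have "\<dots> \<le> \<bar>c\<bar> * l" using l by (simp add: mult_le_cancel_left1)
    finally have "- (c + M * \<zeta> + E) / l \<le> \<bar>c\<bar>" using l by (subst pos_divide_le_eq) auto
    then show ?thesis unfolding minus_divide_left .
  qed
  have gS: "- \<omega> - (c + M * \<zeta> + E) / l \<le> g S"
  proof (cases "\<bar>x\<bar> < r \<and> \<bar>y\<bar> < r \<and> \<bar>z\<bar> < r \<and> \<bar>t\<bar> < r")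
    case False
    then have "r ^ 4 \<le> barrier S" unfolding Se using r by (intro barrier_boundary) auto
    then have "M * r ^ 4 \<le> M * barrier S" using Mp by (intro mult_left_mono)
    moreover have "M * r ^ 4 = 2 * M0 + \<bar>c\<bar> + 1" using r by (simp add: M)
    ultimately have "\<bar>c\<bar> \<le> g S" using wM [OF S(1)] vM [OF S(1)] unfolding g_def by linarith
    then show ?thesis using rhs pos by linarith
  next
    case True
    then have ev: "\<forall>\<^sub>F Q in nhds 0. S \<star> Q \<in> cube r" unfolding Se by (intro eventually_cube) auto
    obtain J where J: "norm J \<le> K" "taylor2 v (P1 \<star> S) J K" using vT [OF S(1)] by blast
    have jb: "jet_at (\<lambda>P. barrier (ginv P1 \<star> P)) (P1 \<star> S) (barrier_jet S)"
      using jet_at_barrier [of S] unfolding jet_at_def by (simp add: gmul_assoc)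
    have jp: "jet_at (\<lambda>P. v P + (- M) * barrier (ginv P1 \<star> P)) (P1 \<star> S) (J + (- M) *\<^sub>R barrier_jet S)"
      by (intro jet_at_add jet_at_cmul taylor2_jet_at [OF J(2)] jb)
    have "subjet w (P1 \<star> S) (J + (- M) *\<^sub>R barrier_jet S)"
    proof (rule subjet_of_touching [OF jp])
      show "\<forall>\<^sub>F Q in nhds 0. v (P1 \<star> S \<star> Q) + (- M) * barrier (ginv P1 \<star> (P1 \<star> S \<star> Q)) -
         (v (P1 \<star> S) + (- M) * barrier (ginv P1 \<star> (P1 \<star> S))) \<le> w (P1 \<star> S \<star> Q) - w (P1 \<star> S)"
        using ev
      proof eventually_elim
        case (elim Q)
        then show ?case using S(2) [of "S \<star> Q"] by (simp add: g_def gmul_assoc)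
      qed
    qed
    then have "Lop (J + (- M) *\<^sub>R barrier_jet S) \<le> c" by (rule super [OF S(1)])
    then have 1: "Lop J - M * Lop (barrier_jet S) \<le> c" unfolding Lop_add Lop_scaleR by simp
    have "S \<in> ubox" using S(1) r by (auto simp: ubox_cube Se mem_cube)
    then have "M * Lop (barrier_jet S) \<le> M * (\<zeta> + C * barrier S)" using bar Mp by (intro mult_left_mono)
    also have "\<dots> \<le> M * \<zeta> + l * (M * barrier S)"
      using mult_right_mono [OF l(2), of "M * barrier S"] Mp barrier_nonneg [of S] by (simp add: algebra_simps)
    finally have 2: "M * Lop (barrier_jet S) \<le> M * \<zeta> + l * (M * barrier S)" .
    have "\<bar>avg s v (P1 \<star> S) - v (P1 \<star> S) - s\<^sup>2 * Lop J\<bar> \<le> 13 * coeff_bound ^ 3 * K * s ^ 3"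
      by (rule avg_consistent [OF J(2,1) s])
    also have "\<dots> = s\<^sup>2 * E" by (simp add: E_def power2_eq_square power3_eq_cube)
    finally have "s\<^sup>2 * (l * (v (P1 \<star> S) - F (P1 \<star> S))) - s\<^sup>2 * Lop J \<le> s\<^sup>2 * E"
      unfolding res by (simp add: algebra_simps)
    then have "s\<^sup>2 * (l * (v (P1 \<star> S) - F (P1 \<star> S)) - Lop J) \<le> s\<^sup>2 * E" by (simp add: right_diff_distrib)
    then have 3: "l * (v (P1 \<star> S) - F (P1 \<star> S)) - Lop J \<le> E" using s by simp
    have "v (P1 \<star> S) - F (P1 \<star> S) \<ge> - g S + M * barrier S - \<omega>" using Fw [OF S(1)] by (simp add: g_def)
    then have "l * (- g S + M * barrier S - \<omega>) \<le> l * (v (P1 \<star> S) - F (P1 \<star> S))" using l by (intro mult_left_mono) auto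
    then have "- (l * g S) - l * \<omega> \<le> c + M * \<zeta> + E" using 1 2 3 by (simp add: algebra_simps)
    then have "l * (- g S - \<omega>) \<le> c + M * \<zeta> + E" by (simp add: algebra_simps)
    then have "- g S - \<omega> \<le> (c + M * \<zeta> + E) / l" using l by (simp add: pos_le_divide_eq mult.commute)
    then show ?thesis by linarith
  qed
  then show ?thesis using g0 unfolding E_def by linarith
qed

end

lemma cube_neighbourhood:
  assumes O: "open U" and C: "compact C" "C \<subseteq> U"
  obtains r where "0 < r" "r \<le> 1" "\<And>P Q. P \<in> C \<Longrightarrow> Q \<in> cube r \<Longrightarrow> P \<star> Q \<in> U"
proof -
  obtain e where e: "e > 0" "(\<Union>x\<in>C. ball x e) \<subseteq> U"
    using compact_subset_open_imp_ball_epsilon_subset [OF C(1) O C(2)] .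
  obtain R where R: "R > 0" "\<And>P. P \<in> C \<Longrightarrow> norm P \<le> R"
    using compact_imp_bounded [OF C(1)] unfolding bounded_pos by blast
  \<comment> \<open>\<open>P \<star> Q\<close> differs from \<open>P\<close> by at most
    \<open>r\<close> in three coordinates and by at most \<open>r + R * r\<close> in the central
    one, in total \<open>r * (4 + R)\<close>; the choice makes this at most
    \<open>e / 2\<close>.\<close>
  define r where "r = min 1 (e / (2 * (4 + R)))"
  have r: "0 < r" "r \<le> 1" using e R by (auto simp: r_def)
  have "r * (4 + R) \<le> e / (2 * (4 + R)) * (4 + R)" using R by (intro mult_right_mono) (auto simp: r_def)
  also have "\<dots> = e / 2" using R by (simp add: field_simps)
  finally have r3: "r * (4 + R) < e" using e by linarith
  show thesis
  proof (rule that [OF r(1,2)])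
    fix P Q assume P: "P \<in> C" and Q: "Q \<in> cube r"
    obtain X Y Z T where Pe: "P = (X, Y, Z, T)" by (cases P) auto
    obtain x y z t where Qe: "Q = (x, y, z, t)" by (cases Q) auto
    note q = Q [unfolded Qe mem_cube]
    note p = abs_le_norm_pt [OF R(2) [OF P, unfolded Pe]]
    have "\<bar>X * y\<bar> \<le> R * r" "\<bar>x * Y\<bar> \<le> r * R" using p q by (auto intro!: abs_mult_le)
    then have m: "\<bar>z + (X * y - x * Y) / 2\<bar> \<le> r + R * r" using q by (simp add: mult.commute) argo
    have "P \<star> Q - P = (x, y, z + (X * y - x * Y) / 2, t)" by (simp add: Pe Qe)
    then have "norm (P \<star> Q - P) \<le> \<bar>x\<bar> + \<bar>y\<bar> + \<bar>z + (X * y - x * Y) / 2\<bar> + \<bar>t\<bar>" by (metis norm_pt_le)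
    also have "\<dots> \<le> r + r + (r + R * r) + r" using q m by (intro add_mono) auto
    also have "\<dots> < e" using r3 by (simp add: algebra_simps)
    finally have "P \<star> Q \<in> ball P e" by (simp add: dist_norm norm_minus_commute)
    then show "P \<star> Q \<in> U" using e(2) P by blast
  qed
qed

lemma mollify_uniform:
  assumes F: "continuous_on UNIV F" and C: "compact C" and \<omega>: "\<omega> > 0"
  obtains \<delta> where "0 < \<delta>" "\<delta> \<le> 1" "\<And>\<delta>' P. 0 < \<delta>' \<Longrightarrow> \<delta>' \<le> \<delta> \<Longrightarrow> P \<in> C \<Longrightarrow> \<bar>mollify \<delta>' F P - F P\<bar> \<le> \<omega>"
proof -
  define f where "f = (\<lambda>(g, P). F (g \<star> P))"
  have "continuous_on (cball 0 1 \<times> C) f"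
    unfolding f_def case_prod_unfold by (rule continuous_on_compose2 [OF F]) (auto intro!: continuous_intros)
  then have "uniformly_continuous_on (cball 0 1 \<times> C) f"
    using C by (intro compact_uniformly_continuous compact_Times) auto
  then obtain d where d: "d > 0" "\<And>A B. A \<in> cball 0 1 \<times> C \<Longrightarrow> B \<in> cball 0 1 \<times> C \<Longrightarrow> dist B A < d \<Longrightarrow> dist (f B) (f A) < \<omega>"
    using \<omega> unfolding uniformly_continuous_on_def by metis
  show thesis
  proof (rule that [of "min 1 (d / 2)"])
    fix \<delta>' P assume \<delta>': "0 < \<delta>'" "\<delta>' \<le> min 1 (d / 2)" and P: "P \<in> C"
    show "\<bar>mollify \<delta>' F P - F P\<bar> \<le> \<omega>"
    proof (rule mollify_bounds [OF \<delta>'(1) F])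
      fix g :: pt assume g: "norm g \<le> \<delta>'"
      have "dist (f (g, P)) (f (0, P)) < \<omega>"
        by (rule d(2)) (use g \<delta>' P d(1) in \<open>auto simp: dist_Pair_Pair dist_norm\<close>)
      then show "\<bar>F (g \<star> P) - F P\<bar> \<le> \<omega>" by (simp add: f_def dist_real_def)
    qed
  qed (use d in auto)
qed

lemma taylor2_mono: "taylor2 F P J K \<Longrightarrow> K \<le> K' \<Longrightarrow> taylor2 F P J K'"
  unfolding taylor2_def by (meson mult_right_mono order_trans rem3_nonneg)

section \<open>Mollification of linear viscosity supersolutions\<close>

context left_invariant_operator
begin

text \<open>The generators are compared through a step \<open>s\<close> independent of the one that defines the resolvent.\<close>

lemma Lop_diff_bound:
  assumes V: "taylor2 V P J K" "norm J \<le> K" and W: "taylor2 W P J' K" "norm J' \<le> K"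
    and s: "0 < s" "s * coeff_bound \<le> 1" and d: "\<And>Q. Q \<in> ubox \<Longrightarrow> \<bar>V (P \<star> Q) - W (P \<star> Q)\<bar> \<le> \<epsilon>"
  shows "\<bar>Lop J - Lop J'\<bar> \<le> 2 * \<epsilon> / s\<^sup>2 + 26 * coeff_bound ^ 3 * K * s"
proof -
  let ?B = coeff_bound
  have VW: "taylor2 (\<lambda>P. V P + (- 1) * W P) P (J + (- 1) *\<^sub>R J') (2 * K)"
    unfolding taylor2_def
  proof
    fix Q assume "Q \<in> ubox"
    then have "\<bar>V (P \<star> Q) - V P - jeval J Q\<bar> \<le> K * rem3 Q" "\<bar>W (P \<star> Q) - W P - jeval J' Q\<bar> \<le> K * rem3 Q"
      using V W by (auto simp: taylor2_def)
    then show "\<bar>V (P \<star> Q) + (- 1) * W (P \<star> Q) - (V P + (- 1) * W P) - jeval (J + (- 1) *\<^sub>R J') Q\<bar> \<le> 2 * K * rem3 Q"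
      unfolding jeval_add jeval_scaleR by linarith
  qed
  have nJ: "norm (J + (- 1) *\<^sub>R J') \<le> 2 * K" using norm_triangle_ineq4 [of J J'] V W by simp
  have b: "\<bar>- s\<^sup>2 * a + 2 * s * p\<bar> \<le> s * ?B" "\<bar>- s\<^sup>2 * a - 2 * s * p\<bar> \<le> s * ?B"
    if "\<bar>a\<bar> + 2 * \<bar>p\<bar> \<le> ?B" for a p
  proof -
    have "s * 1 \<le> s * ?B" using s coeff_bound_ge_1 by (intro mult_left_mono) auto
    then have s1: "s \<le> 1" using s by linarith
    then have s2: "s\<^sup>2 \<le> s" using s by (simp add: power2_eq_square mult_left_le)
    have 1: "\<bar>s\<^sup>2 * a\<bar> \<le> s * \<bar>a\<bar>" using s2 s by (simp add: abs_mult mult_right_mono)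
    have 2: "\<bar>2 * s * p\<bar> = s * (2 * \<bar>p\<bar>)" using s by (simp add: abs_mult)
    have "s * (\<bar>a\<bar> + 2 * \<bar>p\<bar>) \<le> s * ?B" using that s by (intro mult_left_mono) auto
    then show "\<bar>- s\<^sup>2 * a + 2 * s * p\<bar> \<le> s * ?B" "\<bar>- s\<^sup>2 * a - 2 * s * p\<bar> \<le> s * ?B"
      using 1 2 unfolding distrib_left by linarith+
  qed
  have le: "\<bar>a1\<bar> + 2 * \<bar>p1\<bar> \<le> ?B" "\<bar>a2\<bar> + 2 * \<bar>p2\<bar> \<le> ?B" "\<bar>a1\<bar> + 2 * \<bar>q1\<bar> \<le> ?B" "\<bar>a2\<bar> + 2 * \<bar>q2\<bar> \<le> ?B"
    by (auto simp: coeff_bound_def)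
  have dd: "\<bar>V (P \<star> Q) + (- 1) * W (P \<star> Q)\<bar> \<le> \<epsilon>" if "Q \<in> ubox" for Q using d [OF that] by simp
  note in_ubox = step_size(1) [OF s b(1) [OF le(1)] b(1) [OF le(2)]] step_size(1) [OF s b(2) [OF le(1)] b(2) [OF le(2)]]
    step_size(1) [OF s b(1) [OF le(3)] b(1) [OF le(4)]] step_size(1) [OF s b(2) [OF le(3)] b(2) [OF le(4)]]
  have "\<bar>(x1 + x2 + x3 + x4) / 4\<bar> \<le> \<epsilon>" if "\<bar>x1\<bar> \<le> \<epsilon>" "\<bar>x2\<bar> \<le> \<epsilon>" "\<bar>x3\<bar> \<le> \<epsilon>" "\<bar>x4\<bar> \<le> \<epsilon>" for x1 x2 x3 x4
    using that by argo
  then have 1: "\<bar>avg s (\<lambda>P. V P + (- 1) * W P) P\<bar> \<le> \<epsilon>"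
    unfolding avg_def using dd in_ubox by blast
  have "0 \<in> ubox" by (auto simp: ubox_def zero_prod_def)
  then have 2: "\<bar>V P + (- 1) * W P\<bar> \<le> \<epsilon>" using dd [of 0] by simp
  have "\<bar>avg s (\<lambda>P. V P + (- 1) * W P) P - (V P + (- 1) * W P) - s\<^sup>2 * Lop (J + (- 1) *\<^sub>R J')\<bar>
      \<le> 13 * ?B ^ 3 * (2 * K) * s ^ 3"
    by (rule avg_consistent [OF VW nJ s])
  then have "\<bar>s\<^sup>2 * (Lop J - Lop J')\<bar> \<le> 2 * \<epsilon> + 26 * ?B ^ 3 * K * s ^ 3"
    using 1 2 unfolding Lop_add Lop_scaleR by (simp add: algebra_simps) 
  then have "s\<^sup>2 * \<bar>Lop J - Lop J'\<bar> \<le> s\<^sup>2 * (2 * \<epsilon> / s\<^sup>2 + 26 * ?B ^ 3 * K * s)"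
    using s by (simp add: abs_mult distrib_left power2_eq_square power3_eq_cube mult_ac)
  then show ?thesis using s by simp
qed

lemma Lop_bound:
  obtains C where "C \<ge> 0" "\<And>J. \<bar>Lop J\<bar> \<le> C * norm J"
proof -
  have "linear Lop" by (intro linearI) (simp_all add: Lop_add Lop_scaleR)
  then have "bounded_linear Lop" by (simp add: linear_conv_bounded_linear)
  then obtain C where "C > 0" "\<And>J. norm (Lop J) \<le> norm J * C" using bounded_linear.pos_bounded by blast
  then show thesis by (intro that [of C]) (auto simp: mult.commute)
qed

text \<open>By comparison \<open>w\<close> dominates the mollified resolvent of its own values, up to the error
  \<open>c / l\<close>. Mollifying this linear relation by \<open>\<delta>\<close> and letting the resolvent parameter \<open>l\<close> tend to
  infinity gives the inequality for the smooth function \<open>mollify \<delta> w\<close>.\<close>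

lemma mollify_linear_supersolution:
  assumes w: "continuous_on UNIV w" and U: "open U" and \<delta>: "\<delta> > 0"
    and super: "\<And>P J. P \<in> U \<Longrightarrow> subjet w P J \<Longrightarrow> Lop J \<le> c"
    and inU: "\<And>g. norm g \<le> \<delta> \<Longrightarrow> g \<star> P0 \<in> U"
    and T: "taylor2 (mollify \<delta> w) P0 J K0"
  shows "Lop J \<le> c"
proof (rule ccontr)
  assume "\<not> Lop J \<le> c"
  \<comment> \<open>The errors below consume \<open>3 * \<kappa> / 16 + 4 * \<kappa> / 8\<close> of
    the assumed excess \<kappa>. The order of choices matters: the derivative bound \<open>K\<close>
    for \<open>mollify \<delta>\<close> does not involve the resolvent, so the probing step
    \<open>s1\<close> comes before \<open>l\<close>; then follow the tolerance \<omega> and the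
    inner radius \<delta>'. The walk step \<open>s\<close> comes last, because the derivative bound
    \<open>K2\<close> depends on \<delta>'.\<close>
  define \<kappa> where "\<kappa> = Lop J - c"
  have \<kappa>: "\<kappa> > 0" using \<open>\<not> Lop J \<le> c\<close> by (simp add: \<kappa>_def)
  let ?B = coeff_bound
  have B: "?B \<ge> 1" by (rule coeff_bound_ge_1)
  define C0 where "C0 = (\<lambda>g. g \<star> P0) ` cball 0 \<delta>"
  have C0: "compact C0" "C0 \<subseteq> U" unfolding C0_def using inU
    by (auto intro!: compact_continuous_image continuous_intros)
  obtain r where r: "0 < r" "r \<le> 1" "\<And>P Q. P \<in> C0 \<Longrightarrow> Q \<in> cube r \<Longrightarrow> P \<star> Q \<in> U"
    using cube_neighbourhood [OF U C0] by blast
  define reg where "reg = (\<lambda>(g, Q). g \<star> (P0 \<star> Q)) ` (cball 0 \<delta> \<times> cube 1)"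
  have reg: "compact reg" unfolding reg_def case_prod_unfold
    by (intro compact_continuous_image compact_Times compact_cube continuous_intros) auto
  have regI: "g \<star> (P0 \<star> Q) \<in> reg" if "norm g \<le> \<delta>" "Q \<in> ubox" for g Q
    unfolding reg_def using that by (auto simp: ubox_cube intro!: image_eqI [where x = "(g, Q)"])
  obtain b where b: "reg \<subseteq> cbox (- b) b" using bounded_subset_cbox_symmetric [OF compact_imp_bounded [OF reg]] .
  \<comment> \<open>Clamping \<open>w\<close> outside a box makes the data globally bounded, as the
    resolvent requires. On \<open>reg\<close>, which contains the points at which the data are
    compared with \<open>w\<close>, nothing changes.\<close>
  define F where "F = ext_cont w (- b) b"
  have F: "continuous_on UNIV F" unfolding F_def
    by (intro continuous_on_ext_cont continuous_on_subset [OF w]) auto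
  have Fw: "F P = w P" if "P \<in> reg" for P using that b by (auto simp: F_def)
  have "0 \<in> ubox" by (simp add: ubox_cube zero_prod_def mem_cube)
  then have zero_reg: "P0 \<in> reg" using regI [of 0 0] \<delta> by simp
  have ne: "cbox (- b) b \<noteq> {}" using zero_reg b by blast
  have "compact (w ` cbox (- b) b)" by (intro compact_continuous_image continuous_on_subset [OF w]) auto
  from compact_imp_bounded [OF this] obtain M0 where M0': "\<And>P. P \<in> cbox (- b) b \<Longrightarrow> \<bar>w P\<bar> \<le> M0"
    unfolding bounded_iff by auto
  have M0: "\<bar>F P\<bar> \<le> M0" for P
    unfolding F_def ext_cont_def using ne by (intro M0' clamp_in_interval) (simp add: box_ne_empty)
  have M0p: "M0 \<ge> 0" using M0 [of 0] by linarith
  obtain R where R: "R > 0" "\<And>P. P \<in> reg \<Longrightarrow> norm P \<le> R"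
    using compact_imp_bounded [OF reg] unfolding bounded_pos by blast
  obtain K1 where K1: "K1 \<ge> 0" "\<And>F X Y Z T. continuous_on UNIV F \<Longrightarrow> (\<And>P. \<bar>F P\<bar> \<le> M0) \<Longrightarrow> \<bar>X\<bar> \<le> R \<Longrightarrow> \<bar>Y\<bar> \<le> R
    \<Longrightarrow> \<exists>J. norm J \<le> K1 \<and> taylor2 (mollify \<delta> F) (X, Y, Z, T) J K1"
    using mollify_taylor2 [OF \<delta> _ M0p, of R] R by (metis less_eq_real_def)
  define K where "K = max K1 (max K0 (norm J))"
  have K: "K \<ge> 0" "K1 \<le> K" "K0 \<le> K" "norm J \<le> K" using K1(1) by (auto simp: K_def)
  have T1: "\<exists>J. norm J \<le> K \<and> taylor2 (mollify \<delta> G) P J K"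
    if "continuous_on UNIV G" "\<And>P. \<bar>G P\<bar> \<le> M0" "P \<in> reg" for G P
  proof -
    obtain X Y Z T where P: "P = (X, Y, Z, T)" by (cases P) auto
    note p = abs_le_norm_pt [OF R(2) [OF that(3), unfolded P]]
    from K1(2) [OF that(1,2) p(1,2), of Z T] show ?thesis unfolding P using K(2) taylor2_mono by (meson order_trans)
  qed
  define C1 where "C1 = 13 * ?B ^ 3 * K"
  have C1: "C1 \<ge> 0" using K B by (simp add: C1_def)
  obtain CL where CL: "CL \<ge> 0" "\<And>J. \<bar>Lop J\<bar> \<le> CL * norm J" using Lop_bound by blast
  define C2 where "C2 = CL * K + C1"
  have C2: "C2 \<ge> 0" using CL K C1 by (simp add: C2_def)
  define M where "M = (2 * M0 + \<bar>c\<bar> + 1) / r ^ 4"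
  have M: "M \<ge> 0" using M0p r by (simp add: M_def)
  define \<zeta> where "\<zeta> = \<kappa> / (8 * (M + 1))"
  have \<zeta>: "\<zeta> > 0" "M * \<zeta> \<le> \<kappa> / 8" using \<kappa> M by (auto simp: \<zeta>_def field_simps)
  obtain Cz where Cz: "Cz \<ge> 0" "\<And>S. S \<in> ubox \<Longrightarrow> Lop (barrier_jet S) \<le> \<zeta> + Cz * barrier S"
    using Lop_barrier [OF \<zeta>(1)] by blast
  define s1 where "s1 = min (1 / ?B) (\<kappa> / (32 * (C1 + 1)))"
  have s1: "s1 > 0" "s1 * ?B \<le> 1" "2 * C1 * s1 \<le> \<kappa> / 16"
  proof -
    show "s1 > 0" using B \<kappa> C1 by (auto simp: s1_def)
    have "s1 * ?B \<le> 1 / ?B * ?B" using B by (intro mult_right_mono) (auto simp: s1_def)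
    then show "s1 * ?B \<le> 1" using B by simp
    have "2 * C1 * s1 \<le> 2 * C1 * (\<kappa> / (32 * (C1 + 1)))" using C1 by (intro mult_left_mono) (auto simp: s1_def)
    also have "\<dots> \<le> \<kappa> / 16" using C1 \<kappa> by (simp add: field_simps)
    finally show "2 * C1 * s1 \<le> \<kappa> / 16" .
  qed
  \<comment> \<open>The last entry makes the uniform distance \<open>C2 / l\<close> between
    \<open>V\<close> and \<open>U'\<close> harmless even after the division by
    \<open>s1\<^sup>2\<close> in \<open>Lop_diff_bound\<close>.\<close>
  define l where "l = max (max 1 Cz) (32 * C2 / (\<kappa> * s1\<^sup>2))"
  have l: "l \<ge> 1" "l \<ge> Cz" "2 * (C2 / l) / s1\<^sup>2 \<le> \<kappa> / 16"
  proof -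
    show l1: "l \<ge> 1" "l \<ge> Cz" by (auto simp: l_def)
    have "32 * C2 / (\<kappa> * s1\<^sup>2) \<le> l" by (simp add: l_def)
    then have "32 * C2 \<le> l * (\<kappa> * s1\<^sup>2)" using \<kappa> s1 by (simp add: pos_divide_le_eq)
    then show "2 * (C2 / l) / s1\<^sup>2 \<le> \<kappa> / 16" using l1 \<kappa> s1 by (simp add: field_simps)
  qed
  define \<omega> where "\<omega> = min (\<kappa> * s1\<^sup>2 / 32) (\<kappa> / (16 * l))"
  have \<omega>: "\<omega> > 0" "2 * \<omega> / s1\<^sup>2 \<le> \<kappa> / 16" "2 * l * \<omega> \<le> \<kappa> / 8"
  proof -
    show "\<omega> > 0" using \<kappa> s1 l by (auto simp: \<omega>_def)
    have "\<omega> \<le> \<kappa> * s1\<^sup>2 / 32" by (simp add: \<omega>_def)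
    then show "2 * \<omega> / s1\<^sup>2 \<le> \<kappa> / 16" using s1 by (simp add: field_simps)
    have "\<omega> \<le> \<kappa> / (16 * l)" by (simp add: \<omega>_def)
    then show "2 * l * \<omega> \<le> \<kappa> / 8" using l by (simp add: field_simps)
  qed
  obtain \<delta>' where \<delta>': "0 < \<delta>'" "\<And>P. P \<in> reg \<Longrightarrow> \<bar>mollify \<delta>' F P - F P\<bar> \<le> \<omega>"
    using mollify_uniform [OF F reg \<omega>(1)] by (metis order_refl)
  obtain K2 where K2: "K2 \<ge> 0" "\<And>F X Y Z T. continuous_on UNIV F \<Longrightarrow> (\<And>P. \<bar>F P\<bar> \<le> M0) \<Longrightarrow> \<bar>X\<bar> \<le> R \<Longrightarrow> \<bar>Y\<bar> \<le> R
    \<Longrightarrow> \<exists>J. norm J \<le> K2 \<and> taylor2 (mollify \<delta>' F) (X, Y, Z, T) J K2"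
    using mollify_taylor2 [OF \<delta>'(1) _ M0p, of R] R by (metis less_eq_real_def)
  define C3 where "C3 = 13 * ?B ^ 3 * K2"
  have C3: "C3 \<ge> 0" using K2 B by (simp add: C3_def)
  define s where "s = min (1 / ?B) (\<kappa> / (8 * (C1 + C3 + 1)))"
  have s: "s > 0" "s * ?B \<le> 1" "C1 * s \<le> \<kappa> / 8" "C3 * s \<le> \<kappa> / 8"
  proof -
    show s0: "s > 0" using B \<kappa> C1 C3 by (auto simp: s_def)
    have "s * ?B \<le> 1 / ?B * ?B" using B by (intro mult_right_mono) (auto simp: s_def)
    then show "s * ?B \<le> 1" using B by simp
    have "(C1 + C3 + 1) * s \<le> (C1 + C3 + 1) * (\<kappa> / (8 * (C1 + C3 + 1)))" using C1 C3 by (intro mult_left_mono) (auto simp: s_def)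
    also have "\<dots> = \<kappa> / 8" using C1 C3 by (simp add: field_simps)
    finally have *: "(C1 + C3 + 1) * s \<le> \<kappa> / 8" .
    have "C1 * s \<le> (C1 + C3 + 1) * s" "C3 * s \<le> (C1 + C3 + 1) * s" using C1 C3 s0 by (auto intro!: mult_right_mono)
    then show "C1 * s \<le> \<kappa> / 8" "C3 * s \<le> \<kappa> / 8" using * by linarith+
  qed
  have "s \<le> 1"
  proof -
    have "s * 1 \<le> s * ?B" using s B by (intro mult_left_mono) auto
    then show ?thesis using s by linarith
  qed
  obtain v where v: "continuous_on UNIV v" "\<And>P. \<bar>v P\<bar> \<le> M0" "\<And>P. avg s v P - v P = l * s\<^sup>2 * (v P - F P)"
    using resolvent_exists [OF F M0, of l s] l s by (metis less_le_trans zero_less_one)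
  \<comment> \<open>The resolvent \<open>v\<close> is only continuous, while the comparison needs
    its second-order expansion. The inner mollification provides it and replaces the data by
    \<open>F'\<close>, which is within \<omega> of \<open>w\<close> on \<open>reg\<close>.\<close>
  define v' F' where "v' = mollify \<delta>' v" and "F' = mollify \<delta>' F"
  have v': "continuous_on UNIV v'" "\<And>P. \<bar>v' P\<bar> \<le> M0" "\<And>P. avg s v' P - v' P = l * s\<^sup>2 * (v' P - F' P)"
    unfolding v'_def F'_def using mollify_bounds [OF \<delta>'(1) v(1), of _ 0 M0] v(2)
    by (auto intro!: continuous_on_mollify [OF \<delta>'(1) v(1,2)] mollify_resolvent [OF \<delta>'(1) F v(1,3)])
  have F': "continuous_on UNIV F'" "\<And>P. \<bar>F' P\<bar> \<le> M0"
    unfolding F'_def using mollify_bounds [OF \<delta>'(1) F, of _ 0 M0] M0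
    by (auto intro!: continuous_on_mollify [OF \<delta>'(1) F M0])
  have F'w: "\<bar>F' P - w P\<bar> \<le> \<omega>" if "P \<in> reg" for P using \<delta>'(2) [OF that] Fw [OF that] by (simp add: F'_def)
  \<comment> \<open>Multiplied by \<open>l\<close>, this error returns \<open>c\<close> plus small
    terms; the share of \<omega> stays small because \<omega> was chosen below a multiple of
    \<open>1 / l\<close>.\<close>
  define e0 where "e0 = \<omega> + (c + M * \<zeta> + C3 * s) / l"
  have cmp: "v' (g \<star> P0) - e0 \<le> w (g \<star> P0)" if g: "norm g \<le> \<delta>" for g
  proof -
    have inr: "g \<star> P0 \<star> Q \<in> reg" if "Q \<in> cube r" for Q
      unfolding gmul_assoc using that r by (intro regI g) (cases Q, auto simp: ubox_cube mem_cube)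
    have "v' (g \<star> P0) - \<omega> - (c + M * \<zeta> + 13 * ?B ^ 3 * K2 * s) / l \<le> w (g \<star> P0)"
    proof (rule comparison [OF w v'(1) _ r(1,2) _ v'(2) _ v'(3) _ Cz(2) s(1,2) l(1,2) M_def])
      show "Lop J \<le> c" if "Q \<in> cube r" "subjet w (g \<star> P0 \<star> Q) J" for Q J
        using r(3) [OF _ that(1), of "g \<star> P0"] g super [OF _ that(2)] by (auto simp: C0_def)
      show "\<bar>w (g \<star> P0 \<star> Q)\<bar> \<le> M0" if "Q \<in> cube r" for Q
        using Fw [OF inr [OF that]] M0 [of "g \<star> P0 \<star> Q"] by simp
      show "\<exists>J. norm J \<le> K2 \<and> taylor2 v' (g \<star> P0 \<star> Q) J K2" if "Q \<in> cube r" for Q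
      proof -
        obtain X Y Z T where P: "g \<star> P0 \<star> Q = (X, Y, Z, T)" by (cases "g \<star> P0 \<star> Q") auto
        note p = abs_le_norm_pt [OF R(2) [OF inr [OF that], unfolded P]]
        show ?thesis unfolding P v'_def by (rule K2(2) [OF v(1,2) p(1,2)])
      qed
      show "F' (g \<star> P0 \<star> Q) \<le> w (g \<star> P0 \<star> Q) + \<omega>" if "Q \<in> cube r" for Q
        using F'w [OF inr [OF that]] by linarith
    qed (use \<omega> \<zeta> K2 in auto)
    then show ?thesis unfolding e0_def C3_def by (simp add: algebra_simps)
  qed
  define V U' where "V = mollify \<delta> v'" and "U' = mollify \<delta> F'"
  have Vres: "avg s V P - V P = l * s\<^sup>2 * (V P - U' P)" for P
    unfolding V_def U'_def by (rule mollify_resolvent [OF \<delta> F'(1) v'(1,3)])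
  \<comment> \<open>The viscosity inequality has become an inequality between two functions at every
    \<open>g \<star> P0\<close>, so it can be averaged against the kernel.\<close>
  have "mollify \<delta> (\<lambda>P. v' P + (- e0)) P0 \<le> mollify \<delta> w P0"
    by (rule mollify_mono [OF \<delta> _ w]) (use cmp v'(1) in \<open>auto intro!: continuous_intros\<close>)
  then have 1: "V P0 - e0 \<le> mollify \<delta> w P0"
    unfolding mollify_add_const [OF \<delta> v'(1)] V_def by simp
  have 2: "\<bar>U' (P0 \<star> Q) - mollify \<delta> w (P0 \<star> Q)\<bar> \<le> \<omega>" if "Q \<in> ubox" for Q
  proof -
    have "mollify \<delta> (\<lambda>P. F P + (- \<omega>)) (P0 \<star> Q) \<le> U' (P0 \<star> Q)" "U' (P0 \<star> Q) \<le> mollify \<delta> (\<lambda>P. F P + \<omega>) (P0 \<star> Q)"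
      unfolding U'_def by (intro mollify_mono \<delta> F'(1) continuous_intros F;
        use F'w [OF regI [OF _ that]] Fw [OF regI [OF _ that]] in \<open>fastforce simp: abs_le_iff\<close>)+
    moreover have "mollify \<delta> F (P0 \<star> Q) = mollify \<delta> w (P0 \<star> Q)"
      by (rule mollify_cong [OF \<delta> F w]) (use Fw [OF regI [OF _ that]] in auto)
    ultimately show ?thesis unfolding mollify_add_const [OF \<delta> F] by (simp add: abs_le_iff)
  qed
  have VU: "l * (V P - U' P) \<le> Lop J' + C1 * s \<and> Lop J' - C1 * s \<le> l * (V P - U' P)"
    if J': "norm J' \<le> K" "taylor2 V P J' K" for P J'
  proof -
    have "\<bar>avg s V P - V P - s\<^sup>2 * Lop J'\<bar> \<le> 13 * ?B ^ 3 * K * s ^ 3" by (rule avg_consistent [OF J'(2,1) s(1,2)])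
    also have "\<dots> = s\<^sup>2 * (C1 * s)" by (simp add: C1_def power2_eq_square power3_eq_cube)
    finally have "\<bar>s\<^sup>2 * (l * (V P - U' P) - Lop J')\<bar> \<le> s\<^sup>2 * (C1 * s)" unfolding Vres by (simp add: algebra_simps)
    then have "\<bar>l * (V P - U' P) - Lop J'\<bar> \<le> C1 * s" using s by (simp add: abs_mult)
    then show ?thesis by linarith
  qed
  have 3: "\<bar>V (P0 \<star> Q) - U' (P0 \<star> Q)\<bar> \<le> C2 / l" if "Q \<in> ubox" for Q
  proof -
    have "P0 \<star> Q \<in> reg" using regI [OF _ that, of 0] \<delta> by simp
    from T1 [OF v'(1,2) this] obtain J' where J': "norm J' \<le> K" "taylor2 V (P0 \<star> Q) J' K" unfolding V_def by blast
    have "\<bar>Lop J'\<bar> \<le> CL * K" using CL(2) [of J'] mult_left_mono [OF J'(1) CL(1)] by linarith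
    moreover have "C1 * s \<le> C1" using C1 \<open>s \<le> 1\<close> by (simp add: mult_left_le)
    ultimately have "\<bar>l * (V (P0 \<star> Q) - U' (P0 \<star> Q))\<bar> \<le> C2" using VU [OF J'] unfolding C2_def by linarith
    then show ?thesis using l by (simp add: abs_mult pos_le_divide_eq mult.commute)
  qed
  from T1 [OF v'(1,2) zero_reg] obtain J' where J': "norm J' \<le> K" "taylor2 V P0 J' K" unfolding V_def by blast
  \<comment> \<open>\<open>V\<close> and \<open>mollify \<delta> w\<close> are uniformly close near
    \<open>P0\<close> and have expansions with the common constant \<open>K\<close>; an
    interpolation at step \<open>s1\<close> then makes their generators close.\<close>
  have 4: "\<bar>Lop J' - Lop J\<bar> \<le> 2 * (C2 / l + \<omega>) / s1\<^sup>2 + 26 * ?B ^ 3 * K * s1"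
  proof (rule Lop_diff_bound [OF J'(2,1) taylor2_mono [OF T K(3)] K(4) s1(1,2)])
    fix Q assume "Q \<in> ubox"
    then show "\<bar>V (P0 \<star> Q) - mollify \<delta> w (P0 \<star> Q)\<bar> \<le> C2 / l + \<omega>" using 2 3 by (smt (verit))
  qed
  have "0 \<in> ubox" by (simp add: ubox_cube zero_prod_def mem_cube)
  then have 5: "\<bar>U' P0 - mollify \<delta> w P0\<bar> \<le> \<omega>" using 2 [of 0] by simp
  have "Lop J' - C1 * s \<le> l * (V P0 - U' P0)" using VU [OF J'] by simp
  also have "\<dots> \<le> l * (e0 + \<omega>)" using 1 5 l by (intro mult_left_mono) linarith+
  also have "\<dots> = 2 * l * \<omega> + (c + M * \<zeta> + C3 * s)" unfolding e0_def using l by (simp add: field_simps)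
  finally have 6: "Lop J' - c \<le> 2 * l * \<omega> + M * \<zeta> + C3 * s + C1 * s" by linarith
  have "2 * (C2 / l + \<omega>) / s1\<^sup>2 = 2 * (C2 / l) / s1\<^sup>2 + 2 * \<omega> / s1\<^sup>2"
    by (simp add: add_divide_distrib)
  also have "\<dots> \<le> \<kappa> / 16 + \<kappa> / 16" by (intro add_mono l(3) \<omega>(2))
  finally have 7: "2 * (C2 / l + \<omega>) / s1\<^sup>2 \<le> \<kappa> / 16 + \<kappa> / 16" .
  have "26 * ?B ^ 3 * K * s1 = 2 * C1 * s1" by (simp add: C1_def)
  then have "Lop J - Lop J' \<le> \<kappa> / 16 + \<kappa> / 16 + \<kappa> / 16" using 4 7 s1(3) by linarith
  moreover have "Lop J' - c \<le> \<kappa> / 8 + \<kappa> / 8 + \<kappa> / 8 + \<kappa> / 8" using 6 \<omega>(3) \<zeta>(2) s(3,4) by linarith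
  ultimately show False using \<kappa> unfolding \<kappa>_def by argo
qed

end

section \<open>Auxiliary facts for the comparison argument\<close>

text \<open>If a point of the segment were missing, closedness gives a maximal gap around it with
  both ends in \<open>S\<close>; the midpoint of the gap lies in \<open>S\<close>, a
  contradiction.\<close>

lemma closed_midpoint_convex:
  fixes S :: "'a::real_normed_vector set"
  assumes S: "closed S" and mid: "\<And>x y. x \<in> S \<Longrightarrow> y \<in> S \<Longrightarrow> (1 / 2) *\<^sub>R (x + y) \<in> S"
  shows "convex S"
  unfolding convex_alt
proof (intro ballI allI impI, rule ccontr)
  fix x y and u :: real
  assume x: "x \<in> S" and y: "y \<in> S" and u: "0 \<le> u \<and> u \<le> 1" and not: "(1 - u) *\<^sub>R x + u *\<^sub>R y \<notin> S"
  define f where "f s = (1 - s) *\<^sub>R x + s *\<^sub>R y" for s :: real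
  have f: "continuous_on UNIV f" unfolding f_def by (intro continuous_intros)
  have "closed (f -` S)" using closed_vimage [OF S f] .
  then have c: "closed (f -` S \<inter> {0..u})" "closed (f -` S \<inter> {u..1})" by (auto intro: closed_Int)
  have ne: "0 \<in> f -` S \<inter> {0..u}" "1 \<in> f -` S \<inter> {u..1}" using x y u by (auto simp: f_def)
  define a where "a = Sup (f -` S \<inter> {0..u})" define b where "b = Inf (f -` S \<inter> {u..1})"
  have ba: "bdd_above (f -` S \<inter> {0..u})" "bdd_below (f -` S \<inter> {u..1})" by (auto intro: bdd_aboveI2 bdd_belowI2)
  have a: "a \<in> f -` S \<inter> {0..u}" unfolding a_def using ne(1) ba(1) c(1) by (intro closed_contains_Sup) auto
  have b: "b \<in> f -` S \<inter> {u..1}" unfolding b_def using ne(2) ba(2) c(2) by (intro closed_contains_Inf) auto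
  have "f u \<notin> S" using not by (simp add: f_def)
  then have ab: "a < u" "u < b" using a b by (auto simp: less_le)
  have "f ((a + b) / 2) = (1 / 2) *\<^sub>R (f a + f b)"
    unfolding f_def by (simp add: algebra_simps add_divide_distrib diff_divide_distrib flip: scaleR_add_left)
  then have m: "f ((a + b) / 2) \<in> S" using mid a b by auto
  show False
  proof (cases "(a + b) / 2 \<le> u")
    case True
    then have "(a + b) / 2 \<in> f -` S \<inter> {0..u}" using m a ab by auto
    then have "(a + b) / 2 \<le> a" unfolding a_def using ba(1) by (intro cSup_upper)
    then show False using ab by simp
  next
    case False
    then have "(a + b) / 2 \<in> f -` S \<inter> {u..1}" using m b ab by auto
    then have "b \<le> (a + b) / 2" unfolding b_def using ba(2) by (intro cInf_lower)
    then show False using ab by simp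
  qed
qed

text \<open>The hypograph is closed and convex and misses the point at height \<open>e\<close> above
  the graph. A strictly separating hyperplane cannot be vertical, since \<open>(b, \<phi> b)\<close>
  lies directly below that point and on the other side. The slack \<open>e\<close> stands in for an
  exact support of the graph.\<close>

lemma concave_supergradient:
  fixes \<phi> :: "'a::euclidean_space \<Rightarrow> real"
  assumes c: "continuous_on UNIV \<phi>" and mid: "\<And>x y. \<phi> x + \<phi> y \<le> 2 * \<phi> ((1 / 2) *\<^sub>R (x + y))"
    and e: "e > 0"
  obtains a where "\<And>x. \<phi> x \<le> \<phi> b + a \<bullet> (x - b) + e"
proof -
  define S where "S = {z :: 'a \<times> real. snd z \<le> \<phi> (fst z)}"
  have "closed S" unfolding S_def
    by (intro closed_Collect_le continuous_intros continuous_on_compose2 [OF c]) auto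
  moreover have "convex S"
  proof (rule closed_midpoint_convex [OF \<open>closed S\<close>])
    fix x y assume "x \<in> S" "y \<in> S"
    then show "(1 / 2) *\<^sub>R (x + y) \<in> S" using mid [of "fst x" "fst y"] by (simp add: S_def)
  qed
  moreover have "(b, \<phi> b + e) \<notin> S" using e by (simp add: S_def)
  ultimately obtain n k where "n \<bullet> (b, \<phi> b + e) < k" "\<forall>x\<in>S. n \<bullet> x > k"
    using separating_hyperplane_closed_point by blast
  moreover obtain n1 n2 where "n = (n1, n2)" by (cases n) auto
  ultimately have n: "n1 \<bullet> b + n2 * (\<phi> b + e) < k" "\<And>x y. y \<le> \<phi> x \<Longrightarrow> k < n1 \<bullet> x + n2 * y"
    by (auto simp: S_def)
  have "n2 * e < 0" using n(1) n(2) [of "\<phi> b" b] by (simp add: algebra_simps)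
  then have n2: "n2 < 0" using e by (simp add: mult_less_0_iff)
  show thesis
  proof (rule that [of "(1 / (- n2)) *\<^sub>R n1"])
    fix x
    have "n1 \<bullet> b + n2 * (\<phi> b + e) < n1 \<bullet> x + n2 * \<phi> x" using n(1) n(2) [of "\<phi> x" x] by simp
    then have "(- n2) * \<phi> x \<le> (- n2) * (\<phi> b + e) + n1 \<bullet> (x - b)" by (simp add: inner_diff_right)
    then show "\<phi> x \<le> \<phi> b + ((1 / (- n2)) *\<^sub>R n1) \<bullet> (x - b) + e"
      using n2 by (simp add: field_simps)
  qed
qed

text \<open>This is the Cholesky factorization. If the first diagonal entry vanishes, nonnegativity
  forces the off-diagonal entry to vanish too: otherwise the form would take the value -1 at
  \<open>x = - (d + 1) / (2 * b)\<close>, \<open>y = 1\<close>.\<close>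

lemma psd_factorization:
  fixes A :: "real^2^2"
  assumes sym: "transpose A = A" and psd: "\<forall>v. 0 \<le> v \<bullet> (A *v v)"
  obtains p1 p2 q1 q2 where "A$1$1 = p1\<^sup>2 + q1\<^sup>2" "A$1$2 = p1 * p2 + q1 * q2" "A$2$1 = p1 * p2 + q1 * q2"
    "A$2$2 = p2\<^sup>2 + q2\<^sup>2"
proof -
  define a b d where "a = A$1$1" and "b = A$1$2" and "d = A$2$2"
  have b': "A$2$1 = b" using sym unfolding b_def transpose_def by (metis vec_lambda_beta)
  have q: "0 \<le> a * x\<^sup>2 + 2 * b * x * y + d * y\<^sup>2" for x y
  proof -
    have "0 \<le> (vector [x, y] :: real^2) \<bullet> (A *v vector [x, y])" using psd by blast
    also have "\<dots> = a * x\<^sup>2 + 2 * b * x * y + d * y\<^sup>2"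
      by (simp add: inner_vec_def matrix_vector_mult_def sum_2 b' a_def [symmetric] b_def [symmetric] d_def [symmetric])
        (simp add: power2_eq_square algebra_simps)
    finally show ?thesis .
  qed
  have a: "a \<ge> 0" and d: "d \<ge> 0" using q [of 1 0] q [of 0 1] by auto
  show thesis
  proof (cases "a = 0")
    case True
    have "b = 0"
    proof (rule ccontr)
      assume "b \<noteq> 0"
      then have "2 * b * (- (d + 1) / (2 * b)) * 1 + d * 1\<^sup>2 = - 1" by (simp add: field_simps)
      then show False using q [of "- (d + 1) / (2 * b)" 1] True by simp
    qed
    then show thesis using True d b' by (intro that [of 0 0 0 "sqrt d"]) (auto simp: a_def b_def d_def)
  next
    case False
    then have a0: "a > 0" using a by simp
    have "0 \<le> a * (- b / a)\<^sup>2 + 2 * b * (- b / a) * 1 + d * 1\<^sup>2" by (rule q)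
    also have "\<dots> = d - b\<^sup>2 / a" using a0 by (simp add: field_simps power2_eq_square)
    finally have e: "0 \<le> d - b\<^sup>2 / a" .
    show thesis
    proof (rule that [of "sqrt a" 0 "b / sqrt a" "sqrt (d - b\<^sup>2 / a)"])
      show "A$1$1 = (sqrt a)\<^sup>2 + 0\<^sup>2" using a by (simp add: a_def)
      show "A$1$2 = sqrt a * (b / sqrt a) + 0 * sqrt (d - b\<^sup>2 / a)" using a0 by (simp add: b_def)
      show "A$2$1 = sqrt a * (b / sqrt a) + 0 * sqrt (d - b\<^sup>2 / a)" using a0 b' by simp
      show "A$2$2 = (b / sqrt a)\<^sup>2 + (sqrt (d - b\<^sup>2 / a))\<^sup>2"
        using a0 e by (simp add: d_def power_divide)
    qed
  qed
qed

section \<open>The exponential growth barrier\<close>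

definition hbracket :: "pt \<Rightarrow> real" where
  "hbracket P = (case P of (x, y, z, t) \<Rightarrow> jbracket (vector [x, y, z]))"

definition m4 :: "pt \<Rightarrow> real" where
  "m4 = (\<lambda>(x, y, z, t). 1 + x ^ 4 + y ^ 4 + 16 * z\<^sup>2)"

lemma m4_ge_1: "m4 P \<ge> 1"
  by (cases P) (simp add: m4_def)

lemma hbracket_m4: "hbracket P = root 4 (m4 P)"
  by (cases P) (simp add: hbracket_def jbracket_def m4_def)

lemma hbracket_powr: "hbracket P = m4 P powr (1 / 4)"
  using m4_ge_1 [of P] by (simp add: hbracket_m4 root_powr_inverse)

lemma hbracket_pow4: "hbracket P ^ 4 = m4 P"
  using m4_ge_1 [of P] by (simp add: hbracket_m4)

lemma hbracket_ge_1: "hbracket P \<ge> 1"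
  using m4_ge_1 [of P] by (simp add: hbracket_m4)

lemma continuous_on_hbracket [continuous_intros]:
  "continuous_on S f \<Longrightarrow> continuous_on S (\<lambda>x. hbracket (f x))"
  unfolding hbracket_m4 m4_def case_prod_unfold by (intro continuous_intros)

lemma hbracket_components:
  assumes "hbracket (x, y, z, t) \<le> r"
  shows "\<bar>x\<bar> \<le> r" "\<bar>y\<bar> \<le> r" "4 * \<bar>z\<bar> \<le> r\<^sup>2"
proof -
  let ?N = "hbracket (x, y, z, t)"
  have N: "?N ^ 4 = 1 + x ^ 4 + y ^ 4 + 16 * z\<^sup>2" by (simp add: hbracket_pow4 m4_def)
  have N0: "0 \<le> ?N" using hbracket_ge_1 [of "(x, y, z, t)"] by linarith
  have nn: "0 \<le> x ^ 4" "0 \<le> y ^ 4" "0 \<le> z\<^sup>2" by simp_all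
  have "\<bar>x\<bar> ^ 4 \<le> ?N ^ 4" "\<bar>y\<bar> ^ 4 \<le> ?N ^ 4" unfolding N using nn by simp_all
  note this [THEN power_mono_iff [OF abs_ge_zero N0 zero_less_numeral, THEN iffD1]]
  then show "\<bar>x\<bar> \<le> r" "\<bar>y\<bar> \<le> r" using assms by auto
  have "(4 * \<bar>z\<bar>)\<^sup>2 \<le> (?N\<^sup>2)\<^sup>2"
  proof -
    have "(4 * \<bar>z\<bar>)\<^sup>2 = 16 * z\<^sup>2" by (simp add: power_mult_distrib)
    also have "\<dots> \<le> ?N ^ 4" unfolding N using nn by linarith
    finally show ?thesis by (simp flip: power_mult)
  qed
  then have "4 * \<bar>z\<bar> \<le> ?N\<^sup>2" by (rule power2_le_imp_le) simp
  also have "\<dots> \<le> r\<^sup>2" using assms N0 by (intro power_mono)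
  finally show "4 * \<bar>z\<bar> \<le> r\<^sup>2" .
qed

text \<open>A horizontal left translation only multiplies the exponential growth rate by a constant,
  so the translates of the solution can be dominated by the same kind of barrier as the solution.
  The constant bounds the ratio of the fourth powers and is not sharp.\<close>

lemma hbracket_translate:
  obtains C where "C \<ge> 1" "\<And>P. hbracket ((h1, h2, 0, 0) \<star> P) \<le> C * hbracket P"
proof -
  define C where "C = 33 + 8 * h1 ^ 4 + 8 * h2 ^ 4 + 16 * h1\<^sup>2 + 16 * h2\<^sup>2"
  have C: "C \<ge> 1" by (simp add: C_def)
  show thesis
  proof (rule that [OF C])
    fix P :: pt
    obtain x y z t where P: "P = (x, y, z, t)" by (cases P) auto
    have f4: "(u + v) ^ 4 \<le> 8 * u ^ 4 + 8 * v ^ 4" for u v :: real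
    proof -
      have f2: "(a + b)\<^sup>2 \<le> 2 * a\<^sup>2 + 2 * b\<^sup>2" for a b :: real
        using zero_le_power2 [of "a - b"] by (simp add: power2_eq_square algebra_simps)
      have "(u + v) ^ 4 = ((u + v)\<^sup>2)\<^sup>2" by simp
      also have "\<dots> \<le> (2 * u\<^sup>2 + 2 * v\<^sup>2)\<^sup>2" by (intro power_mono f2) auto
      also have "\<dots> \<le> 2 * (2 * u\<^sup>2)\<^sup>2 + 2 * (2 * v\<^sup>2)\<^sup>2" by (rule f2)
      finally show ?thesis by simp
    qed
    have z: "16 * (z + (h1 * y - x * h2) / 2)\<^sup>2 \<le> 32 * z\<^sup>2 + 16 * (h1\<^sup>2 * y\<^sup>2) + 16 * (h2\<^sup>2 * x\<^sup>2)"
    proof -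
      have "0 \<le> 16 * (z - (h1 * y - x * h2) / 2)\<^sup>2 + 8 * (h1 * y + x * h2)\<^sup>2" by simp
      then show ?thesis by (simp add: power2_eq_square field_simps)
    qed
    have sq: "u\<^sup>2 \<le> 1 + u ^ 4" for u :: real
    proof -
      have "2 * u\<^sup>2 \<le> 1 + u ^ 4" using zero_le_power2 [of "u\<^sup>2 - 1"] by (simp add: power2_diff)
      then show ?thesis using zero_le_power2 [of u] by linarith
    qed
    have xy: "h1\<^sup>2 * y\<^sup>2 \<le> h1\<^sup>2 * m4 P" "h2\<^sup>2 * x\<^sup>2 \<le> h2\<^sup>2 * m4 P"
    proof -
      have nn: "0 \<le> x ^ 4" "0 \<le> y ^ 4" "0 \<le> z\<^sup>2" by simp_all
      have "x\<^sup>2 \<le> m4 P" "y\<^sup>2 \<le> m4 P"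
        using sq [of x] sq [of y] nn unfolding m4_def P prod.case by linarith+
      then show "h1\<^sup>2 * y\<^sup>2 \<le> h1\<^sup>2 * m4 P" "h2\<^sup>2 * x\<^sup>2 \<le> h2\<^sup>2 * m4 P"
        by (auto intro: mult_left_mono)
    qed
    have hm: "h1 ^ 4 \<le> h1 ^ 4 * m4 P" "h2 ^ 4 \<le> h2 ^ 4 * m4 P"
      using m4_ge_1 [of P] by (simp_all add: mult_le_cancel_left1)
    have "m4 ((h1, h2, 0, 0) \<star> P) = 1 + (h1 + x) ^ 4 + (h2 + y) ^ 4 + 16 * (z + (h1 * y - x * h2) / 2)\<^sup>2"
      by (simp add: P m4_def)
    also have "\<dots> \<le> 1 + (8 * h1 ^ 4 + 8 * x ^ 4) + (8 * h2 ^ 4 + 8 * y ^ 4) + (32 * z\<^sup>2 + 16 * (h1\<^sup>2 * y\<^sup>2) + 16 * (h2\<^sup>2 * x\<^sup>2))"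
      by (intro add_mono f4 z order_refl)
    also have "\<dots> \<le> 8 * m4 P + 8 * (h1 ^ 4 * m4 P) + 8 * (h2 ^ 4 * m4 P) + 16 * (h1\<^sup>2 * m4 P) + 16 * (h2\<^sup>2 * m4 P)"
    proof -
      have "8 * m4 P = 8 + 8 * x ^ 4 + 8 * y ^ 4 + 128 * z\<^sup>2" by (simp add: m4_def P)
      then show ?thesis using xy hm zero_le_power2 [of z] by linarith
    qed
    also have "\<dots> = (C - 25) * m4 P" by (simp add: C_def algebra_simps)
    also have "\<dots> \<le> C ^ 4 * m4 P"
    proof (intro mult_right_mono)
      show "C - 25 \<le> C ^ 4" using self_le_power [OF C, of 4] by linarith
    qed (use m4_ge_1 [of P] in linarith)
    finally have "hbracket ((h1, h2, 0, 0) \<star> P) ^ 4 \<le> (C * hbracket P) ^ 4"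
      unfolding power_mult_distrib hbracket_pow4 .
    moreover have "0 \<le> C * hbracket P" using C hbracket_ge_1 [of P] by (intro mult_nonneg_nonneg) auto
    moreover have "0 \<le> hbracket ((h1, h2, 0, 0) \<star> P)" using hbracket_ge_1 by (rule order_trans [rotated]) simp
    ultimately show "hbracket ((h1, h2, 0, 0) \<star> P) \<le> C * hbracket P"
      by (simp add: power_mono_iff)
  qed
qed

lemma jet_at_m4: "jet_at m4 (X, Y, Z, T) (0, (4 * X ^ 3 - 16 * Y * Z, 4 * Y ^ 3 + 16 * X * Z), 32 * Z,
    (12 * X\<^sup>2 + 8 * Y\<^sup>2, - 8 * X * Y, 12 * Y\<^sup>2 + 8 * X\<^sup>2))"
proof -
  let ?S = "(X, Y, Z, T) :: pt"
  define cx cy cz :: "pt \<Rightarrow> real"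
    where "cx = (\<lambda>(x, y, z, t). x)" and "cy = (\<lambda>(x, y, z, t). y)" and "cz = (\<lambda>(x, y, z, t). z)"
  note c = jet_at_coords [of X Y Z T, folded cx_def cy_def cz_def]
  have v: "cx ?S = X" "cy ?S = Y" "cz ?S = Z" by (auto simp: cx_def cy_def cz_def)
  have "jet_at (\<lambda>Q. 1 + cx Q ^ 4 + cy Q ^ 4 + 16 * (cz Q)\<^sup>2) ?S
     (0 + jcomp (4 * X ^ 3) (12 * X\<^sup>2) (0, (1, 0), 0, (0, 0, 0)) + jcomp (4 * Y ^ 3) (12 * Y\<^sup>2) (0, (0, 1), 0, (0, 0, 0))
      + 16 *\<^sub>R jcomp (2 * Z) 2 (0, (- Y / 2, X / 2), 1, (0, 0, 0)))"
    by (intro jet_at_add jet_at_cmul jet_at_const jet_at_pow4 [OF c(1), unfolded v] jet_at_pow4 [OF c(2), unfolded v]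
        jet_at_square [OF c(3), unfolded v])
  moreover have "(\<lambda>Q. 1 + cx Q ^ 4 + cy Q ^ 4 + 16 * (cz Q)\<^sup>2) = m4"
    by (auto simp: fun_eq_iff m4_def cx_def cy_def cz_def)
  moreover have "0 + jcomp (4 * X ^ 3) (12 * X\<^sup>2) (0, (1, 0), 0, (0, 0, 0)) + jcomp (4 * Y ^ 3) (12 * Y\<^sup>2) (0, (0, 1), 0, (0, 0, 0))
      + 16 *\<^sub>R jcomp (2 * Z) 2 (0, (- Y / 2, X / 2), 1, (0, 0, 0))
    = (0, (4 * X ^ 3 - 16 * Y * Z, 4 * Y ^ 3 + 16 * X * Z), 32 * Z, (12 * X\<^sup>2 + 8 * Y\<^sup>2, - 8 * X * Y, 12 * Y\<^sup>2 + 8 * X\<^sup>2))"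
    by (simp add: zero_prod_def power2_eq_square)
  ultimately show ?thesis by metis
qed

text \<open>With \<open>N\<close> the bracket at \<open>P\<close>, the coordinates are of order
  \<open>N\<close>, \<open>N\<close> and \<open>N\<^sup>2\<close>, hence the horizontal gradient of
  \<open>m4\<close> is at most \<open>8 * N ^ 3\<close> and its Hessian at most
  \<open>20 * N\<^sup>2\<close>. The derivatives of the fourth root carry \<open>N ^ 3\<close> and
  \<open>N ^ 7\<close> in the denominator and, as \<open>N \<ge> 1\<close>, all powers cancel:
  \<open>2 = 8 / 4\<close> and \<open>17 = 20 / 4 + 64 * 3 / 16\<close>.\<close>

lemma hbracket_jet:
  obtains b1 b2 c m11 m12 m22 where "jet_at hbracket P (0, (b1, b2), c, (m11, m12, m22))"
    "\<bar>b1\<bar> \<le> 2" "\<bar>b2\<bar> \<le> 2" "\<bar>m11\<bar> \<le> 17" "\<bar>m12\<bar> \<le> 17" "\<bar>m22\<bar> \<le> 17"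
proof -
  obtain X Y Z T where P: "P = (X, Y, Z, T)" by (cases P) auto
  define N where "N = hbracket P"
  have N: "N \<ge> 1" unfolding N_def by (rule hbracket_ge_1)
  have m: "m4 P > 0" using m4_ge_1 [of P] by linarith
  note XYZ = hbracket_components [where x = X and y = Y and z = Z and t = T, OF order_refl, folded P N_def]
  have Np: "m4 P powr (k / 4) = N powr k" for k
    unfolding N_def hbracket_powr using m by (simp add: powr_powr)
  have N3: "m4 P powr (1 / 4 - 1) = 1 / N ^ 3"
  proof -
    have "m4 P powr (1 / 4 - 1) = N powr (- 3)" using Np [of "- 3"] by simp
    also have "\<dots> = 1 / N ^ 3" using N by (simp add: powr_minus_divide powr_numeral)
    finally show ?thesis .
  qed
  have N7: "m4 P powr (1 / 4 - 1 - 1) = 1 / N ^ 7"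
  proof -
    have "m4 P powr (1 / 4 - 1 - 1) = N powr (- 7)" using Np [of "- 7"] by simp
    also have "\<dots> = 1 / N ^ 7" using N by (simp add: powr_minus_divide powr_numeral)
    finally show ?thesis .
  qed
  let ?f' = "\<lambda>s::real. 1 / 4 * s powr (1 / 4 - 1)"
  have ev: "\<forall>\<^sub>F s in nhds (m4 P). ((\<lambda>s. s powr (1 / 4)) has_real_derivative ?f' s) (at s)"
  proof -
    have "\<forall>\<^sub>F s in nhds (m4 P). s \<in> {0<..}" using m by (intro eventually_nhds_in_open) auto
    then show ?thesis by eventually_elim (rule has_real_derivative_powr, simp)
  qed
  have f2: "(?f' has_real_derivative (1 / 4 * ((1 / 4 - 1) * m4 P powr (1 / 4 - 1 - 1)))) (at (m4 P))"
    using m by (intro DERIV_cmult has_real_derivative_powr)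
  define d1 d2 where "d1 = 1 / (4 * N ^ 3)" and "d2 = - 3 / (16 * N ^ 7)"
  define B1 B2 where "B1 = 4 * X ^ 3 - 16 * Y * Z" and "B2 = 4 * Y ^ 3 + 16 * X * Z"
  have j0: "jet_at (\<lambda>Q. m4 Q powr (1 / 4)) P (jcomp (1 / 4 * (1 / N ^ 3)) (1 / 4 * ((1 / 4 - 1) * (1 / N ^ 7)))
      (0, (B1, B2), 32 * Z, (12 * X\<^sup>2 + 8 * Y\<^sup>2, - 8 * X * Y, 12 * Y\<^sup>2 + 8 * X\<^sup>2)))"
    using jet_at_comp [OF jet_at_m4 [of X Y Z T, folded P] ev f2] unfolding N3 N7 B1_def B2_def .
  have d12: "1 / 4 * (1 / N ^ 3) = d1" "1 / 4 * ((1 / 4 - 1) * (1 / N ^ 7)) = d2" by (auto simp: d1_def d2_def)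
  have j: "jet_at hbracket P (0, (d1 * B1, d1 * B2), d1 * (32 * Z),
      (d1 * (12 * X\<^sup>2 + 8 * Y\<^sup>2) + d2 * B1\<^sup>2, d1 * (- 8 * X * Y) + d2 * B1 * B2, d1 * (12 * Y\<^sup>2 + 8 * X\<^sup>2) + d2 * B2\<^sup>2))"
    using j0 unfolding hbracket_powr [abs_def] d12 jcomp_simp by (simp only: mult_zero_right)
  have d1: "0 < d1" "d1 * N ^ 3 = 1 / 4" using N by (auto simp: d1_def)
  have d2: "\<bar>d2\<bar> * N ^ 7 = 3 / 16" using N by (auto simp: d2_def abs_mult)
  have c3: "\<bar>u ^ 3\<bar> \<le> N ^ 3" if "\<bar>u\<bar> \<le> N" for u using power_mono [OF that abs_ge_zero, of 3] by (simp add: power_abs)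
  have z: "\<bar>Z\<bar> \<le> N\<^sup>2 / 4" using XYZ(3) by linarith
  have uz: "\<bar>u * Z\<bar> \<le> N ^ 3 / 4" if "\<bar>u\<bar> \<le> N" for u
    using abs_mult_le [OF that z] by (simp add: power3_eq_cube power2_eq_square)
  have B: "\<bar>B1\<bar> \<le> 8 * N ^ 3" "\<bar>B2\<bar> \<le> 8 * N ^ 3"
    unfolding B1_def B2_def using c3 [OF XYZ(1)] c3 [OF XYZ(2)] uz [OF XYZ(1)] uz [OF XYZ(2)] unfolding mult.assoc by linarith+
  have dB: "\<bar>d1 * b\<bar> \<le> 2" if "\<bar>b\<bar> \<le> 8 * N ^ 3" for b
  proof -
    have "\<bar>d1 * b\<bar> \<le> d1 * (8 * N ^ 3)" using d1 that by (simp add: abs_mult)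
    then show ?thesis using d1 by simp
  qed
  have sq: "\<bar>a * b\<bar> \<le> N\<^sup>2" if "\<bar>a\<bar> \<le> N" "\<bar>b\<bar> \<le> N" for a b
    using abs_mult_le [OF that] by (simp add: power2_eq_square)
  have N23: "N\<^sup>2 \<le> N ^ 3" using N by (intro power_increasing) auto
  have M: "\<bar>d1 * k + d2 * b * b'\<bar> \<le> 17" if "\<bar>k\<bar> \<le> 20 * N\<^sup>2" "\<bar>b\<bar> \<le> 8 * N ^ 3" "\<bar>b'\<bar> \<le> 8 * N ^ 3" for k b b'
  proof -
    have "\<bar>d1 * k\<bar> \<le> d1 * (20 * N ^ 3)" using d1 that(1) N23 by (simp add: abs_mult)
    then have 1: "\<bar>d1 * k\<bar> \<le> 5" using d1 by simp
    have "\<bar>b * b'\<bar> \<le> (8 * N ^ 3) * (8 * N ^ 3)" using that by (intro abs_mult_le)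
    also have "\<dots> = 64 * N ^ 6" by (simp flip: power_add)
    also have "\<dots> \<le> 64 * N ^ 7" using N by (intro mult_left_mono power_increasing) auto
    finally have "\<bar>d2\<bar> * \<bar>b * b'\<bar> \<le> \<bar>d2\<bar> * (64 * N ^ 7)" by (intro mult_left_mono) auto
    then have 2: "\<bar>d2 * b * b'\<bar> \<le> 12" using d2 by (simp add: abs_mult mult.assoc)
    show ?thesis using 1 2 by linarith
  qed
  show thesis
  proof (rule that [OF j])
    show "\<bar>d1 * B1\<bar> \<le> 2" "\<bar>d1 * B2\<bar> \<le> 2" using dB B by auto
    have s: "\<bar>X * X\<bar> \<le> N\<^sup>2" "\<bar>Y * Y\<bar> \<le> N\<^sup>2" "\<bar>X * Y\<bar> \<le> N\<^sup>2"
      by (intro sq XYZ)+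
    have k: "\<bar>12 * X\<^sup>2 + 8 * Y\<^sup>2\<bar> \<le> 20 * N\<^sup>2" "\<bar>12 * Y\<^sup>2 + 8 * X\<^sup>2\<bar> \<le> 20 * N\<^sup>2"
      using s(1,2) unfolding power2_eq_square [of X] power2_eq_square [of Y] by linarith+
    have k': "\<bar>- 8 * X * Y\<bar> \<le> 20 * N\<^sup>2" using s(3) unfolding mult.assoc by linarith
    show "\<bar>d1 * (12 * X\<^sup>2 + 8 * Y\<^sup>2) + d2 * B1\<^sup>2\<bar> \<le> 17"
      using M [OF k(1) B(1) B(1)] by (simp only: power2_eq_square [of B1] mult.assoc)
    show "\<bar>d1 * (- 8 * X * Y) + d2 * B1 * B2\<bar> \<le> 17" by (rule M [OF k' B])
    show "\<bar>d1 * (12 * Y\<^sup>2 + 8 * X\<^sup>2) + d2 * B2\<^sup>2\<bar> \<le> 17"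
      using M [OF k(2) B(2) B(2)] by (simp only: power2_eq_square [of B2] mult.assoc)
  qed
qed

text \<open>The exponential part overtakes the growth of the solution at spatial infinity. The other
  part blows up at time \<open>T\<close>, which keeps maximum points away from the final time, and
  its time derivative supplies a strict inequality.\<close>

definition growth_barrier :: "real \<Rightarrow> real \<Rightarrow> real \<Rightarrow> real \<Rightarrow> real \<Rightarrow> pt \<Rightarrow> real" where
  "growth_barrier k \<Lambda> \<epsilon> \<eta> T P = \<epsilon> * exp (k * hbracket P + \<Lambda> * snd (snd (snd P))) + \<eta> / (T - snd (snd (snd P)))"

text \<open>All derivatives of the exponential are multiples of its value \<open>G\<close>, with
  factors bounded through \<open>hbracket_jet\<close>. A rate \<Lambda> independent of \<epsilon>,
  \<eta> and \<open>T\<close> thus outweighs the diffusion and a gradient term with Lipschitz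
  constant \<open>L\<close>, and the time derivative of the second summand is left over as the
  margin.\<close>

lemma growth_barrier_jet:
  fixes A11 A12 A22 L k :: real
  assumes k: "k > 0" and L: "L \<ge> 0"
  obtains \<Lambda> where "\<Lambda> > 0" "\<And>\<epsilon> \<eta> T x y z t. \<epsilon> > 0 \<Longrightarrow> t < T \<Longrightarrow>
    \<exists>\<alpha> b1 b2 c m11 m12 m22. jet_at (growth_barrier k \<Lambda> \<epsilon> \<eta> T) (x, y, z, t) (\<alpha>, (b1, b2), c, (m11, m12, m22)) \<and>
      \<eta> / (T - t)\<^sup>2 \<le> \<alpha> - (A11 * m11 + 2 * A12 * m12 + A22 * m22) - L * (\<bar>b1\<bar> + \<bar>b2\<bar>)"
proof -
  define D where "D = 17 * k + 4 * k\<^sup>2"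
  have D: "D \<ge> 0" using k by (simp add: D_def)
  define \<Lambda> where "\<Lambda> = (\<bar>A11\<bar> + 2 * \<bar>A12\<bar> + \<bar>A22\<bar>) * D + 4 * k * L + 1"
  have \<Lambda>: "\<Lambda> > 0" using k L D unfolding \<Lambda>_def by (intro add_nonneg_pos add_nonneg_nonneg mult_nonneg_nonneg) auto
  show thesis
  proof (rule that [OF \<Lambda>])
    fix \<epsilon> \<eta> T x y z t :: real assume \<epsilon>: "\<epsilon> > 0" and t: "t < T"
    define P where "P = (x, y, z, t)"
    obtain b1 b2 c m11 m12 m22 where j: "jet_at hbracket P (0, (b1, b2), c, (m11, m12, m22))"
      and b: "\<bar>b1\<bar> \<le> 2" "\<bar>b2\<bar> \<le> 2" and m: "\<bar>m11\<bar> \<le> 17" "\<bar>m12\<bar> \<le> 17" "\<bar>m22\<bar> \<le> 17" using hbracket_jet .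
    define ct :: "pt \<Rightarrow> real" where "ct = (\<lambda>(x, y, z, t). t)"
    have ct: "jet_at ct P (1, (0, 0), 0, (0, 0, 0))" "ct P = t" unfolding ct_def P_def by (rule jet_at_coords, simp)
    have cts: "snd (snd (snd Q)) = ct Q" for Q :: pt by (cases Q) (simp add: ct_def)
    define F where "F Q = k * hbracket Q + \<Lambda> * ct Q" for Q
    define G where "G = \<epsilon> * exp (F P)"
    have G: "G > 0" using \<epsilon> by (simp add: G_def)
    have jF: "jet_at F P (k *\<^sub>R (0, (b1, b2), c, (m11, m12, m22)) + \<Lambda> *\<^sub>R (1, (0, 0), 0, (0, 0, 0)))"
      unfolding F_def by (intro jet_at_add jet_at_cmul j ct)
    have je: "jet_at (\<lambda>Q. exp (F Q)) P (jcomp (exp (F P)) (exp (F P)) (k *\<^sub>R (0, (b1, b2), c, (m11, m12, m22)) + \<Lambda> *\<^sub>R (1, (0, 0), 0, (0, 0, 0))))"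
      by (rule jet_at_comp [OF jF, where f = exp and f' = exp]) (auto intro!: always_eventually DERIV_exp)
    have ev: "\<forall>\<^sub>F s in nhds (ct P). ((\<lambda>s. \<eta> / (T - s)) has_real_derivative \<eta> / (T - s)\<^sup>2) (at s)"
    proof -
      have "\<forall>\<^sub>F s in nhds (ct P). s \<in> {..<T}" using t ct(2) by (intro eventually_nhds_in_open) auto
      then show ?thesis
        by eventually_elim (auto intro!: derivative_eq_intros simp: power2_eq_square field_simps)
    qed
    have d3: "- (\<eta> * (- 2 * d)) / (d\<^sup>2)\<^sup>2 = 2 * \<eta> / d ^ 3" if "d \<noteq> 0" for d
      using that by (simp add: field_simps power2_eq_square power3_eq_cube)
    have "((\<lambda>s. \<eta> / (T - s)\<^sup>2) has_real_derivative - (\<eta> * (- 2 * (T - t))) / ((T - t)\<^sup>2)\<^sup>2) (at t)"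
      using t by (auto intro!: derivative_eq_intros simp: power2_eq_square)
    then have "((\<lambda>s. \<eta> / (T - s)\<^sup>2) has_real_derivative 2 * \<eta> / (T - t) ^ 3) (at (ct P))"
      unfolding ct(2) using t by (subst (asm) d3) auto
    note jt = jet_at_comp [OF ct(1) ev this]
    have "jet_at (\<lambda>Q. \<epsilon> * exp (F Q) + \<eta> / (T - ct Q)) P
      (\<epsilon> *\<^sub>R jcomp (exp (F P)) (exp (F P)) (k *\<^sub>R (0, (b1, b2), c, (m11, m12, m22)) + \<Lambda> *\<^sub>R (1, (0, 0), 0, (0, 0, 0)))
       + jcomp (\<eta> / (T - ct P)\<^sup>2) (2 * \<eta> / (T - t) ^ 3) (1, (0, 0), 0, (0, 0, 0)))"
      by (intro jet_at_add jet_at_cmul je jt)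
    moreover have "(\<lambda>Q. \<epsilon> * exp (F Q) + \<eta> / (T - ct Q)) = growth_barrier k \<Lambda> \<epsilon> \<eta> T"
      by (auto simp: fun_eq_iff growth_barrier_def F_def ct_def)
    moreover define M11 M12 M22 where "M11 = k * m11 + k\<^sup>2 * (b1 * b1)" and "M12 = k * m12 + k\<^sup>2 * (b1 * b2)"
      and "M22 = k * m22 + k\<^sup>2 * (b2 * b2)"
    moreover have "\<epsilon> *\<^sub>R jcomp (exp (F P)) (exp (F P)) (k *\<^sub>R (0, (b1, b2), c, (m11, m12, m22)) + \<Lambda> *\<^sub>R (1, (0, 0), 0, (0, 0, 0)))
       + jcomp (\<eta> / (T - ct P)\<^sup>2) (2 * \<eta> / (T - t) ^ 3) (1, (0, 0), 0, (0, 0, 0))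
       = (G * \<Lambda> + \<eta> / (T - t)\<^sup>2, (G * (k * b1), G * (k * b2)), G * (k * c), (G * M11, G * M12, G * M22))"
      by (simp add: G_def ct(2) M11_def M12_def M22_def) (simp add: power2_eq_square algebra_simps)
    ultimately have J: "jet_at (growth_barrier k \<Lambda> \<epsilon> \<eta> T) P
       (G * \<Lambda> + \<eta> / (T - t)\<^sup>2, (G * (k * b1), G * (k * b2)), G * (k * c), (G * M11, G * M12, G * M22))" by metis
    have bb: "\<bar>b * b'\<bar> \<le> 4" if "\<bar>b\<bar> \<le> 2" "\<bar>b'\<bar> \<le> 2" for b b' :: real using abs_mult_le [OF that] by simp
    have MD: "\<bar>k * m + k\<^sup>2 * q\<bar> \<le> D" if "\<bar>m\<bar> \<le> 17" "\<bar>q\<bar> \<le> 4" for m q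
    proof -
      have "\<bar>k * m\<bar> \<le> k * 17" "\<bar>k\<^sup>2 * q\<bar> \<le> k\<^sup>2 * 4" using k that by (auto intro!: abs_mult_le)
      then show ?thesis unfolding D_def by linarith
    qed
    have Mb: "\<bar>M11\<bar> \<le> D" "\<bar>M12\<bar> \<le> D" "\<bar>M22\<bar> \<le> D" unfolding M11_def M12_def M22_def by (intro MD m bb b)+
    have AM: "A11 * M11 + 2 * A12 * M12 + A22 * M22 \<le> (\<bar>A11\<bar> + 2 * \<bar>A12\<bar> + \<bar>A22\<bar>) * D"
    proof -
      have "a * M \<le> \<bar>a\<bar> * D" if "\<bar>M\<bar> \<le> D" for a M using abs_mult_le [OF order_refl [of "\<bar>a\<bar>"] that] by linarith
      from this [OF Mb(1), of A11] this [OF Mb(2), of "2 * A12"] this [OF Mb(3), of A22]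
      show ?thesis by (simp add: distrib_right abs_mult)
    qed
    have kb: "L * (\<bar>k * b1\<bar> + \<bar>k * b2\<bar>) \<le> 4 * k * L"
    proof -
      have "\<bar>k * b1\<bar> + \<bar>k * b2\<bar> \<le> k * 2 + k * 2" using k b by (intro add_mono abs_mult_le) auto
      then have "L * (\<bar>k * b1\<bar> + \<bar>k * b2\<bar>) \<le> L * (k * 2 + k * 2)" using L by (intro mult_left_mono)
      then show ?thesis by (simp add: algebra_simps)
    qed
    have "0 \<le> \<Lambda> - (A11 * M11 + 2 * A12 * M12 + A22 * M22) - L * (\<bar>k * b1\<bar> + \<bar>k * b2\<bar>)" using AM kb unfolding \<Lambda>_def by linarith
    then have "0 \<le> G * (\<Lambda> - (A11 * M11 + 2 * A12 * M12 + A22 * M22) - L * (\<bar>k * b1\<bar> + \<bar>k * b2\<bar>))" using G by simp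
    also have "\<dots> = G * \<Lambda> - (A11 * (G * M11) + 2 * A12 * (G * M12) + A22 * (G * M22)) - L * (\<bar>G * (k * b1)\<bar> + \<bar>G * (k * b2)\<bar>)"
      using G by (simp add: abs_mult algebra_simps)
    finally show "\<exists>\<alpha> b1 b2 c m11 m12 m22. jet_at (growth_barrier k \<Lambda> \<epsilon> \<eta> T) (x, y, z, t) (\<alpha>, (b1, b2), c, (m11, m12, m22)) \<and>
      \<eta> / (T - t)\<^sup>2 \<le> \<alpha> - (A11 * m11 + 2 * A12 * m12 + A22 * m22) - L * (\<bar>b1\<bar> + \<bar>b2\<bar>)"
      using J unfolding P_def by (intro exI conjI) (assumption, simp)
  qed
qed

text \<open>For an expansion at one point only the values of \<open>F\<close> on a compact set
  matter, so \<open>F\<close> may be clamped to a bounded function and the uniform statement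
  applied.\<close>

lemma mollify_taylor2_exists:
  assumes \<delta>: "\<delta> > 0" and F: "continuous_on UNIV F"
  obtains J K where "taylor2 (mollify \<delta> F) P J K"
proof -
  define reg where "reg = (\<lambda>(g, Q). g \<star> (P \<star> Q)) ` (cball 0 \<delta> \<times> cube 1)"
  have reg: "compact reg" unfolding reg_def case_prod_unfold
    by (intro compact_continuous_image compact_Times compact_cube continuous_intros) auto
  have regI: "g \<star> (P \<star> Q) \<in> reg" if "norm g \<le> \<delta>" "Q \<in> ubox" for g Q
    unfolding reg_def using that by (auto simp: ubox_cube intro!: image_eqI [where x = "(g, Q)"])
  obtain b where b: "reg \<subseteq> cbox (- b) b" using bounded_subset_cbox_symmetric [OF compact_imp_bounded [OF reg]] .
  define G where "G = ext_cont F (- b) b"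
  have G: "continuous_on UNIV G" unfolding G_def
    by (intro continuous_on_ext_cont continuous_on_subset [OF F]) auto
  have GF: "G P = F P" if "P \<in> reg" for P using that b by (auto simp: G_def)
  have z: "0 \<in> ubox" by (simp add: ubox_cube zero_prod_def mem_cube)
  then have "P \<in> reg" using regI [of 0 0] \<delta> by simp
  then have ne: "cbox (- b) b \<noteq> {}" using b by blast
  have "compact (F ` cbox (- b) b)" by (intro compact_continuous_image continuous_on_subset [OF F]) auto
  from compact_imp_bounded [OF this] obtain M where M': "\<And>P. P \<in> cbox (- b) b \<Longrightarrow> \<bar>F P\<bar> \<le> M"
    unfolding bounded_iff by auto
  have M: "\<bar>G P\<bar> \<le> M" for P
    unfolding G_def ext_cont_def using ne by (intro M' clamp_in_interval) (simp add: box_ne_empty)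
  have M0: "M \<ge> 0" using M [of 0] by linarith
  obtain X Y Z T where P: "P = (X, Y, Z, T)" by (cases P) auto
  have R: "\<bar>X\<bar> + \<bar>Y\<bar> \<ge> 0" by simp
  obtain K where K: "\<And>F X' Y' Z T. continuous_on UNIV F \<Longrightarrow> (\<And>P. \<bar>F P\<bar> \<le> M) \<Longrightarrow> \<bar>X'\<bar> \<le> \<bar>X\<bar> + \<bar>Y\<bar> \<Longrightarrow> \<bar>Y'\<bar> \<le> \<bar>X\<bar> + \<bar>Y\<bar>
    \<Longrightarrow> \<exists>J. norm J \<le> K \<and> taylor2 (mollify \<delta> F) (X', Y', Z, T) J K"
    using mollify_taylor2 [OF \<delta> R M0] by metis
  from K [of G X Y Z T] G M obtain J where J: "taylor2 (mollify \<delta> G) P J K" unfolding P by auto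
  have eq: "mollify \<delta> G (P \<star> Q) = mollify \<delta> F (P \<star> Q)" if "Q \<in> ubox" for Q
    by (rule mollify_cong [OF \<delta> G F]) (use GF [OF regI [OF _ that]] in auto)
  have "taylor2 (mollify \<delta> F) P J K"
    using J eq eq [OF z] unfolding taylor2_def by simp
  then show thesis by (rule that)
qed

section \<open>Projections to space and time\<close>

definition sp :: "pt \<Rightarrow> real^3" where
  "sp P = (case P of (x, y, z, t) \<Rightarrow> vector [x, y, z])"

definition tm :: "pt \<Rightarrow> real" where
  "tm P = (case P of (x, y, z, t) \<Rightarrow> t)"

lemma sp_simp [simp]: "sp (x, y, z, t) = vector [x, y, z]" by (simp add: sp_def)
lemma tm_simp [simp]: "tm (x, y, z, t) = t" by (simp add: tm_def)

lemma sp_gmul: "sp (P \<star> Q) = sp P \<odot> sp Q"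
  by (cases P; cases Q) (simp add: hmult_def)

lemma sp_ginv: "sp (ginv P) = hinv (sp P)"
  by (cases P) (simp add: hinv_def)

lemma tm_gmul [simp]: "tm (P \<star> Q) = tm P + tm Q"
  by (cases P; cases Q) simp

lemma continuous_on_sp [continuous_intros]:
  assumes "continuous_on S f" shows "continuous_on S (\<lambda>x. sp (f x))"
proof -
  have "sp P = (\<chi> i. if i = 1 then fst P else if i = 2 then fst (snd P) else fst (snd (snd P)))" for P
    by (cases P) (simp add: vec_eq_iff forall_3)
  moreover have "continuous_on S (\<lambda>x. (\<chi> i. if i = 1 then fst (f x) else if i = 2 then fst (snd (f x)) else fst (snd (snd (f x)))) :: real^3)"
  proof (intro continuous_on_vec_lambda)
    fix i :: 3
    show "continuous_on S (\<lambda>x. if i = 1 then fst (f x) else if i = 2 then fst (snd (f x)) else fst (snd (snd (f x))))"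
      using assms by (cases "i = 1"; cases "i = 2") (auto intro!: continuous_intros)
  qed
  ultimately show ?thesis by simp
qed

lemma continuous_on_tm [continuous_intros]:
  "continuous_on S f \<Longrightarrow> continuous_on S (\<lambda>x. tm (f x))"
  unfolding tm_def case_prod_unfold by (intro continuous_intros)

lemma continuous_on_koranyi_gauge [continuous_intros]:
  "continuous_on S f \<Longrightarrow> continuous_on S (\<lambda>x. koranyi_gauge (f x))"
  unfolding koranyi_gauge_def by (intro continuous_intros)

lemma superjet_cong:
  assumes "superjet F P J" "\<forall>\<^sub>F Q in nhds 0. G (P \<star> Q) = F (P \<star> Q)" "G P = F P"
  shows "superjet G P J"
  unfolding superjet_def
proof (intro allI impI)
  fix \<eta> :: real assume "\<eta> > 0"
  then obtain K where "\<forall>\<^sub>F Q in nhds 0. F (P \<star> Q) \<le> F P + jeval J Q + \<eta> * sqh Q + K * sqv Q"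
    using assms(1) unfolding superjet_def by blast
  with assms(2) have "\<forall>\<^sub>F Q in nhds 0. G (P \<star> Q) \<le> G P + jeval J Q + \<eta> * sqh Q + K * sqv Q"
    by eventually_elim (simp add: assms(3))
  then show "\<exists>K. \<forall>\<^sub>F Q in nhds 0. G (P \<star> Q) \<le> G P + jeval J Q + \<eta> * sqh Q + K * sqv Q" ..
qed

lemma eventually_gmul_continuous:
  fixes f :: "pt \<Rightarrow> real"
  assumes "continuous_on UNIV f" "a < f S" shows "\<forall>\<^sub>F Q in nhds 0. a < f (S \<star> Q)"
proof -
  have "open {P. a < f P}" using assms(1) by (intro open_Collect_less continuous_intros)
  from eventually_gmul [OF this] show ?thesis using assms(2) by simp
qed

section \<open>Supersolution property of the mollified solution\<close>

locale viscosity_problem =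
  fixes A :: "real^2^2"
    and f :: "real^3 \<Rightarrow> real^2 \<Rightarrow> real"
    and u :: "(real^3) \<times> real \<Rightarrow> real"
  assumes A_sym: "transpose A = A"
    and A_psd: "\<forall>v. 0 \<le> v \<bullet> (A *v v)"
    and A1: "\<exists>L1>0. \<forall>p w1 w2. \<bar>f p w1 - f p w2\<bar> \<le> L1 * norm (w1 - w2)"
    and A2: "\<forall>\<rho>>0. \<exists>L2>0. \<forall>p q w. norm p \<le> \<rho> \<and> norm q \<le> \<rho> \<longrightarrow>
               \<bar>f p w - f q w\<bar> \<le> L2 * koranyi_gauge (p \<odot> hinv q)"
    and concavity: "\<forall>p. \<forall>h\<in>horizontal. \<forall>\<xi> \<eta>.
               f (hinv h \<odot> p) \<xi> + f (h \<odot> p) \<eta> \<le> 2 * f p ((1/2) *\<^sub>R (\<xi> + \<eta>))"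
    and u_cont: "continuous_on (UNIV \<times> {0..}) u"
    and u_sol: "visc_solution A f u"
    and u_growth: "exp_growth u"
begin

text \<open>The constant extension to negative times keeps \<open>u\<close> continuous, so that it can be mollified;
  the equation is only used at positive times.\<close>

definition W :: "pt \<Rightarrow> real" where
  "W P = u (sp P, max (tm P) 0)"

lemma continuous_on_W: "continuous_on UNIV W"
  unfolding W_def by (rule continuous_on_compose2 [OF u_cont]) (auto intro!: continuous_intros)

lemma continuous_on_W_translate: "continuous_on UNIV (\<lambda>P. W (H \<star> P))"
  by (rule continuous_on_compose2 [OF continuous_on_W]) (auto intro!: continuous_intros)

lemma W_eventually:
  assumes "tm P > 0"
  shows "\<forall>\<^sub>F Q in nhds 0. u (space_time (P \<star> Q)) = W (P \<star> Q)" "u (space_time P) = W P"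
proof -
  have eq: "u (space_time P) = W P" if "tm P > 0" for P
    using that by (cases P) (simp add: W_def max_def)
  show "u (space_time P) = W P" using assms by (rule eq)
  show "\<forall>\<^sub>F Q in nhds 0. u (space_time (P \<star> Q)) = W (P \<star> Q)"
    using eventually_gmul_continuous [OF continuous_on_tm [OF continuous_on_id] assms]
    by eventually_elim (rule eq)
qed

lemma W_sub:
  assumes "superjet W P (\<alpha>, (b1, b2), c, (m11, m12, m22))" "tm P > 0"
  shows "\<alpha> - (A$1$1 * m11 + (A$1$2 + A$2$1) * m12 + A$2$2 * m22) + f (sp P) (vector [b1, b2]) \<le> 0"
proof -
  obtain x y z t where P: "P = (x, y, z, t)" by (cases P) auto
  have "superjet (\<lambda>P. u (space_time P)) P (\<alpha>, (b1, b2), c, (m11, m12, m22))"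
    by (rule superjet_cong [OF assms(1) W_eventually [OF assms(2)]])
  then show ?thesis
    using visc_subsolution_superjet [of A f u t x y z] u_sol assms(2) by (simp add: P visc_solution_def)
qed

lemma W_super:
  assumes "subjet W P (\<alpha>, (b1, b2), c, (m11, m12, m22))" "tm P > 0"
  shows "\<alpha> - (A$1$1 * m11 + (A$1$2 + A$2$1) * m12 + A$2$2 * m22) + f (sp P) (vector [b1, b2]) \<ge> 0"
proof -
  obtain x y z t where P: "P = (x, y, z, t)" by (cases P) auto
  have "superjet (\<lambda>P. - u (space_time P)) P (- (\<alpha>, (b1, b2), c, (m11, m12, m22)))"
    by (rule superjet_cong [OF assms(1) [unfolded subjet_def]])
      (use W_eventually [OF assms(2)] in \<open>auto elim!: eventually_mono\<close>)
  then have "subjet (\<lambda>P. u (space_time P)) P (\<alpha>, (b1, b2), c, (m11, m12, m22))" unfolding subjet_def .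
  then show ?thesis
    using visc_supersolution_subjet [of A f u t x y z] u_sol assms(2) by (simp add: P visc_solution_def)
qed

lemma f_lipschitz:
  obtains L where "L \<ge> 0" "\<And>p w1 w2. \<bar>f p w1 - f p w2\<bar> \<le> L * norm (w1 - w2)"
  using A1 by (meson less_eq_real_def)

lemma continuous_on_f: "continuous_on UNIV (f p)"
proof -
  obtain L where L: "L \<ge> 0" "\<And>p w1 w2. \<bar>f p w1 - f p w2\<bar> \<le> L * norm (w1 - w2)" using f_lipschitz by blast
  have "L-lipschitz_on UNIV (f p)"
    by (rule lipschitz_onI) (use L in \<open>auto simp: dist_real_def dist_norm\<close>)
  then show ?thesis by (rule lipschitz_on_continuous_on)
qed

text \<open>The case of the zero translation in the concavity condition: \<open>f\<close> is
  midpoint concave in the gradient variable, and with continuity this gives the affine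
  majorants.\<close>

lemma f_midpoint: "f p \<xi> + f p \<eta> \<le> 2 * f p ((1/2) *\<^sub>R (\<xi> + \<eta>))"
proof -
  have "vector [0, 0, 0] \<in> horizontal" unfolding horizontal_def by blast
  moreover have "hinv (vector [0, 0, 0]) \<odot> p = p" "vector [0, 0, 0] \<odot> p = p"
    by (simp_all add: hinv_def hmult_def vec_eq_iff forall_3)
  ultimately show ?thesis using concavity by metis
qed

text \<open>The coefficients are frozen at the base point and \<open>f\<close> is replaced by an affine majorant
  touching at the gradient \<open>(b1, b2)\<close> of the mollification, which is possible by concavity.\<close>

lemma mollify_supersolution:
  assumes C: "compact C" and e: "e > 0"
  obtains d where "d > 0" "\<And>\<delta> P \<alpha> b1 b2 c m11 m12 m22 K. 0 < \<delta> \<Longrightarrow> \<delta> \<le> d \<Longrightarrow> P \<in> C \<Longrightarrow> \<delta> < tm P \<Longrightarrow>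
     tm H = 0 \<Longrightarrow> taylor2 (mollify \<delta> (\<lambda>P. W (H \<star> P))) P (\<alpha>, (b1, b2), c, (m11, m12, m22)) K \<Longrightarrow>
     0 \<le> \<alpha> - (A$1$1 * m11 + (A$1$2 + A$2$1) * m12 + A$2$2 * m22) + f (sp (H \<star> P)) (vector [b1, b2]) + e"
proof -
  obtain p1 p2 q1 q2 where A: "A$1$1 = p1\<^sup>2 + q1\<^sup>2" "A$1$2 = p1 * p2 + q1 * q2" "A$2$1 = p1 * p2 + q1 * q2"
    "A$2$2 = p2\<^sup>2 + q2\<^sup>2" using psd_factorization [OF A_sym A_psd] .
  have "compact ((\<lambda>X. sp (H \<star> (fst X \<star> snd X))) ` (cball 0 1 \<times> C))"
    by (intro compact_continuous_image compact_Times C continuous_intros) auto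
  from compact_imp_bounded [OF this]
  obtain \<rho>0 where \<rho>0': "\<rho>0 > 0" "\<And>y. y \<in> (\<lambda>X. sp (H \<star> (fst X \<star> snd X))) ` (cball 0 1 \<times> C) \<Longrightarrow> norm y \<le> \<rho>0"
    unfolding bounded_pos by blast
  have \<rho>0: "\<rho>0 > 0" "norm (sp (H \<star> (g \<star> P))) \<le> \<rho>0" if "norm g \<le> 1" "P \<in> C" for g P
    using \<rho>0'(1) that by (auto intro!: \<rho>0'(2) image_eqI [where x = "(g, P)"])
  define \<rho> where "\<rho> = \<rho>0 + 1"
  have "\<rho> > 0" using \<rho>0'(1) by (simp add: \<rho>_def)
  then have "\<exists>L2>0. \<forall>p q w. norm p \<le> \<rho> \<and> norm q \<le> \<rho> \<longrightarrow> \<bar>f p w - f q w\<bar> \<le> L2 * koranyi_gauge (p \<odot> hinv q)"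
    by (rule A2 [rule_format])
  then obtain L2 where L2: "L2 > 0"
    and L2': "\<forall>p q w. norm p \<le> \<rho> \<and> norm q \<le> \<rho> \<longrightarrow> \<bar>f p w - f q w\<bar> \<le> L2 * koranyi_gauge (p \<odot> hinv q)"
    by (elim exE conjE)
  \<comment> \<open>The quotient of \<open>H \<star> (g \<star> P)\<close> by
    \<open>H \<star> P\<close> is the conjugate of \<open>g\<close> by \<open>H\<close>. It does not
    depend on \<open>P\<close>, so one radius serves the whole compact set.\<close>
  define kq where "kq g = koranyi_gauge (sp (H \<star> g \<star> ginv H))" for g
  have kq: "continuous_on UNIV kq" unfolding kq_def by (intro continuous_intros)
  have "sp 0 = vector [0, 0, 0]" by (simp add: zero_prod_def)
  then have "kq 0 = 0" by (simp add: kq_def koranyi_gauge_def)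
  then have "\<forall>\<^sub>F g in nhds 0. kq g < e / (2 * L2)"
    using eventually_gmul_continuous [of "\<lambda>g. - kq g" "- (e / (2 * L2))" 0] kq e L2 by (simp add: continuous_on_minus)
  then obtain d1 where d1: "d1 > 0" "\<And>g. dist g 0 < d1 \<Longrightarrow> kq g < e / (2 * L2)"
    unfolding eventually_nhds_metric by blast
  show thesis
  proof (rule that [of "min 1 (d1 / 2)"])
    fix \<delta> P \<alpha> b1 b2 c m11 m12 m22 K
    assume \<delta>: "0 < \<delta>" "\<delta> \<le> min 1 (d1 / 2)" and P: "P \<in> C" and t: "\<delta> < tm P" and tH: "tm H = 0"
      and T: "taylor2 (mollify \<delta> (\<lambda>P. W (H \<star> P))) P (\<alpha>, (b1, b2), c, (m11, m12, m22)) K"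
    define b :: "real^2" where "b = vector [b1, b2]"
    \<comment> \<open>Half of \<open>e\<close> is spent on the approximate supergradient and the
      other half on freezing the base point of \<open>f\<close>; together they form the
      \<open>e\<close> in \<open>k\<close>.\<close>
    obtain a where a: "\<And>\<xi>. f (sp (H \<star> P)) \<xi> \<le> f (sp (H \<star> P)) b + a \<bullet> (\<xi> - b) + e / 2"
      using concave_supergradient [OF continuous_on_f f_midpoint, of "e / 2" "sp (H \<star> P)" b] e by auto
    have ab: "a \<bullet> (vector [x, y] - b) = a $ 1 * (x - b1) + a $ 2 * (y - b2)" for x y
      by (simp add: b_def inner_vec_def sum_2)
    define U where "U = {P'. 0 < tm P' \<and> norm (sp (H \<star> P')) < \<rho> \<and> L2 * koranyi_gauge (sp (H \<star> P' \<star> ginv (H \<star> P))) < e / 2}"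
    have U: "open U" unfolding U_def by (intro open_Collect_conj open_Collect_less continuous_intros)
    define k where "k = f (sp (H \<star> P)) b - (a $ 1 * b1 + a $ 2 * b2) + e"
    interpret op: left_invariant_operator "a $ 1" "a $ 2" p1 p2 q1 q2 .
    have nP: "norm (sp (H \<star> P)) \<le> \<rho>" using \<rho>0(2) [of 0, OF _ P] by (simp add: \<rho>_def)
    have "op.Lop (\<alpha>, (b1, b2), c, (m11, m12, m22)) \<le> k"
    proof (rule op.mollify_linear_supersolution [OF continuous_on_W_translate U \<delta>(1) _ _ T])
      fix P' J assume P': "P' \<in> U" and J: "subjet (\<lambda>P. W (H \<star> P)) P' J"
      obtain \<alpha>' b1' b2' c' n11 n12 n22 where Je: "J = (\<alpha>', (b1', b2'), c', (n11, n12, n22))" by (cases J) auto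
      have "subjet W (H \<star> P') J" using J by (simp add: subjet_def superjet_def gmul_assoc)
      then have 1: "0 \<le> \<alpha>' - (A$1$1 * n11 + (A$1$2 + A$2$1) * n12 + A$2$2 * n22) + f (sp (H \<star> P')) (vector [b1', b2'])"
        using P' tH unfolding Je by (intro W_super) (auto simp: U_def)
      have "\<bar>f (sp (H \<star> P')) (vector [b1', b2']) - f (sp (H \<star> P)) (vector [b1', b2'])\<bar>
          \<le> L2 * koranyi_gauge (sp (H \<star> P') \<odot> hinv (sp (H \<star> P)))"
        using P' nP by (intro L2' [rule_format]) (auto simp: U_def)
      also have "\<dots> < e / 2" using P' by (simp add: U_def sp_gmul [symmetric] sp_ginv [symmetric])
      finally have 2: "f (sp (H \<star> P')) (vector [b1', b2']) < f (sp (H \<star> P)) (vector [b1', b2']) + e / 2" by linarith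
      show "op.Lop J \<le> k"
        using 1 2 a [of "vector [b1', b2']"] unfolding ab unfolding Je op.Lop_simp k_def A by (simp add: algebra_simps)
    next
      fix g :: pt assume g: "norm g \<le> \<delta>"
      obtain g1 g2 g3 g4 where ge: "g = (g1, g2, g3, g4)" by (cases g) auto
      have "\<bar>g4\<bar> \<le> \<delta>" using abs_le_norm_pt [OF g [unfolded ge]] by simp
      then have 1: "0 < tm (g \<star> P)" using t by (simp add: ge abs_le_iff)
      have 2: "norm (sp (H \<star> (g \<star> P))) < \<rho>" using \<rho>0(2) [of g, OF _ P] g \<delta> by (simp add: \<rho>_def)
      have "H \<star> (g \<star> P) \<star> ginv (H \<star> P) = H \<star> g \<star> ginv H"
        by (simp add: ginv_gmul gmul_assoc)
      moreover have "kq g < e / (2 * L2)" using g \<delta> d1 by (intro d1(2)) (simp add: dist_norm)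
      ultimately have "L2 * koranyi_gauge (sp (H \<star> (g \<star> P) \<star> ginv (H \<star> P))) < e / 2"
        using L2 by (simp add: kq_def field_simps)
      then show "g \<star> P \<in> U" using 1 2 by (simp add: U_def)
    qed
    then show "0 \<le> \<alpha> - (A$1$1 * m11 + (A$1$2 + A$2$1) * m12 + A$2$2 * m22) + f (sp (H \<star> P)) (vector [b1, b2]) + e"
      unfolding op.Lop_simp k_def A b_def by (simp add: algebra_simps)
  qed (use d1 in simp)
qed

lemma W_growth:
  assumes "T > 0"
  obtains k C where "k > 0" "C > 0" "\<And>P. tm P \<le> T \<Longrightarrow> \<bar>W P\<bar> \<le> C * exp (k * hbracket P)"
proof -
  have "\<exists>k>0. \<exists>C>0. \<forall>p. \<forall>t\<in>{0..T}. \<bar>u (p, t)\<bar> \<le> C * exp (k * jbracket p)"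
    by (rule u_growth [unfolded exp_growth_def, rule_format, OF assms])
  then obtain k C where kC: "k > 0" "C > 0" "\<forall>p. \<forall>t\<in>{0..T}. \<bar>u (p, t)\<bar> \<le> C * exp (k * jbracket p)"
    by (elim exE conjE)
  have "\<bar>W P\<bar> \<le> C * exp (k * hbracket P)" if "tm P \<le> T" for P
  proof -
    have "jbracket (sp P) = hbracket P" by (cases P) (simp add: hbracket_def)
    moreover have "max (tm P) 0 \<in> {0..T}" using that assms by auto
    ultimately show ?thesis unfolding W_def using kC(3) [rule_format, of "max (tm P) 0" "sp P"] by simp
  qed
  with kC(1,2) show thesis by (rule that)
qed

end

section \<open>Comparison of the solution with the average of its translates\<close>

context viscosity_problem
begin

text \<open>The concavity condition bounds \<open>f\<close> at \<open>H \<star> Q0\<close> and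
  \<open>H' \<star> Q0\<close> with two gradients by twice \<open>f\<close> at \<open>Q0\<close>
  with their mean. Half the sum of the two approximate supersolution inequalities is then
  incompatible with the subsolution inequality for \<open>W\<close> at \<open>Q0\<close>, because
  the barrier contributes a margin larger than the accumulated errors.\<close>

lemma right_convex:
  assumes u0: "\<And>p. 2 * u (p, 0) \<le> u (vector [h1, h2, 0] \<odot> p, 0) + u (hinv (vector [h1, h2, 0]) \<odot> p, 0)"
    and tP: "0 \<le> tm Phat"
  shows "2 * W Phat \<le> W ((h1, h2, 0, 0) \<star> Phat) + W (ginv (h1, h2, 0, 0) \<star> Phat)"
proof (rule ccontr)
  assume neg: "\<not> 2 * W Phat \<le> W ((h1, h2, 0, 0) \<star> Phat) + W (ginv (h1, h2, 0, 0) \<star> Phat)"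
  define H :: pt where "H = (h1, h2, 0, 0)"
  define H' where "H' = ginv H"
  have H'e: "H' = (- h1, - h2, 0, 0)" by (simp add: H'_def H_def)
  have tH: "tm H = 0" "tm H' = 0" by (auto simp: H_def H'e)
  have spH: "sp H = vector [h1, h2, 0]" "sp H' = hinv (sp H)" unfolding H'_def sp_ginv by (simp_all add: H_def)
  have hor: "sp H \<in> horizontal" unfolding spH(1) horizontal_def by blast
  define V where "V P = (1 / 2) * W (H \<star> P) + (1 / 2) * W (H' \<star> P)" for P
  have V: "continuous_on UNIV V" unfolding V_def by (intro continuous_intros continuous_on_W_translate)
  have V0: "W P \<le> V P" if "tm P = 0" for P
    using u0 [of "sp P"] that spH by (simp add: V_def W_def tH sp_gmul)
  define \<gamma> where "\<gamma> = (W Phat - V Phat) / 2"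
  have \<gamma>: "\<gamma> > 0" using neg by (simp add: \<gamma>_def V_def H_def H'_def)
  have t0: "tm Phat > 0" using V0 [of Phat] \<gamma> tP by (cases "tm Phat = 0") (auto simp: \<gamma>_def)
  \<comment> \<open>A horizon exactly one unit after \<open>Phat\<close> makes the singular term of
    the barrier equal to \<eta> there.\<close>
  define T where "T = tm Phat + 1"
  have T: "T > 0" using t0 by (simp add: T_def)
  obtain k0 C0 where k0: "k0 > 0" "C0 > 0" and W0: "\<And>P. tm P \<le> T \<Longrightarrow> \<bar>W P\<bar> \<le> C0 * exp (k0 * hbracket P)"
    by (rule W_growth [OF T]) (rule that; blast)
  obtain c1 where c1: "c1 \<ge> 1" "\<And>P. hbracket (H \<star> P) \<le> c1 * hbracket P"
    using hbracket_translate unfolding H_def by blast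
  obtain c2 where c2: "c2 \<ge> 1" "\<And>P. hbracket (H' \<star> P) \<le> c2 * hbracket P"
    using hbracket_translate unfolding H'e by blast
  \<comment> \<open>One rate for \<open>W\<close> and both translates: \<open>c1 + c2\<close>
    dominates 1, \<open>c1\<close> and \<open>c2\<close>. The barrier uses \<open>k + 1\<close>, and
    the surplus factor confines the positivity set.\<close>
  define k where "k = k0 * (c1 + c2)"
  have k: "k > 0" using k0 c1 c2 by (simp add: k_def add_pos_pos)
  have WV: "W P - V P \<le> 2 * C0 * exp (k * hbracket P)" if "tm P \<le> T" for P
  proof -
    have hb: "hbracket P \<ge> 0" using hbracket_ge_1 [of P] by linarith
    have e: "\<bar>W P'\<bar> \<le> C0 * exp (k * hbracket P)" if "tm P' \<le> T" "hbracket P' \<le> (c1 + c2) * hbracket P" for P'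
    proof -
      have "k0 * hbracket P' \<le> k0 * ((c1 + c2) * hbracket P)" using that k0 by (intro mult_left_mono) auto
      then have "exp (k0 * hbracket P') \<le> exp (k * hbracket P)" by (simp add: k_def mult.assoc)
      then have "C0 * exp (k0 * hbracket P') \<le> C0 * exp (k * hbracket P)" using k0 by (intro mult_left_mono) auto
      then show ?thesis using W0 [OF that(1)] by linarith
    qed
    have "1 * hbracket P \<le> (c1 + c2) * hbracket P" "c1 * hbracket P \<le> (c1 + c2) * hbracket P" "c2 * hbracket P \<le> (c1 + c2) * hbracket P"
      using c1 c2 hb by (intro mult_right_mono; simp)+
    then have "\<bar>W P\<bar> \<le> C0 * exp (k * hbracket P)" "\<bar>W (H \<star> P)\<bar> \<le> C0 * exp (k * hbracket P)" "\<bar>W (H' \<star> P)\<bar> \<le> C0 * exp (k * hbracket P)"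
      using c1(2) [of P] c2(2) [of P] that tH by (auto intro!: e intro: order_trans)
    then show ?thesis unfolding V_def by argo
  qed
  obtain L where L: "L \<ge> 0" "\<And>p w1 w2. \<bar>f p w1 - f p w2\<bar> \<le> L * norm (w1 - w2)" using f_lipschitz by blast
  have k1: "k + 1 > 0" using k by simp
  obtain \<Lambda> where \<Lambda>: "\<Lambda> > 0" "\<And>\<epsilon> \<eta> T x y z t. \<epsilon> > 0 \<Longrightarrow> t < T \<Longrightarrow>
    \<exists>\<alpha> b1 b2 c m11 m12 m22. jet_at (growth_barrier (k + 1) \<Lambda> \<epsilon> \<eta> T) (x, y, z, t) (\<alpha>, (b1, b2), c, (m11, m12, m22)) \<and>
      \<eta> / (T - t)\<^sup>2 \<le> \<alpha> - (A$1$1 * m11 + 2 * ((A$1$2 + A$2$1) / 2) * m12 + A$2$2 * m22) - L * (\<bar>b1\<bar> + \<bar>b2\<bar>)"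
    by (rule growth_barrier_jet [OF k1 L(1)]) (rule that; blast)
  \<comment> \<open>Each summand of the barrier equals half of \<gamma> at \<open>Phat\<close>. As
    the gap there is twice \<gamma>, an excess of \<gamma> remains in \<open>E\<close>.\<close>
  define \<epsilon> where "\<epsilon> = \<gamma> / (2 * exp ((k + 1) * hbracket Phat + \<Lambda> * tm Phat))"
  define \<eta> where "\<eta> = \<gamma> / 2"
  have \<epsilon>\<eta>: "\<epsilon> > 0" "\<eta> > 0" using \<gamma> by (auto simp: \<epsilon>_def \<eta>_def)
  define B where "B = growth_barrier (k + 1) \<Lambda> \<epsilon> \<eta> T"
  have Be: "B P = \<epsilon> * exp ((k + 1) * hbracket P + \<Lambda> * tm P) + \<eta> / (T - tm P)" for P
    by (cases P) (simp add: B_def growth_barrier_def)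
  have BPhat: "B Phat = \<gamma>" unfolding Be by (simp add: \<epsilon>_def \<eta>_def T_def)
  define E where "E P = W P - V P - B P" for P
  have EPhat: "E Phat = \<gamma>" unfolding E_def BPhat \<gamma>_def by (simp add: field_simps)
  \<comment> \<open>Where \<open>E\<close> is positive the barrier lies below
    \<open>2 * C0 * exp (k * hbracket P)\<close>. Cancelling the common exponential leaves
    \<open>exp (hbracket P + \<Lambda> * tm P) < N0\<close>; the growth bound is then at most
    \<open>M\<close>, which in turn bounds the singular term and separates the time from
    \<open>T\<close>.\<close>
  define N0 where "N0 = 2 * C0 / \<epsilon>"
  define M where "M = 2 * C0 * exp (k * N0)"
  have M: "M > 0" using k0 by (simp add: M_def)
  define T1 where "T1 = T - \<eta> / M"
  have T1: "T1 < T" using \<epsilon>\<eta> M by (simp add: T1_def)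
  have loc: "hbracket P < N0 \<and> tm P < T1" if "0 \<le> tm P" "tm P < T" "E P > 0" for P
  proof -
    have hb: "hbracket P \<ge> 1" by (rule hbracket_ge_1)
    have Tt: "\<eta> / (T - tm P) > 0" using that \<epsilon>\<eta> by simp
    have ex: "\<epsilon> * exp ((k + 1) * hbracket P + \<Lambda> * tm P) > 0" using \<epsilon>\<eta> by simp
    have 1: "B P < 2 * C0 * exp (k * hbracket P)" using WV [of P] that unfolding E_def by linarith
    have 2: "exp ((k + 1) * hbracket P + \<Lambda> * tm P) = exp (k * hbracket P) * exp (hbracket P + \<Lambda> * tm P)"
      by (simp add: exp_add [symmetric] algebra_simps)
    have "\<epsilon> * (exp (k * hbracket P) * exp (hbracket P + \<Lambda> * tm P)) < 2 * C0 * exp (k * hbracket P)"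
      using 1 Tt unfolding Be 2 by linarith
    then have "(\<epsilon> * exp (hbracket P + \<Lambda> * tm P)) * exp (k * hbracket P) < (2 * C0) * exp (k * hbracket P)"
      by (simp only: mult_ac)
    then have "\<epsilon> * exp (hbracket P + \<Lambda> * tm P) < 2 * C0" by (rule mult_right_less_imp_less) simp
    then have "exp (hbracket P + \<Lambda> * tm P) < N0" using \<epsilon>\<eta> by (simp add: N0_def pos_less_divide_eq mult.commute)
    moreover have "0 \<le> \<Lambda> * tm P" using \<Lambda> that by simp
    then have "hbracket P \<le> exp (hbracket P + \<Lambda> * tm P)" using exp_ge_add_one_self [of "hbracket P + \<Lambda> * tm P"] by linarith
    ultimately have N: "hbracket P < N0" by linarith
    then have "k * hbracket P \<le> k * N0" using k by (intro mult_left_mono) auto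
    then have "2 * C0 * exp (k * hbracket P) \<le> M" using k0 by (simp add: M_def)
    then have "\<eta> / (T - tm P) < M" using 1 ex unfolding Be by linarith
    then have "\<eta> < M * (T - tm P)" using that by (simp add: pos_divide_less_eq)
    then have "\<eta> / M < T - tm P" using M by (simp add: pos_divide_less_eq mult.commute)
    then show ?thesis using N by (simp add: T1_def)
  qed
  define D where "D = {P. hbracket P \<le> N0 \<and> 0 \<le> tm P \<and> tm P \<le> T1}"
  have D: "compact D"
  proof -
    have "closed D" unfolding D_def
      by (intro closed_Collect_conj closed_Collect_le continuous_intros)
    moreover have "bounded D"
    proof (rule boundedI)
      fix P assume P: "P \<in> D"
      obtain x y z t where Pe: "P = (x, y, z, t)" by (cases P) auto
      have "hbracket (x, y, z, t) \<le> N0" using P by (simp add: D_def Pe)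
      note c = hbracket_components [where x = x and y = y and z = z and t = t, OF this]
      have "\<bar>t\<bar> \<le> T1" using P by (auto simp: D_def Pe)
      then have "\<bar>x\<bar> + \<bar>y\<bar> + \<bar>z\<bar> + \<bar>t\<bar> \<le> N0 + N0 + N0\<^sup>2 / 4 + T1" using c by linarith
      then show "norm P \<le> N0 + N0 + N0\<^sup>2 / 4 + T1" unfolding Pe using norm_pt_le [of x y z t] by linarith
    qed
    ultimately show ?thesis by (simp add: compact_eq_bounded_closed)
  qed
  have cB: "continuous_on D B"
    unfolding Be [abs_def] by (intro continuous_intros) (use T1 in \<open>auto simp: D_def\<close>)
  have cE: "continuous_on D E" unfolding E_def
    by (intro continuous_intros cB continuous_on_subset [OF V] continuous_on_subset [OF continuous_on_W]) auto
  \<comment> \<open>A compact set fixed before mollifying that will contain the later maximum point.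
    Its earliest time is positive by the initial comparison, so a mollification radius below that
    time uses only points of positive time.\<close>
  define D1 where "D1 = {P \<in> D. \<gamma> / 2 \<le> E P}"
  have D1: "compact D1" "D1 \<subseteq> D"
  proof -
    have "closed D1" unfolding D1_def
      by (intro continuous_on_closed_Collect_le cE compact_imp_closed D continuous_on_const)
    moreover show "D1 \<subseteq> D" by (auto simp: D1_def)
    ultimately show "compact D1" using D compact_Int_closed [of D D1] by (simp add: Int_absorb1)
  qed
  have "hbracket Phat < N0 \<and> tm Phat < T1" using loc [of Phat] EPhat \<gamma> t0 by (simp add: T_def)
  then have PhatD: "Phat \<in> D" "Phat \<in> D1" using t0 EPhat \<gamma> by (auto simp: D_def D1_def)
  obtain Pm where Pm: "Pm \<in> D1" "\<And>P. P \<in> D1 \<Longrightarrow> tm Pm \<le> tm P"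
    using continuous_attains_inf [OF D1(1), of tm] PhatD continuous_on_tm [OF continuous_on_id] by blast
  have tm0: "tm Pm > 0"
  proof (rule ccontr)
    assume "\<not> tm Pm > 0"
    then have t: "tm Pm = 0" using Pm(1) by (auto simp: D1_def D_def)
    then have "W Pm \<le> V Pm" by (rule V0)
    moreover have "B Pm > 0" unfolding Be using \<epsilon>\<eta> T t by (auto intro!: add_pos_pos)
    ultimately have "E Pm < 0" by (simp add: E_def)
    then show False using Pm(1) \<gamma> by (simp add: D1_def)
  qed
  \<comment> \<open>Each translate loses \<open>e\<close>, so their average loses \<open>e\<close>,
    while the barrier provides at least \<open>\<eta> / T\<^sup>2 = 2 * e\<close>.\<close>
  define e where "e = \<eta> / (2 * T\<^sup>2)"
  have e: "e > 0" using \<epsilon>\<eta> T by (simp add: e_def)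
  obtain d1 where d1: "d1 > 0" "\<And>\<delta> P \<alpha> b1 b2 c m11 m12 m22 K. 0 < \<delta> \<Longrightarrow> \<delta> \<le> d1 \<Longrightarrow> P \<in> D1 \<Longrightarrow> \<delta> < tm P \<Longrightarrow>
     tm H = 0 \<Longrightarrow> taylor2 (mollify \<delta> (\<lambda>P. W (H \<star> P))) P (\<alpha>, (b1, b2), c, (m11, m12, m22)) K \<Longrightarrow>
     0 \<le> \<alpha> - (A$1$1 * m11 + (A$1$2 + A$2$1) * m12 + A$2$2 * m22) + f (sp (H \<star> P)) (vector [b1, b2]) + e"
    by (rule mollify_supersolution [OF D1(1) e, where H = H]) (rule that; blast)
  obtain d2 where d2: "d2 > 0" "\<And>\<delta> P \<alpha> b1 b2 c m11 m12 m22 K. 0 < \<delta> \<Longrightarrow> \<delta> \<le> d2 \<Longrightarrow> P \<in> D1 \<Longrightarrow> \<delta> < tm P \<Longrightarrow>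
     tm H' = 0 \<Longrightarrow> taylor2 (mollify \<delta> (\<lambda>P. W (H' \<star> P))) P (\<alpha>, (b1, b2), c, (m11, m12, m22)) K \<Longrightarrow>
     0 \<le> \<alpha> - (A$1$1 * m11 + (A$1$2 + A$2$1) * m12 + A$2$2 * m22) + f (sp (H' \<star> P)) (vector [b1, b2]) + e"
    by (rule mollify_supersolution [OF D1(1) e, where H = H']) (rule that; blast)
  have "\<gamma> / 8 > 0" using \<gamma> by simp
  obtain d3 where d3: "d3 > 0" "\<And>\<delta>' P. 0 < \<delta>' \<Longrightarrow> \<delta>' \<le> d3 \<Longrightarrow> P \<in> D \<Longrightarrow> \<bar>mollify \<delta>' V P - V P\<bar> \<le> \<gamma> / 8"
    using mollify_uniform [OF V D \<open>\<gamma> / 8 > 0\<close>] by metis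
  define \<delta> where "\<delta> = min (min d1 d2) (min d3 (tm Pm / 2))"
  have \<delta>: "\<delta> > 0" "\<delta> \<le> d1" "\<delta> \<le> d2" "\<delta> \<le> d3" "\<delta> < tm Pm" using d1(1) d2(1) d3(1) tm0 by (auto simp: \<delta>_def)
  have cm: "isCont (mollify \<delta> V) P" for P
  proof -
    obtain J K where "taylor2 (mollify \<delta> V) P J K" using mollify_taylor2_exists [OF \<delta>(1) V] .
    then show ?thesis by (intro jet_at_isCont taylor2_jet_at)
  qed
  define E' where "E' P = W P - mollify \<delta> V P - B P" for P
  have "continuous_on D E'" unfolding E'_def
    by (intro continuous_intros cB continuous_on_subset [OF continuous_on_W] continuous_at_imp_continuous_on ballI cm) auto
  then obtain Q0 where Q0: "Q0 \<in> D" "\<And>P. P \<in> D \<Longrightarrow> E' P \<le> E' Q0"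
    using continuous_attains_sup [OF D] PhatD(1) by blast
  have EE: "\<bar>E' P - E P\<bar> \<le> \<gamma> / 8" if "P \<in> D" for P
    using d3(2) [OF \<delta>(1,4) that] unfolding E'_def E_def by linarith
  \<comment> \<open>Passing between \<open>E'\<close> and \<open>E\<close> costs an eighth of
    \<gamma> at \<open>Q0\<close> and another at \<open>Phat\<close>, which leaves three quarters of
    the excess \<gamma> at \<open>Phat\<close>.\<close>
  have EQ: "\<gamma> / 2 \<le> E Q0" using EE [OF Q0(1)] EE [OF PhatD(1)] Q0(2) [OF PhatD(1)] EPhat \<gamma> by linarith
  have Q1: "Q0 \<in> D1" using Q0(1) EQ by (simp add: D1_def)
  have tQ: "\<delta> < tm Q0" "0 < tm Q0" using Pm(2) [OF Q1] \<delta> by linarith+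
  have tQT: "tm Q0 < T" using Q0(1) T1 by (simp add: D_def)
  \<comment> \<open>The localization gives strict inequalities and \<open>Q0\<close> has positive
    time, so \<open>Q0\<close> is interior to \<open>D\<close> and the maximum over \<open>D\<close>
    is a local one.\<close>
  have lQ: "hbracket Q0 < N0" "tm Q0 < T1" using loc [OF less_imp_le [OF tQ(2)] tQT] EQ \<gamma> by auto
  have inD: "\<forall>\<^sub>F Q in nhds 0. Q0 \<star> Q \<in> D"
  proof -
    have "open {P. hbracket P < N0 \<and> 0 < tm P \<and> tm P < T1}"
      by (intro open_Collect_conj open_Collect_less continuous_intros)
    from eventually_gmul [OF this, of Q0] lQ tQ show ?thesis
      by (auto simp: D_def elim: eventually_mono)
  qed
  obtain J1 K1 where J1: "taylor2 (mollify \<delta> (\<lambda>P. W (H \<star> P))) Q0 J1 K1"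
    using mollify_taylor2_exists [OF \<delta>(1) continuous_on_W_translate] .
  obtain J2 K2 where J2: "taylor2 (mollify \<delta> (\<lambda>P. W (H' \<star> P))) Q0 J2 K2"
    using mollify_taylor2_exists [OF \<delta>(1) continuous_on_W_translate] .
  obtain x y z t where Qe: "Q0 = (x, y, z, t)" by (cases Q0) auto
  obtain \<alpha> b1 b2 c m11 m12 m22 where J3: "jet_at B Q0 (\<alpha>, (b1, b2), c, (m11, m12, m22))"
    and J3': "\<eta> / (T - tm Q0)\<^sup>2 \<le> \<alpha> - (A$1$1 * m11 + 2 * ((A$1$2 + A$2$1) / 2) * m12 + A$2$2 * m22) - L * (\<bar>b1\<bar> + \<bar>b2\<bar>)"
    using \<Lambda>(2) [OF \<epsilon>\<eta>(1), of t T \<eta> x y z] tQT unfolding B_def Qe tm_simp by blast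
  obtain \<alpha>1 b11 b12 c1 n11 n12 n22 where J1e: "J1 = (\<alpha>1, (b11, b12), c1, (n11, n12, n22))" by (cases J1) auto
  obtain \<alpha>2 b21 b22 c2 o11 o12 o22 where J2e: "J2 = (\<alpha>2, (b21, b22), c2, (o11, o12, o22))" by (cases J2) auto
  have mV: "mollify \<delta> V P = (1 / 2) * mollify \<delta> (\<lambda>P. W (H \<star> P)) P + (1 / 2) * mollify \<delta> (\<lambda>P. W (H' \<star> P)) P" for P
    unfolding V_def [abs_def] mollify_cmul [symmetric]
    by (intro mollify_add \<delta> continuous_intros continuous_on_W_translate)
  have "jet_at (\<lambda>P. (1 / 2) * mollify \<delta> (\<lambda>P. W (H \<star> P)) P + (1 / 2) * mollify \<delta> (\<lambda>P. W (H' \<star> P)) P + B P) Q0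
      ((1 / 2) *\<^sub>R J1 + (1 / 2) *\<^sub>R J2 + (\<alpha>, (b1, b2), c, (m11, m12, m22)))"
    by (intro jet_at_add jet_at_cmul taylor2_jet_at [OF J1] taylor2_jet_at [OF J2] J3)
  moreover have "\<forall>\<^sub>F Q in nhds 0. W (Q0 \<star> Q) - W Q0
      \<le> (1 / 2) * mollify \<delta> (\<lambda>P. W (H \<star> P)) (Q0 \<star> Q) + (1 / 2) * mollify \<delta> (\<lambda>P. W (H' \<star> P)) (Q0 \<star> Q) + B (Q0 \<star> Q)
       - ((1 / 2) * mollify \<delta> (\<lambda>P. W (H \<star> P)) Q0 + (1 / 2) * mollify \<delta> (\<lambda>P. W (H' \<star> P)) Q0 + B Q0)"
    using inD
  proof eventually_elim
    case (elim Q)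
    from Q0(2) [OF this] show ?case unfolding E'_def mV by linarith
  qed
  ultimately have "superjet W Q0 ((1 / 2) *\<^sub>R J1 + (1 / 2) *\<^sub>R J2 + (\<alpha>, (b1, b2), c, (m11, m12, m22)))"
    by (rule superjet_of_touching)
  then have sj: "superjet W Q0 (\<alpha>1 / 2 + \<alpha>2 / 2 + \<alpha>, (b11 / 2 + b21 / 2 + b1, b12 / 2 + b22 / 2 + b2), c1 / 2 + c2 / 2 + c,
      (n11 / 2 + o11 / 2 + m11, n12 / 2 + o12 / 2 + m12, n22 / 2 + o22 / 2 + m22))"
    by (simp add: J1e J2e)
  have S: "\<alpha>1 / 2 + \<alpha>2 / 2 + \<alpha> - (A$1$1 * (n11 / 2 + o11 / 2 + m11) + (A$1$2 + A$2$1) * (n12 / 2 + o12 / 2 + m12) + A$2$2 * (n22 / 2 + o22 / 2 + m22))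
      + f (sp Q0) (vector [b11 / 2 + b21 / 2 + b1, b12 / 2 + b22 / 2 + b2]) \<le> 0"
    by (rule W_sub [OF sj tQ(2)])
  \<comment> \<open>The mean of the two gradients; it differs from the gradient in the superjet of
    \<open>W\<close> by that of the barrier, which the Lipschitz bound in (A1) pays for.\<close>
  define w :: "real^2" where "w = (1 / 2) *\<^sub>R (vector [b21, b22] + vector [b11, b12])"
  have "f (sp Q0) w - f (sp Q0) (vector [b11 / 2 + b21 / 2 + b1, b12 / 2 + b22 / 2 + b2]) \<le> L * (\<bar>b1\<bar> + \<bar>b2\<bar>)"
  proof -
    have "w - vector [b11 / 2 + b21 / 2 + b1, b12 / 2 + b22 / 2 + b2] = (vector [- b1, - b2] :: real^2)"
      by (simp add: w_def vec_eq_iff forall_2 field_simps)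
    moreover have "norm (vector [- b1, - b2] :: real^2) \<le> \<bar>b1\<bar> + \<bar>b2\<bar>"
      using norm_le_l1_cart [of "vector [- b1, - b2] :: real^2"] by (simp add: sum_2)
    ultimately have "L * norm (w - vector [b11 / 2 + b21 / 2 + b1, b12 / 2 + b22 / 2 + b2]) \<le> L * (\<bar>b1\<bar> + \<bar>b2\<bar>)"
      using L(1) by (intro mult_left_mono) auto
    then show ?thesis using L(2) [of "sp Q0" w "vector [b11 / 2 + b21 / 2 + b1, b12 / 2 + b22 / 2 + b2]"] by linarith
  qed
  moreover have "f (sp (H' \<star> Q0)) (vector [b21, b22]) + f (sp (H \<star> Q0)) (vector [b11, b12]) \<le> 2 * f (sp Q0) w"
    unfolding w_def sp_gmul spH(2) using concavity hor by blast
  moreover have "0 \<le> \<alpha>1 - (A$1$1 * n11 + (A$1$2 + A$2$1) * n12 + A$2$2 * n22) + f (sp (H \<star> Q0)) (vector [b11, b12]) + e"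
    by (rule d1(2) [OF \<delta>(1,2) Q1 tQ(1) tH(1) J1 [unfolded J1e]])
  moreover have "0 \<le> \<alpha>2 - (A$1$1 * o11 + (A$1$2 + A$2$1) * o12 + A$2$2 * o22) + f (sp (H' \<star> Q0)) (vector [b21, b22]) + e"
    by (rule d2(2) [OF \<delta>(1,3) Q1 tQ(1) tH(2) J2 [unfolded J2e]])
  moreover have "2 * e \<le> \<eta> / (T - tm Q0)\<^sup>2"
  proof -
    have "(T - tm Q0)\<^sup>2 \<le> T\<^sup>2" using tQ tQT by (intro power_mono) auto
    then have "\<eta> / T\<^sup>2 \<le> \<eta> / (T - tm Q0)\<^sup>2" using \<epsilon>\<eta> tQT T by (intro divide_left_mono) (auto intro!: mult_pos_pos)
    then show ?thesis by (simp add: e_def)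
  qed
  moreover have "A$1$1 * (n11 / 2 + o11 / 2 + m11) + (A$1$2 + A$2$1) * (n12 / 2 + o12 / 2 + m12) + A$2$2 * (n22 / 2 + o22 / 2 + m22)
     = (A$1$1 * n11 + (A$1$2 + A$2$1) * n12 + A$2$2 * n22) / 2 + (A$1$1 * o11 + (A$1$2 + A$2$1) * o12 + A$2$2 * o22) / 2
       + (A$1$1 * m11 + 2 * ((A$1$2 + A$2$1) / 2) * m12 + A$2$2 * m22)"
    by (simp add: field_simps)
  ultimately show False using S J3' e by argo
qed

end


text \<open>h-convexity concerns the right translates \<open>p \<odot> h\<close>, whereas the
  comparison controls the left translates \<open>h \<odot> p\<close>. An involution preserving
  \<open>w\<close> that exchanges the two sums over plus and minus \<open>h\<close> bridges the
  difference, and one exists for each of the three structures.\<close>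

lemma symmetric_involution:
  assumes "even_fun w \<or> vertically_even w \<or> separable_fun w"
  obtains \<iota> where "\<And>p. \<iota> (\<iota> p) = p" "\<And>p. w (\<iota> p) = w p"
    "\<And>p h. h \<in> horizontal \<Longrightarrow> w (p \<odot> hinv h) + w (p \<odot> h) = w (h \<odot> \<iota> p) + w (hinv h \<odot> \<iota> p)"
proof -
  have inv: "hinv (hinv p) = p" "hinv (p \<odot> q) = hinv q \<odot> hinv p" for p q
    by (simp_all add: hinv_def hmult_def vec_eq_iff forall_3 field_simps)
  consider "even_fun w" | "vertically_even w" | "separable_fun w" using assms by blast
  then show thesis
  proof cases
    case 1
    then have e: "w (hinv p) = w p" for p by (simp add: even_fun_def)
    show thesis
    proof (rule that [of hinv])
      show "w (p \<odot> hinv h) + w (p \<odot> h) = w (h \<odot> hinv p) + w (hinv h \<odot> hinv p)" for p h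
        using e [of "p \<odot> hinv h"] e [of "p \<odot> h"] by (simp add: inv)
    qed (auto simp: inv e)
  next
    case 2
    \<comment> \<open>Reversing the central coordinate is an anti-automorphism of the group that
      fixes the horizontal points.\<close>
    define \<iota> :: "real^3 \<Rightarrow> real^3" where "\<iota> p = vector [p$1, p$2, - (p$3)]" for p
    have e: "w (\<iota> p) = w p" for p
      using 2 vector3_eta [of p] unfolding vertically_even_def \<iota>_def by metis
    show thesis
    proof (rule that [of \<iota>])
      show "\<iota> (\<iota> p) = p" for p by (simp add: \<iota>_def vec_eq_iff forall_3)
      show "w (\<iota> p) = w p" for p by (rule e)
      fix p h :: "real^3" assume "h \<in> horizontal"
      then obtain h1 h2 where h: "h = vector [h1, h2, 0]" by (auto simp: horizontal_def)
      have "\<iota> (p \<odot> hinv h) = hinv h \<odot> \<iota> p" "\<iota> (p \<odot> h) = h \<odot> \<iota> p"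
        by (simp_all add: \<iota>_def h hinv_def hmult_def vec_eq_iff forall_3 field_simps)
      then show "w (p \<odot> hinv h) + w (p \<odot> h) = w (h \<odot> \<iota> p) + w (hinv h \<odot> \<iota> p)"
        by (metis add.commute e)
    qed
  next
    case 3
    then obtain a b where ab: "\<And>x y z. w (vector [x, y, z]) = a x y + b z" by (auto simp: separable_fun_def)
    show thesis
    proof (rule that [of "\<lambda>p. p"])
      fix p h :: "real^3" assume "h \<in> horizontal"
      then obtain h1 h2 where h: "h = vector [h1, h2, 0]" by (auto simp: horizontal_def)
      \<comment> \<open>Left and right translates have the same horizontal part and opposite central
        shifts. In a separable function the terms in \<open>a\<close> and in \<open>b\<close> can be
        regrouped independently, so the two sums agree and the identity serves as
        involution.\<close>
      define s where "s = (p$1 * h2 - h1 * p$2) / 2"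
      have "p \<odot> h = vector [p$1 + h1, p$2 + h2, p$3 + s]" "hinv h \<odot> p = vector [p$1 - h1, p$2 - h2, p$3 + s]"
        "p \<odot> hinv h = vector [p$1 - h1, p$2 - h2, p$3 - s]" "h \<odot> p = vector [p$1 + h1, p$2 + h2, p$3 - s]"
        by (simp_all add: h s_def hinv_def hmult_def vec_eq_iff forall_3 field_simps)
      then show "w (p \<odot> hinv h) + w (p \<odot> h) = w (h \<odot> p) + w (hinv h \<odot> p)" by (simp add: ab)
    qed auto
  qed
qed

lemma convex_along_translations_iff:
  assumes "even_fun w \<or> vertically_even w \<or> separable_fun w"
  shows "(\<forall>p. \<forall>h\<in>horizontal. w (p \<odot> hinv h) + w (p \<odot> h) \<ge> 2 * w p)
     \<longleftrightarrow> (\<forall>p. \<forall>h\<in>horizontal. w (h \<odot> p) + w (hinv h \<odot> p) \<ge> 2 * w p)"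
proof -
  obtain \<iota> where i: "\<And>p. \<iota> (\<iota> p) = p" "\<And>p. w (\<iota> p) = w p"
    "\<And>p h. h \<in> horizontal \<Longrightarrow> w (p \<odot> hinv h) + w (p \<odot> h) = w (h \<odot> \<iota> p) + w (hinv h \<odot> \<iota> p)"
    using symmetric_involution [OF assms] by blast
  show ?thesis
  proof (intro iffI allI ballI)
    fix p h assume *: "\<forall>p. \<forall>h\<in>horizontal. w (p \<odot> hinv h) + w (p \<odot> h) \<ge> 2 * w p" and h: "h \<in> horizontal"
    show "w (h \<odot> p) + w (hinv h \<odot> p) \<ge> 2 * w p" using * [rule_format, OF h, of "\<iota> p"] i(3) [OF h, of "\<iota> p"] by (simp add: i)
  next
    fix p h assume *: "\<forall>p. \<forall>h\<in>horizontal. w (h \<odot> p) + w (hinv h \<odot> p) \<ge> 2 * w p" and h: "h \<in> horizontal"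
    show "w (p \<odot> hinv h) + w (p \<odot> h) \<ge> 2 * w p" using * [rule_format, OF h, of "\<iota> p"] i(3) [OF h, of p] by (simp add: i)
  qed
qed

theorem corollary5p8:
  fixes A :: "real^2^2"
    and f :: "real^3 \<Rightarrow> real^2 \<Rightarrow> real"
    and u :: "(real^3) \<times> real \<Rightarrow> real"
    and u0 :: "real^3 \<Rightarrow> real"
  assumes A_sym: "transpose A = A"
    and A_psd: "\<forall>v. 0 \<le> v \<bullet> (A *v v)"
    and A1: "\<exists>L1>0. \<forall>p w1 w2. \<bar>f p w1 - f p w2\<bar> \<le> L1 * norm (w1 - w2)"
    and A2: "\<forall>\<rho>>0. \<exists>L2>0. \<forall>p q w. norm p \<le> \<rho> \<and> norm q \<le> \<rho> \<longrightarrow>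
               \<bar>f p w - f q w\<bar> \<le> L2 * koranyi_gauge (p \<odot> hinv q)"
    and A3: "\<exists>Cf>0. \<forall>p \<xi>. \<bar>f p \<xi>\<bar> \<le> Cf * (1 + norm \<xi>)"
    and concavity: "\<forall>p. \<forall>h\<in>horizontal. \<forall>\<xi> \<eta>.
               f (hinv h \<odot> p) \<xi> + f (h \<odot> p) \<eta> \<le> 2 * f p ((1/2) *\<^sub>R (\<xi> + \<eta>))"
    and u_cont: "continuous_on (UNIV \<times> {0..}) u"
    and u_sol: "visc_solution A f u"
    and u_init: "\<forall>p. u (p, 0) = u0 p"
    and u_growth: "exp_growth u"
    and u_struct: "\<forall>t\<ge>0. even_fun (\<lambda>p. u (p, t)) \<or> vertically_even (\<lambda>p. u (p, t))
               \<or> separable_fun (\<lambda>p. u (p, t))"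
    and u0_convex: "h_convex u0"
  shows "\<forall>t\<ge>0. h_convex (\<lambda>p. u (p, t))"
proof (intro allI impI)
  fix t :: real assume t: "t \<ge> 0"
  interpret viscosity_problem A f u
    by (rule viscosity_problem.intro [OF A_sym A_psd A1 A2 concavity u_cont u_sol u_growth])
  \<comment> \<open>The structure at time 0 gives convexity of the initial data along left
    translates; the structure at time \<open>t\<close> is what converts the conclusion back to right
    translates.\<close>
  have "even_fun u0 \<or> vertically_even u0 \<or> separable_fun u0"
    using u_struct [rule_format, of 0] u_init by simp
  from convex_along_translations_iff [OF this] u0_convex
  have r0: "\<forall>p. \<forall>h\<in>horizontal. u0 (h \<odot> p) + u0 (hinv h \<odot> p) \<ge> 2 * u0 p" by (simp add: h_convex_def)
  have "\<forall>p. \<forall>h\<in>horizontal. u (h \<odot> p, t) + u (hinv h \<odot> p, t) \<ge> 2 * u (p, t)"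
  proof (intro allI ballI)
    fix p h :: "real^3" assume h: "h \<in> horizontal"
    then obtain h1 h2 where he: "h = vector [h1, h2, 0]" by (auto simp: horizontal_def)
    define P where "P = (p$1, p$2, p$3, t)"
    have P: "sp P = p" "tm P = t" by (simp_all add: P_def vector3_eta)
    have "2 * W P \<le> W ((h1, h2, 0, 0) \<star> P) + W (ginv (h1, h2, 0, 0) \<star> P)"
      by (rule right_convex) (use r0 h he u_init P t in auto)
    moreover have "sp ((h1, h2, 0, 0) \<star> P) = h \<odot> p" unfolding sp_gmul P by (simp add: he)
    moreover have "sp (ginv (h1, h2, 0, 0) \<star> P) = hinv h \<odot> p" unfolding sp_gmul sp_ginv P by (simp add: he)
    moreover have "tm ((h1, h2, 0, 0) \<star> P) = t" "tm (ginv (h1, h2, 0, 0) \<star> P) = t" by (simp_all add: P)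
    ultimately show "u (h \<odot> p, t) + u (hinv h \<odot> p, t) \<ge> 2 * u (p, t)"
      using t P unfolding W_def by (simp only: max_absorb1)
  qed
  then have "\<forall>p. \<forall>h\<in>horizontal. u (p \<odot> hinv h, t) + u (p \<odot> h, t) \<ge> 2 * u (p, t)"
    using convex_along_translations_iff [of "\<lambda>p. u (p, t)"] u_struct t by blast
  moreover have "usc_on UNIV (\<lambda>p. u (p, t))"
  proof -
    have "continuous_on UNIV (\<lambda>p. u (p, t))"
      by (rule continuous_on_compose2 [OF u_cont]) (use t in \<open>auto intro!: continuous_intros\<close>)
    then have "((\<lambda>p. u (p, t)) \<longlongrightarrow> u (p, t)) (at p)" for p
      by (simp add: continuous_on_def)
    then show ?thesis unfolding usc_on_def using order_tendstoD(2) by blast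
  qed
  ultimately show "h_convex (\<lambda>p. u (p, t))" by (simp add: h_convex_def)
qed

end
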